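(* Let $\{f=0\}$ and $\{g=0\}$ be two reduced curves of degree $n\ge 1$ in $\mathbb{P}^2$ with no common component, and let $\mathcal{C}(f,g)=\{C_{\alpha,\beta}=\{\alpha f+\beta g=0\}\mid (\alpha,\beta)\in\mathbb{P}^1\}$ be the pencil they generate. Assume that the general member of $\mathcal{C}(f,g)$ is a smooth curve, that $C_{\alpha,\beta}$ is reduced for every $(\alpha,\beta)\in\mathbb{P}^1$, and that the base locus of the pencil is smooth, i.e. consists of $n^2$ distinct points. Let $k>1$ and let $D_k$ be a union of $k$ distinct members of $\mathcal{C}(f,g)$. Let $D^{\mathrm{sg}}$ be the union of all the singular members of the pencil and let $\mathrm{Sing}(\mathcal{C})$ be the set of all singular points of members of the pencil. Then $D_k$ is free with exponents $(2n-2,\,n(k-2)+1)$ if and only if $D_k\supseteq D^{\mathrm{sg}}$ and the Jacobian ideal $\mathcal{J}_{\nabla D_k}$ is locally a complete intersection at every $p\in\mathrm{Sing}(\mathcal{C})$.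
   Context: $\mathbb{K}$ is a field of characteristic zero, $S=\mathbb{K}[x,y,z]$ and $\mathbb{P}^2=\mathrm{Proj}(S)$. For a homogeneous polynomial $F\in S$, $\nabla F=(\partial_xF,\partial_yF,\partial_zF)$. For a reduced curve $D=\{F=0\}\subset\mathbb{P}^2$ of degree $d$, the Jacobian ideal sheaf $\mathcal{J}_{\nabla D}=\mathcal{J}_{\nabla F}\subset\mathcal{O}_{\mathbb{P}^2}$ is the ideal sheaf generated by the partial derivatives of $F$, and $\mathcal{T}_D$ is the rank two vector bundle defined by the exact sequence $$0\to\mathcal{T}_D\to\mathcal{O}_{\mathbb{P}^2}^3\xrightarrow{\nabla F}\mathcal{J}_{\nabla F}(d-1)\to 0.$$ The curve $D$ is free with exponents $(a,b)\in\mathbb{N}^2$ if $\mathcal{T}_D\simeq\mathcal{O}_{\mathbb{P}^2}(-a)\oplus\mathcal{O}_{\mathbb{P}^2}(-b)$. The Jacobian ideal is locally a complete intersection at $p$ if its localization at $p$ can be generated by two elements. *)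

theory Defs
  imports
    "HOL-Analysis.Cartesian_Space"
    "HOL-Computational_Algebra.Computational_Algebra"
    "HOL-Algebra.Algebraic_Closure_Type"
begin

text \<open>K[x,y,z] is K[x][y][z]: the outermost variable is z. The monomial
  x^i y^j z^k has coefficient \<open>coeff (coeff (coeff F k) j) i\<close>.\<close>

type_synonym 'a poly3 = "'a poly poly poly"

definition coeff3 :: "'a::zero poly3 \<Rightarrow> nat \<Rightarrow> nat \<Rightarrow> nat \<Rightarrow> 'a" where
  "coeff3 F i j k = Polynomial.coeff (Polynomial.coeff (Polynomial.coeff F k) j) i"

text \<open>The zero polynomial is homogeneous of every degree.\<close>

definition homogeneous :: "nat \<Rightarrow> 'a::zero poly3 \<Rightarrow> bool" where
  "homogeneous d F \<longleftrightarrow> (\<forall>i j k. coeff3 F i j k \<noteq> 0 \<longrightarrow> i + j + k = d)"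

definition const3 :: "'a::zero \<Rightarrow> 'a poly3" where
  "const3 c = [:[:[:c:]:]:]"

definition eval3 :: "'a::comm_ring_1 poly3 \<Rightarrow> 'a ^ 3 \<Rightarrow> 'a" where
  "eval3 F v = poly (poly (poly F [:[:v $ 3:]:]) [:v $ 2:]) (v $ 1)"

definition grad :: "'a::idom poly3 \<Rightarrow> 'a poly3 ^ 3" where
  "grad F = vector [map_poly (map_poly pderiv) F, map_poly pderiv F, pderiv F]"

definition lift3 :: "'a::field poly3 \<Rightarrow> 'a alg_closure poly3" where
  "lift3 F = map_poly (map_poly (map_poly to_ac)) F"

text \<open>A projective point is the set of all its homogeneous coordinate vectors.\<close>

definition proj_class :: "'b::field ^ 'n \<Rightarrow> ('b ^ 'n) set" where
  "proj_class v = {c *s v | c. c \<noteq> 0}"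

definition proj_space :: "('b::field ^ 'n) set set" where
  "proj_space = proj_class ` (- {0})"

definition curve_points :: "'b::field poly3 \<Rightarrow> ('b ^ 3) set set" where
  "curve_points F = {P \<in> proj_space. \<forall>v\<in>P. eval3 F v = 0}"

definition singular_points :: "'b::field poly3 \<Rightarrow> ('b ^ 3) set set" where
  "singular_points F = {P \<in> curve_points F. \<forall>v\<in>P. \<forall>i. eval3 (grad F $ i) v = 0}"

text \<open>For a nonzero homogeneous F, the divisor F = 0 is reduced iff F is squarefree.\<close>

definition reduced_curve :: "nat \<Rightarrow> 'b::field poly3 \<Rightarrow> bool" where
  "reduced_curve d F \<longleftrightarrow> F \<noteq> 0 \<and> homogeneous d F \<and> squarefree F"

definition no_common_component :: "'b::field poly3 \<Rightarrow> 'b poly3 \<Rightarrow> bool" where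
  "no_common_component F G \<longleftrightarrow> \<not> (\<exists>h. irreducible h \<and> h dvd F \<and> h dvd G)"

text \<open>The parameters (alpha, beta) of the members range over the geometric points of the
  projective line. Over a field K that is not algebraically closed the singular members need
  not be K-rational.\<close>

definition pencil_member ::
    "'a::field poly3 \<Rightarrow> 'a poly3 \<Rightarrow> 'a alg_closure ^ 2 \<Rightarrow> 'a alg_closure poly3" where
  "pencil_member f g v = const3 (v $ 1) * lift3 f + const3 (v $ 2) * lift3 g"

text \<open>"General" means: outside a proper closed, hence finite, subset of the projective line.\<close>

definition general_member_smooth :: "'a::field poly3 \<Rightarrow> 'a poly3 \<Rightarrow> bool" where
  "general_member_smooth f g \<longleftrightarrow>
     finite {Q \<in> proj_space. \<exists>v\<in>Q. singular_points (pencil_member f g v) \<noteq> {}}"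

definition base_locus :: "'a::field poly3 \<Rightarrow> 'a poly3 \<Rightarrow> ('a alg_closure ^ 3) set set" where
  "base_locus f g = curve_points (lift3 f) \<inter> curve_points (lift3 g)"

definition pencil_sing :: "'a::field poly3 \<Rightarrow> 'a poly3 \<Rightarrow> ('a alg_closure ^ 3) set set" where
  "pencil_sing f g = (\<Union>v \<in> - {0}. singular_points (pencil_member f g v))"

definition singular_members_union ::
    "'a::field poly3 \<Rightarrow> 'a poly3 \<Rightarrow> ('a alg_closure ^ 3) set set" where
  "singular_members_union f g =
     \<Union> {curve_points (pencil_member f g v) | v.
          v \<noteq> 0 \<and> singular_points (pencil_member f g v) \<noteq> {}}"

text \<open>F = 0 is a curve over K which, geometrically, is the union of k distinct members. The
  constant by which F may differ from the product is absorbed in one of the \<open>v i\<close>.\<close>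

definition union_of_members ::
    "nat \<Rightarrow> 'a::field poly3 \<Rightarrow> 'a poly3 \<Rightarrow> 'a poly3 \<Rightarrow> bool" where
  "union_of_members k f g F \<longleftrightarrow>
     (\<exists>v :: nat \<Rightarrow> 'a alg_closure ^ 2.
        (\<forall>i<k. v i \<noteq> 0) \<and> inj_on (\<lambda>i. proj_class (v i)) {..<k} \<and>
        lift3 F = (\<Prod>i<k. pencil_member f g (v i)))"

abbreviation S_ring :: "'a::field poly3 ring" where
  "S_ring \<equiv> ring_of_type_algebra"

definition homogeneous_ideal :: "'a::field poly3 set \<Rightarrow> bool" where
  "homogeneous_ideal I \<longleftrightarrow>
     ideal I S_ring \<and> I = genideal S_ring {F \<in> I. \<exists>d. homogeneous d F}"

definition irrelevant_ideal :: "'a::field poly3 set" where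
  "irrelevant_ideal = {F. coeff3 F 0 0 0 = 0}"

definition proj_plane :: "'a::field poly3 set set" where
  "proj_plane =
     {p. primeideal p S_ring \<and> homogeneous_ideal p \<and> \<not> irrelevant_ideal \<subseteq> p}"

definition zariski_open :: "'a::field poly3 set set \<Rightarrow> bool" where
  "zariski_open U \<longleftrightarrow>
     (\<exists>I. homogeneous_ideal I \<and> U = {p \<in> proj_plane. \<not> I \<subseteq> p})"

text \<open>The closed point of Proj S below a geometric point. Since \<open>P\<close> contains all multiples
  of a coordinate vector, this set is a homogeneous ideal.\<close>

definition point_prime :: "('a::field alg_closure ^ 3) set \<Rightarrow> 'a poly3 set" where
  "point_prime P = {F. \<forall>v\<in>P. eval3 (lift3 F) v = 0}"

text \<open>S is a domain, so all the homogeneous localizations S(m)_(p) are subsets of its fraction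
  field. A sheaf of submodules of the r-fold sum of twists O(m) is given by its sets of
  sections; a section over U is a function on Proj S which is zero outside U.\<close>

type_synonym ('a, 'n) fsection = "'a poly3 set \<Rightarrow> 'a poly3 fract ^ 'n"
type_synonym ('a, 'n) sheaf = "'a poly3 set set \<Rightarrow> ('a, 'n) fsection set"

definition local_ring :: "'a::field poly3 set \<Rightarrow> 'a poly3 fract set" where
  "local_ring p =
     {to_fract a / to_fract b | a b d. homogeneous d a \<and> homogeneous d b \<and> b \<notin> p}"

text \<open>The sections of O(m): functions that locally are a quotient of two homogeneous
  polynomials whose degrees differ by m.\<close>

definition twist :: "int \<Rightarrow> 'a::field poly3 set set \<Rightarrow> ('a poly3 set \<Rightarrow> 'a poly3 fract) set" where
  "twist m U =
     {s. (\<forall>p. p \<notin> U \<longrightarrow> s p = 0) \<and>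
         (\<forall>p\<in>U. \<exists>V a b d e. zariski_open V \<and> p \<in> V \<and> V \<subseteq> U \<and>
            homogeneous d a \<and> homogeneous e b \<and> int d = int e + m \<and>
            (\<forall>q\<in>V. b \<notin> q \<and> s q = to_fract a / to_fract b))}"

definition section_restrict ::
    "'a::field poly3 set set \<Rightarrow> ('a, 'n::finite) fsection \<Rightarrow> ('a, 'n) fsection" where
  "section_restrict V s = (\<lambda>p. if p \<in> V then s p else 0)"

definition sheaf_isomorphic ::
    "('a::field, 'm::finite) sheaf \<Rightarrow> ('a, 'n::finite) sheaf \<Rightarrow> bool" where
  "sheaf_isomorphic M N \<longleftrightarrow>
     (\<exists>\<phi> :: 'a poly3 set set \<Rightarrow> ('a, 'm) fsection \<Rightarrow> ('a, 'n) fsection.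
        \<forall>U. zariski_open U \<longrightarrow>
          bij_betw (\<phi> U) (M U) (N U) \<and>
          (\<forall>s\<in>M U. \<forall>t\<in>M U. \<phi> U (\<lambda>p. s p + t p) = (\<lambda>p. \<phi> U s p + \<phi> U t p)) \<and>
          (\<forall>r\<in>twist 0 U. \<forall>s\<in>M U. \<phi> U (\<lambda>p. r p *s s p) = (\<lambda>p. r p *s \<phi> U s p)) \<and>
          (\<forall>V. zariski_open V \<and> V \<subseteq> U \<longrightarrow>
             (\<forall>s\<in>M U. \<phi> V (section_restrict V s) = section_restrict V (\<phi> U s))))"

definition split_sheaf :: "int \<Rightarrow> int \<Rightarrow> ('a::field, 2) sheaf" where
  "split_sheaf a b U = {s. (\<lambda>p. s p $ 1) \<in> twist a U \<and> (\<lambda>p. s p $ 2) \<in> twist b U}"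

text \<open>The kernel of the map from the threefold sum of O to the Jacobian ideal sheaf
  (twisted by d - 1) given by the gradient of F.\<close>

definition derivation_sheaf :: "'a::field poly3 \<Rightarrow> ('a, 3) sheaf" where
  "derivation_sheaf F U =
     {s. (\<forall>i. (\<lambda>p. s p $ i) \<in> twist 0 U) \<and>
         (\<forall>p\<in>U. (\<Sum>i\<in>UNIV. to_fract (grad F $ i) * s p $ i) = 0)}"

definition free_curve :: "'a::field poly3 \<Rightarrow> nat \<Rightarrow> nat \<Rightarrow> bool" where
  "free_curve F a b \<longleftrightarrow>
     sheaf_isomorphic (derivation_sheaf F) (split_sheaf (- int a) (- int b))"

definition jacobian_ideal :: "'a::field poly3 \<Rightarrow> 'a poly3 set" where
  "jacobian_ideal F = genideal S_ring (range (\<lambda>i. grad F $ i))"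

text \<open>The stalk at p of the Jacobian ideal sheaf, an ideal of the local ring at p.\<close>

definition jacobian_stalk :: "'a::field poly3 \<Rightarrow> 'a poly3 set \<Rightarrow> 'a poly3 fract set" where
  "jacobian_stalk F p =
     {to_fract a / to_fract b | a b d.
        a \<in> jacobian_ideal F \<and> homogeneous d a \<and> homogeneous d b \<and> b \<notin> p}"

definition jacobian_lci_at :: "'a::field poly3 \<Rightarrow> 'a poly3 set \<Rightarrow> bool" where
  "jacobian_lci_at F p \<longleftrightarrow>
     (\<exists>h1 h2. jacobian_stalk F p =
        {r1 * h1 + r2 * h2 | r1 r2. r1 \<in> local_ring p \<and> r2 \<in> local_ring p})"

end

theory Submission
  imports Defs
begin

text \<open>Put \<open>u = \<nabla>f \<times> \<nabla>g\<close>, a syzygy of \<open>\<nabla>F\<close> of degree \<open>2n - 2\<close>. Its entries are coprime and it vanishes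
  exactly at the singular points of the members; the base points are excluded because \<open>n\<^sup>2\<close> distinct
  intersection points force transversality. Since the entries of \<open>\<nabla>F\<close> are coprime, Saito's criterion
  turns freeness into the existence of a vector field \<open>v\<close> with \<open>\<nabla>F = u \<times> v\<close>.

  Such a \<open>v\<close> exists globally iff it exists locally at every zero \<open>p\<close> of \<open>u\<close>: the obstruction vanishes
  because the quotient by a linear form avoiding the zeros of \<open>u\<close> is a factorial ring in which \<open>u\<close>
  stays coprime. The Jacobian ideal is a local complete intersection at \<open>p\<close> iff some syzygy \<open>b\<close> of
  \<open>\<nabla>F\<close> is nonzero at \<open>p\<close>. Then \<open>u \<times> b = c \<nabla>F\<close>, and \<open>c(p) \<noteq> 0\<close>: otherwise \<open>b\<close> would be a derivation
  transversal to the line through \<open>p\<close> that preserves the Jacobian ideal, which locally contains a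
  power of a coordinate; differentiating that power, the ideal would be trivial at \<open>p\<close>.\<close>

text \<open>Points live over the algebraic closure, freeness and stalks over K. The geometry is done
  over the closure; a solution found there is carried back by a K-linear retraction of the closure
  onto K, applied to coefficients, and by projection to one degree.

  All intersection theory rests on one count: in a degree at least d1 + d2, any d1 * d2 + 1 forms
  have a nontrivial combination in the ideal of two given coprime forms of degrees d1 and d2.
  Separating forms yield Bezout's bound and transversality; monomials in two linear forms yield
  elimination down to products of lines.

  The exponents 2n - 2 and n(k - 2) + 1 add up to nk - 1, the degree of the entries of grad F, so
  the cross product of two syzygies of these degrees can only be a constant multiple of grad F.

  On the sheaf side, every nonempty open set contains the generic point {0}, so a section is a
  single vector over the fraction field subject to a regularity condition at each point; statements
  on sheaves become identities of such vectors with control of denominators.\<close>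

no_notation fps_nth (infixl \<open>$\<close> 75)

section \<open>Polynomials in three variables\<close>

definition mon :: "'a::zero \<Rightarrow> nat \<Rightarrow> nat \<Rightarrow> nat \<Rightarrow> 'a poly3" where
  "mon c i j k = monom (monom (monom c i) j) k"

lemma coeff3_mon: "coeff3 (mon c i j k) i' j' k' = (if i = i' \<and> j = j' \<and> k = k' then c else 0)"
  by (simp add: coeff3_def mon_def)

lemma coeff3_simps [simp]:
  "coeff3 0 i j k = 0"
  "coeff3 (A + B) i j k = coeff3 A i j k + coeff3 B i j k"
  "coeff3 (A' - B') i j k = coeff3 A' i j k - coeff3 B' i j k"
  "coeff3 (- A') i j k = - coeff3 A' i j k"
  for A B :: "'a::comm_monoid_add poly3" and A' B' :: "'b::ab_group_add poly3"
  by (simp_all add: coeff3_def)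

lemma coeff3_const3_mult [simp]: "coeff3 (const3 c * A) i j k = c * coeff3 A i j k"
  for A :: "'a::comm_ring_1 poly3"
  by (simp add: coeff3_def const3_def)

lemma coeff3_sum: "coeff3 (sum A T) i j k = (\<Sum>t\<in>T. coeff3 (A t) i j k)"
  for A :: "_ \<Rightarrow> 'a::comm_ring_1 poly3"
  by (simp add: coeff3_def coeff_sum)

lemma coeff3_ext: "(\<And>i j k. coeff3 A i j k = coeff3 B i j k) \<Longrightarrow> A = B"
  by (auto simp: coeff3_def poly_eq_iff)

lemma mon_0 [simp]: "mon 0 i j k = 0"
  by (simp add: mon_def)

lemma mon_mult: "mon a i j k * mon b i' j' k' = mon (a * b) (i + i') (j + j') (k + k')"
  for a :: "'a::comm_ring_1"
  by (simp add: mon_def mult_monom)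

lemma const3_mon: "const3 c = mon c 0 0 0"
  by (simp add: mon_def const3_def monom_0)

lemma mon_1: "mon 1 0 0 0 = (1 :: 'a::comm_ring_1 poly3)"
  by (simp add: mon_def one_pCons monom_0)

lemma const3_simps [simp]:
  "const3 0 = 0" "const3 (1::'a) = (1 :: 'a::comm_ring_1 poly3)"
  "const3 (a + b :: 'a) = const3 a + const3 b"
  "const3 (a - b :: 'a) = const3 a - const3 b"
  "const3 (- a :: 'a) = - const3 a"
  "const3 (a * b :: 'a) = const3 a * const3 b"
  by (simp_all add: const3_def one_pCons)

lemma const3_eq_0_iff [simp]: "const3 c = 0 \<longleftrightarrow> c = 0"
  by (simp add: const3_def)

lemma const3_power: "const3 (a ^ n :: 'a::comm_ring_1) = const3 a ^ n"
  by (induction n) simp_all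

lemma const3_of_nat: "const3 (of_nat n :: 'a::comm_ring_1) = of_nat n"
  by (induction n) simp_all

lemma const3_inverse: "x \<noteq> 0 \<Longrightarrow> const3 (1 / x) * const3 x = 1" for x :: "'a::field"
  by (simp flip: const3_simps)

lemma poly_monom_induct:
  assumes "\<And>c n. Q (monom c n)" "\<And>a b. Q a \<Longrightarrow> Q b \<Longrightarrow> Q (a + b)"
  shows "Q (p :: 'a::comm_monoid_add poly)"
proof -
  have "Q (\<Sum>i\<le>n. monom (Polynomial.coeff p i) i)" for n
    by (induction n) (auto intro: assms)
  then show ?thesis by (metis poly_as_sum_of_monoms)
qed

lemma poly3_induct [case_names mon add]:
  assumes mon: "\<And>c i j k. Q (mon c i j k)" and add: "\<And>A B. Q A \<Longrightarrow> Q B \<Longrightarrow> Q (A + B)"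
  shows "Q (P :: 'a::comm_monoid_add poly3)"
proof -
  have 1: "Q (monom (monom c j) k)" for c j k
    by (rule poly_monom_induct[of "\<lambda>c. Q (monom (monom c j) k)"])
       (use mon add in \<open>auto simp: mon_def add_monom[symmetric]\<close>)
  have 2: "Q (monom c k)" for c k
    by (rule poly_monom_induct[of "\<lambda>c. Q (monom c k)"])
       (use 1 add in \<open>auto simp: add_monom[symmetric]\<close>)
  show ?thesis by (rule poly_monom_induct[of Q]) (use 2 add in auto)
qed

section \<open>Homogeneous polynomials as sums of monomials\<close>

definition triples :: "nat \<Rightarrow> (nat \<times> nat \<times> nat) set" where
  "triples d = {(i, j, k). i + j + k = d}"

lemma finite_triples [simp]: "finite (triples d)"
proof (rule finite_subset)
  show "triples d \<subseteq> {..d} \<times> {..d} \<times> {..d}" by (auto simp: triples_def)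
qed auto

lemma homogeneous_expand:
  fixes P :: "'a::comm_ring_1 poly3"
  assumes "homogeneous d P"
  shows "P = (\<Sum>(i, j, k)\<in>triples d. mon (coeff3 P i j k) i j k)"
proof (rule coeff3_ext)
  fix i j k
  have "coeff3 (\<Sum>(i, j, k)\<in>triples d. mon (coeff3 P i j k) i j k) i j k
     = (\<Sum>t\<in>triples d. if t = (i, j, k) then coeff3 P i j k else 0)"
    unfolding coeff3_sum by (intro sum.cong) (auto simp: coeff3_mon split: if_splits)
  also have "\<dots> = coeff3 P i j k"
    using assms by (simp add: homogeneous_def) (auto simp: triples_def)
  finally show "coeff3 P i j k = coeff3 (\<Sum>(i, j, k)\<in>triples d. mon (coeff3 P i j k) i j k) i j k"
    by simp
qed

lemma homogeneous_induct [consumes 1, case_names mon add]: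
  fixes P :: "'a::comm_ring_1 poly3"
  assumes "homogeneous d P" and mon: "\<And>c i j k. i + j + k = d \<Longrightarrow> Q (mon c i j k)"
    and add: "\<And>A B. Q A \<Longrightarrow> Q B \<Longrightarrow> Q (A + B)"
  shows "Q P"
proof -
  \<comment> \<open>The premise of \<open>mon\<close> mentions i, j, k before c, so this is the
    monomial with exponents (d, 0, 0) and coefficient 0.\<close>
  have 0: "Q 0" using mon[of d 0 0 0] by simp
  have "Q (\<Sum>t\<in>T. case t of (i, j, k) \<Rightarrow> mon (coeff3 P i j k) i j k)"
    if "finite T" "T \<subseteq> triples d" for T
    using that
  proof (induction T rule: finite_induct)
    case (insert t T)
    then have "Q (case t of (i, j, k) \<Rightarrow> mon (coeff3 P i j k) i j k)"
      by (auto simp: triples_def intro: mon)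
    with insert show ?case by (auto intro: add)
  qed (simp add: 0)
  from this[OF finite_triples order_refl] show ?thesis
    using homogeneous_expand[OF assms(1)] by metis
qed

lemma homogeneous_0 [simp]: "homogeneous d 0"
  by (simp add: homogeneous_def coeff3_def)

lemma homogeneous_mon: "i + j + k = d \<Longrightarrow> homogeneous d (mon c i j k)"
  by (simp add: homogeneous_def coeff3_mon)

lemma homogeneous_add: "homogeneous d A \<Longrightarrow> homogeneous d B \<Longrightarrow> homogeneous d (A + B)"
  for A :: "'a::comm_ring_1 poly3"
  unfolding homogeneous_def coeff3_simps by (metis add_0)

lemma homogeneous_uminus: "homogeneous d A \<Longrightarrow> homogeneous d (- A)"
  for A :: "'a::comm_ring_1 poly3"
  unfolding homogeneous_def by simp

lemma homogeneous_diff: "homogeneous d A \<Longrightarrow> homogeneous d B \<Longrightarrow> homogeneous d (A - B)"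
  for A :: "'a::comm_ring_1 poly3"
  using homogeneous_add[of d A "- B"] homogeneous_uminus[of d B] by simp

lemma homogeneous_sum: "(\<And>t. t \<in> T \<Longrightarrow> homogeneous d (A t)) \<Longrightarrow> homogeneous d (sum A T)"
  for A :: "_ \<Rightarrow> 'a::comm_ring_1 poly3"
  by (induction T rule: infinite_finite_induct) (auto intro: homogeneous_add)

lemma homogeneous_const3 [simp]: "homogeneous 0 (const3 c)"
  by (simp add: const3_mon homogeneous_mon)

lemma homogeneous_1 [simp]: "homogeneous 0 (1 :: 'a::comm_ring_1 poly3)"
  using homogeneous_const3[of "1::'a"] by simp

lemma homogeneous_mult:
  fixes A B :: "'a::comm_ring_1 poly3"
  assumes "homogeneous d A" "homogeneous e B"
  shows "homogeneous (d + e) (A * B)"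
  using assms(1)
proof (induction rule: homogeneous_induct)
  case (mon c i j k)
  from assms(2) show ?case
    by (induction rule: homogeneous_induct)
       (use mon in \<open>auto simp: mon_mult distrib_left intro!: homogeneous_mon homogeneous_add\<close>)
qed (auto simp: distrib_right intro: homogeneous_add)

lemma homogeneous_const3_mult: "homogeneous d A \<Longrightarrow> homogeneous d (const3 c * A)"
  for A :: "'a::comm_ring_1 poly3"
  using homogeneous_mult[of 0 "const3 c" d A] by simp

lemma homogeneous_power: "homogeneous d A \<Longrightarrow> homogeneous (n * d) (A ^ n)"
  for A :: "'a::comm_ring_1 poly3"
  by (induction n) (auto intro: homogeneous_mult)

lemma homogeneous_prod:
  fixes A :: "_ \<Rightarrow> 'a::comm_ring_1 poly3"
  shows "(\<And>t. t \<in> T \<Longrightarrow> homogeneous (d t) (A t)) \<Longrightarrow> homogeneous (sum d T) (prod A T)"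
  by (induction T rule: infinite_finite_induct) (auto intro: homogeneous_mult)

lemma homogeneous_degree_unique: "homogeneous d A \<Longrightarrow> homogeneous e A \<Longrightarrow> A \<noteq> 0 \<Longrightarrow> d = e"
  for A :: "'a::comm_ring_1 poly3"
  using coeff3_ext[of A 0] unfolding homogeneous_def by fastforce

lemma homogeneous_0_const:
  fixes A :: "'a::comm_ring_1 poly3"
  assumes "homogeneous 0 A"
  obtains c where "A = const3 c"
proof -
  have "A = const3 (coeff3 A 0 0 0)"
    using homogeneous_expand[OF assms] by (simp add: triples_def const3_mon)
  with that show ?thesis by blast
qed

lemma is_unit_poly3_iff: "h dvd 1 \<longleftrightarrow> (\<exists>c. c \<noteq> 0 \<and> h = const3 c)"
  for h :: "'a::field poly3"
  by (auto simp: is_unit_poly_iff const3_def dvd_field_iff)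

lemma homogeneous_unit_iff: "homogeneous d h \<Longrightarrow> h \<noteq> 0 \<Longrightarrow> h dvd 1 \<longleftrightarrow> d = 0"
  for h :: "'a::field poly3"
  by (metis homogeneous_0_const is_unit_poly3_iff const3_eq_0_iff homogeneous_const3
      homogeneous_degree_unique)

subsection \<open>Homogeneous components\<close>

text \<open>A predicate on functions, so that a homomorphism can be pushed through the three nested
  polynomial layers one after the other.\<close>

definition ring_hom_fun :: "('a::comm_ring_1 \<Rightarrow> 'b::comm_ring_1) \<Rightarrow> bool" where
  "ring_hom_fun h \<longleftrightarrow> h 1 = 1 \<and> (\<forall>a b. h (a + b) = h a + h b) \<and> (\<forall>a b. h (a * b) = h a * h b)"

lemma ring_hom_funD:
  assumes "ring_hom_fun h"
  shows "h 1 = 1" "h 0 = 0" "h (a + b) = h a + h b" "h (a * b) = h a * h b"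
    "h (- a) = - h a" "h (a - b) = h a - h b"
proof -
  show *: "h 1 = 1" "h (a + b) = h a + h b" "h (a * b) = h a * h b" for a b
    using assms by (auto simp: ring_hom_fun_def)
  show 0: "h 0 = 0" using *(2)[of 0 0] by simp
  show m: "h (- a) = - h a" for a using *(2)[of a "- a"] 0 by (simp add: eq_neg_iff_add_eq_0 add.commute)
  show "h (a - b) = h a - h b" using *(2)[of a "- b"] m by simp
qed

lemma ring_hom_fun_sum: "ring_hom_fun h \<Longrightarrow> h (sum f T) = (\<Sum>t\<in>T. h (f t))"
  by (induction T rule: infinite_finite_induct) (auto simp: ring_hom_funD)

lemma ring_hom_fun_prod: "ring_hom_fun h \<Longrightarrow> h (prod f T) = (\<Prod>t\<in>T. h (f t))"
  by (induction T rule: infinite_finite_induct) (auto simp: ring_hom_funD)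

lemma ring_hom_fun_power: "ring_hom_fun h \<Longrightarrow> h (a ^ n) = h a ^ n"
  by (induction n) (auto simp: ring_hom_funD)

lemma ring_hom_fun_map_poly:
  assumes h: "ring_hom_fun h"
  shows "ring_hom_fun (map_poly h)"
  unfolding ring_hom_fun_def
proof (intro conjI allI)
  fix a b
  show "map_poly h (a + b) = map_poly h a + map_poly h b"
    by (rule poly_eqI) (simp add: coeff_map_poly ring_hom_funD[OF h])
  show "map_poly h (a * b) = map_poly h a * map_poly h b"
    by (rule poly_eqI) (simp add: coeff_map_poly coeff_mult ring_hom_funD[OF h] ring_hom_fun_sum[OF h])
qed (simp add: ring_hom_funD[OF h])

lemma ring_hom_fun_eval:
  assumes h: "ring_hom_fun h"
  shows "ring_hom_fun (\<lambda>p. poly (map_poly h p) w)"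
  using ring_hom_fun_map_poly[OF h] by (auto simp: ring_hom_fun_def)

text \<open>Substitutes x t, y t, z t for the variables, with values in S[t]. The coefficient of t^d
  is the part of degree d. Since this is a ring homomorphism, over a domain questions about
  homogeneous factors become questions about factors of monomials in t.\<close>

definition grading :: "'a::comm_ring_1 poly3 \<Rightarrow> 'a poly3 poly" where
  "grading P = poly (map_poly (\<lambda>Q. poly (map_poly (\<lambda>q. poly (map_poly (\<lambda>c. [:const3 c:]) q)
     (monom (mon 1 1 0 0) 1)) Q) (monom (mon 1 0 1 0) 1)) P) (monom (mon 1 0 0 1) 1)"

lemma ring_hom_fun_grading: "ring_hom_fun grading"
proof -
  have "ring_hom_fun (\<lambda>c::'a. [:const3 c:])" by (auto simp: ring_hom_fun_def one_pCons)
  from ring_hom_fun_eval[OF ring_hom_fun_eval[OF ring_hom_fun_eval[OF this]]]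
  show ?thesis unfolding grading_def[abs_def] .
qed

lemma mon_power: "mon a i j k ^ n = mon (a ^ n) (n * i) (n * j) (n * k)" for a :: "'a::comm_ring_1"
  by (induction n) (simp_all add: mon_mult mon_1)

lemma monom_power: "monom a i ^ n = monom (a ^ n) (n * i)" for a :: "'a::comm_ring_1"
  by (induction n) (simp_all add: mult_monom)

lemma poly_monom_hom:
  assumes h: "ring_hom_fun h"
  shows "poly (map_poly h (monom c n)) w = h c * w ^ n"
  using h by (simp add: map_poly_monom ring_hom_funD poly_monom)

lemma grading_mon: "grading (mon c i j k) = monom (mon c i j k) (i + j + k)"
proof -
  have h: "ring_hom_fun (\<lambda>c::'a. [:const3 c:])" by (auto simp: ring_hom_fun_def one_pCons)
  note h1 = ring_hom_fun_eval[OF h] note h2 = ring_hom_fun_eval[OF h1]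
  have "[:const3 c:] = monom (const3 c) 0" by (simp add: monom_0)
  then show ?thesis
    unfolding grading_def mon_def[of c i j k] poly_monom_hom[OF h2] poly_monom_hom[OF h1] poly_monom_hom[OF h]
    by (simp add: monom_power mon_power const3_mon mult_monom mon_mult mon_def[symmetric])
qed

definition hpart :: "nat \<Rightarrow> 'a::comm_ring_1 poly3 \<Rightarrow> 'a poly3" where
  "hpart d P = Polynomial.coeff (grading P) d"

lemma coeff3_hpart: "coeff3 (hpart d P) i j k = (if i + j + k = d then coeff3 P i j k else 0)"
  by (induction P rule: poly3_induct)
     (auto simp: hpart_def grading_mon coeff3_mon ring_hom_funD[OF ring_hom_fun_grading])

lemma homogeneous_hpart: "homogeneous d (hpart d P)"
  by (simp add: homogeneous_def coeff3_hpart)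

lemma hpart_simps [simp]: "hpart d 0 = 0" "hpart d (A + B) = hpart d A + hpart d B"
  "hpart d (A - B) = hpart d A - hpart d B" "hpart d (- A) = - hpart d A"
  by (simp_all add: hpart_def ring_hom_funD[OF ring_hom_fun_grading])

lemma grading_homogeneous: "homogeneous d P \<Longrightarrow> grading P = monom P d"
  by (induction rule: homogeneous_induct)
     (auto simp: grading_mon ring_hom_funD[OF ring_hom_fun_grading] add_monom)

lemma hpart_homogeneous: "homogeneous d P \<Longrightarrow> hpart e P = (if e = d then P else 0)"
  by (simp add: hpart_def grading_homogeneous)

lemma hpart_mult_homogeneous:
  assumes "homogeneous d A"
  shows "hpart e (A * B) = (if e < d then 0 else A * hpart (e - d) B)"
  by (simp add: hpart_def ring_hom_funD[OF ring_hom_fun_grading] grading_homogeneous[OF assms] coeff_monom_mult)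

text \<open>Setting the grading variable to 1 undoes the substitution.\<close>

lemma sum_hpart: obtains N where "P = (\<Sum>d\<le>N. hpart d P)"
proof -
  have "poly (grading P) 1 = P"
    by (induction P rule: poly3_induct)
       (auto simp: grading_mon poly_monom ring_hom_funD[OF ring_hom_fun_grading])
  then show ?thesis
    using that[of "degree (grading P)"] by (simp add: poly_altdef hpart_def)
qed

text \<open>Over a domain the lowest and the highest exponent are both additive under
  multiplication. They coincide for a monomial, hence for each of its factors.\<close>

lemma monom_product:
  fixes p q :: "'a::idom poly"
  assumes "p * q = monom c d" "c \<noteq> 0"
  shows "\<exists>a i b j. p = monom a i \<and> q = monom b j \<and> i + j = d"
proof -
  have nz: "p \<noteq> 0" "q \<noteq> 0" using assms by auto
  define l where "l r = (LEAST i. Polynomial.coeff r i \<noteq> 0)" for r :: "'a poly"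
  have l: "Polynomial.coeff r (l r) \<noteq> 0" "l r \<le> degree r" "\<And>i. i < l r \<Longrightarrow> Polynomial.coeff r i = 0"
    if "r \<noteq> 0" for r
  proof -
    have "Polynomial.coeff r (degree r) \<noteq> 0" using that by simp
    then show "Polynomial.coeff r (l r) \<noteq> 0" "l r \<le> degree r"
      unfolding l_def by (metis (mono_tags) LeastI, metis (mono_tags) Least_le)
    show "\<And>i. i < l r \<Longrightarrow> Polynomial.coeff r i = 0" unfolding l_def using not_less_Least by blast
  qed
  have "Polynomial.coeff (p * q) (l p + l q) = (\<Sum>i\<le>l p + l q. if i = l p then Polynomial.coeff p (l p) * Polynomial.coeff q (l q) else 0)"
    unfolding coeff_mult
  proof (rule sum.cong)
    fix i assume "i \<in> {..l p + l q}"
    consider "i < l p" | "i = l p" | "l p + l q - i < l q" using \<open>i \<in> _\<close> by (auto simp: less_diff_conv2) linarith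
    then show "Polynomial.coeff p i * Polynomial.coeff q (l p + l q - i) =
      (if i = l p then Polynomial.coeff p (l p) * Polynomial.coeff q (l q) else 0)"
      using l(3)[OF nz(1)] l(3)[OF nz(2)] by cases auto
  qed simp
  then have "Polynomial.coeff (p * q) (l p + l q) \<noteq> 0" using l(1) nz by simp
  then have "l p + l q = d" by (simp add: assms(1) split: if_splits)
  moreover have "degree p + degree q = d"
    using degree_mult_eq[OF nz] by (simp add: assms degree_monom_eq)
  ultimately have "l p = degree p" "l q = degree q" using l(2)[OF nz(1)] l(2)[OF nz(2)] by linarith+
  then have "p = monom (lead_coeff p) (degree p)" "q = monom (lead_coeff q) (degree q)"
    using l(3)[OF nz(1)] l(3)[OF nz(2)] by (auto intro!: poly_eqI simp: coeff_eq_0 not_less_iff_gr_or_eq)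
       (metis coeff_eq_0 linorder_neqE_nat)+
  with \<open>degree p + degree q = d\<close> show ?thesis by blast
qed

text \<open>Under \<open>grading\<close> a factorization of a form becomes a factorization of a
  monomial in t.\<close>

lemma homogeneous_factors:
  fixes P Q :: "'a::idom poly3"
  assumes "homogeneous d (P * Q)" "P * Q \<noteq> 0"
  obtains e1 e2 where "homogeneous e1 P" "homogeneous e2 Q" "e1 + e2 = d"
proof -
  have "grading P * grading Q = monom (P * Q) d"
    using grading_homogeneous[OF assms(1)] by (simp add: ring_hom_funD[OF ring_hom_fun_grading])
  from monom_product[OF this assms(2)] obtain a i b j where
    *: "grading P = monom a i" "grading Q = monom b j" "i + j = d" by blast
  have "homogeneous e R" if "grading R = monom c e" for R :: "'a poly3" and c e
  proof -
    obtain N where N: "R = (\<Sum>d\<le>N. hpart d R)" by (rule sum_hpart)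
    have "hpart d R = (if d = e then c else 0)" for d by (simp add: hpart_def that)
    then show ?thesis by (metis (no_types, lifting) N homogeneous_0 homogeneous_hpart homogeneous_sum)
  qed
  with * that show ?thesis by blast
qed

lemma homogeneous_dvd: "homogeneous d P \<Longrightarrow> P \<noteq> 0 \<Longrightarrow> h dvd P \<Longrightarrow> \<exists>e. homogeneous e h"
  for P :: "'a::idom poly3"
  by (metis dvd_def homogeneous_factors)

lemma homogeneous_cofactor:
  fixes P Q :: "'a::idom poly3"
  assumes "homogeneous (e + d) (P * Q)" "homogeneous e P" "P \<noteq> 0"
  shows "homogeneous d Q"
proof (cases "Q = 0")
  case False
  then obtain e1 e2 where "homogeneous e1 P" "homogeneous e2 Q" "e1 + e2 = e + d"
    using homogeneous_factors[OF assms(1)] assms(3) by auto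
  moreover from this have "e1 = e" using assms homogeneous_degree_unique by blast
  ultimately show ?thesis by auto
qed simp

subsection \<open>Vectors of length three\<close>

definition dot :: "'b::comm_ring_1 ^ 3 \<Rightarrow> 'b ^ 3 \<Rightarrow> 'b" where
  "dot a b = (\<Sum>i\<in>UNIV. a $ i * b $ i)"

definition cross :: "'b::comm_ring_1 ^ 3 \<Rightarrow> 'b ^ 3 \<Rightarrow> 'b ^ 3" where
  "cross a b = vector [a $ 2 * b $ 3 - a $ 3 * b $ 2, a $ 3 * b $ 1 - a $ 1 * b $ 3,
     a $ 1 * b $ 2 - a $ 2 * b $ 1]"

lemma dot_3: "dot a b = a $ 1 * b $ 1 + a $ 2 * b $ 2 + a $ 3 * b $ 3"
  by (simp add: dot_def sum_3)

lemma cross_3: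
  "cross a b $ 1 = a $ 2 * b $ 3 - a $ 3 * b $ 2"
  "cross a b $ 2 = a $ 3 * b $ 1 - a $ 1 * b $ 3"
  "cross a b $ 3 = a $ 1 * b $ 2 - a $ 2 * b $ 1"
  by (simp_all add: cross_def vector_3)

lemma vec3_eq_iff: "a = b \<longleftrightarrow> a $ 1 = b $ 1 \<and> a $ 2 = b $ 2 \<and> a $ 3 = b $ 3" for a b :: "'b ^ 3"
  by (simp add: vec_eq_iff forall_3)

lemmas vec3_simps = vec3_eq_iff dot_3 cross_3 vector_scalar_mult_def forall_3

lemma cross_simps [simp]:
  "cross a a = 0" "cross 0 a = 0" "cross a 0 = 0"
  "dot a 0 = 0" "dot 0 a = 0"
  "dot a (cross a b) = 0" "dot b (cross a b) = 0"
  by (simp_all add: vec3_simps algebra_simps)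

lemma cross_add_right: "cross a (b + c) = cross a b + cross a c"
  and cross_add_left: "cross (a + b) c = cross a c + cross b c"
  and cross_scale_right: "cross a (r *s b) = r *s cross a b"
  and cross_scale_left: "cross (r *s a) b = r *s cross a b"
  and dot_add_right: "dot a (b + c) = dot a b + dot a c"
  and dot_diff_right: "dot a (b - c) = dot a b - dot a c"
  and dot_scale_right: "dot a (r *s b) = r * dot a b"
  and dot_scale_left: "dot (r *s a) b = r * dot a b"
  and dot_add_left: "dot (a + b) c = dot a c + dot b c"
  by (simp_all add: vec3_simps algebra_simps)

lemma dot_commute: "dot a b = dot b a"
  by (simp add: dot_3 mult.commute)

lemma cross_skew: "cross b a = - cross a b"
  by (simp add: vec3_simps)

lemma cross_cross_right: "cross a (cross b c) = dot a c *s b - dot a b *s c"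
  by (simp add: vec3_simps algebra_simps)

lemma cross_cross_left: "cross (cross a b) c = dot a c *s b - dot b c *s a"
  by (simp add: vec3_simps algebra_simps)

lemma cross_eq_0_components: "cross a b = 0 \<Longrightarrow> a $ i * b $ j = a $ j * b $ i"
  using exhaust_3[of i] exhaust_3[of j] by (auto simp: vec3_simps)

lemma dot_axis: "dot (axis i 1) x = x $ i" and dot_axis_right: "dot x (axis i 1) = x $ i"
  by (simp_all add: dot_def axis_def if_distrib[of "\<lambda>x. x * _"] if_distrib[of "\<lambda>x. _ * x"] cong: if_cong)

text \<open>The witness is the cross product of q with the axis vector of a coordinate in which
  \<open>cross p q\<close> does not vanish: it annihilates q, and its value at p is that
  coordinate.\<close>

lemma ex_separating_covector:
  fixes p q :: "'b::field ^ 3"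
  assumes "cross p q \<noteq> 0"
  obtains a where "dot a q = 0" "dot a p \<noteq> 0"
proof -
  obtain i where i: "cross p q $ i \<noteq> 0" using assms by (auto simp: vec_eq_iff)
  have "dot (cross q (axis i 1)) p = cross p q $ i"
    using exhaust_3[of i] by (auto simp: vec3_simps axis_def algebra_simps)
  with i that[of "cross q (axis i 1)"] show ?thesis by (simp add: dot_commute[of "cross _ _"])
qed

text \<open>Phrased by divisibility, so that it makes sense over any commutative ring.\<close>

definition coprime3 :: "'b::comm_ring_1 ^ 3 \<Rightarrow> bool" where
  "coprime3 b \<longleftrightarrow> (\<forall>h. (\<forall>i. h dvd b $ i) \<longrightarrow> h dvd 1)"

lemma coprime3_nonzero: "coprime3 b \<Longrightarrow> \<exists>i. b $ i \<noteq> 0"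
  unfolding coprime3_def by (metis dvd_0_right dvd_0_left zero_neq_one)

lemma dvd_mult_gcd:
  fixes b :: "'b::{factorial_ring_gcd,semiring_gcd_mult_normalize}"
  assumes "b dvd c * p" "b dvd c * q"
  shows "b dvd c * gcd p q"
proof -
  have "b dvd gcd (c * p) (c * q)" using assms by simp
  then show ?thesis by (simp add: gcd_mult_left)
qed

text \<open>Proportionality makes b_j divide a_j b_i for every i, hence divide a_j times the gcd of
  the entries of b, which is a unit. The quotient of a_j by b_j is then the factor for all
  entries.\<close>

lemma parallel_coprime3:
  fixes a b :: "'b::{factorial_ring_gcd,semiring_gcd_mult_normalize} ^ 3"
  assumes par: "cross a b = 0" and cop: "coprime3 b"
  obtains c where "a = c *s b"
proof -
  obtain j where j: "b $ j \<noteq> 0" using coprime3_nonzero[OF cop] by blast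
  have d: "b $ j dvd a $ j * b $ i" for i
    using cross_eq_0_components[OF par, of i j] by (metis dvd_triv_right)
  let ?g = "gcd (b $ 1) (gcd (b $ 2) (b $ 3))"
  have "?g dvd b $ 1" "?g dvd b $ 2" "?g dvd b $ 3"
    by (auto intro: gcd_dvdI2)
  then have "?g dvd 1"
    using cop unfolding coprime3_def forall_3 by blast
  moreover have "b $ j dvd a $ j * ?g"
    using d by (intro dvd_mult_gcd) auto
  ultimately have "b $ j dvd a $ j"
    by (metis dvd_mult_unit_iff)
  then obtain c where c: "a $ j = b $ j * c" by (auto simp: dvd_def)
  have "a $ i = c * b $ i" for i
  proof -
    have "b $ j * a $ i = b $ j * (c * b $ i)"
      using cross_eq_0_components[OF par, of i j] by (simp add: c mult_ac)
    with j show ?thesis by simp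
  qed
  then have "a = c *s b" by (simp add: vec_eq_iff)
  with that show ?thesis .
qed

subsection \<open>Evaluation and differentiation\<close>

lemma ring_hom_fun_eval3: "ring_hom_fun (\<lambda>F. eval3 F v)"
  by (simp add: ring_hom_fun_def eval3_def)

lemmas eval3_simps [simp] = ring_hom_funD[OF ring_hom_fun_eval3]

lemma eval3_sum: "eval3 (sum f T) v = (\<Sum>t\<in>T. eval3 (f t) v)"
  by (rule ring_hom_fun_sum[OF ring_hom_fun_eval3])

lemma eval3_prod: "eval3 (prod f T) v = (\<Prod>t\<in>T. eval3 (f t) v)"
  by (rule ring_hom_fun_prod[OF ring_hom_fun_eval3])

lemma eval3_power: "eval3 (f ^ n) v = eval3 f v ^ n"
  by (rule ring_hom_fun_power[OF ring_hom_fun_eval3])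

lemma eval3_const3 [simp]: "eval3 (const3 c) v = c"
  by (simp add: eval3_def const3_def)

lemma eval3_mon: "eval3 (mon c i j k) v = c * (v $ 1) ^ i * (v $ 2) ^ j * (v $ 3) ^ k"
proof -
  have p: "[:a:] ^ m = [:a ^ m:]" for a :: "'c::comm_ring_1" and m by (induction m) (simp_all add: one_pCons)
  show ?thesis by (simp add: eval3_def mon_def poly_monom p mult_ac)
qed

lemma eval3_dvd: "p dvd q \<Longrightarrow> eval3 p v = 0 \<Longrightarrow> eval3 q v = 0"
  by (auto simp: dvd_def)

lemma eval3_homogeneous_scale: "homogeneous d P \<Longrightarrow> eval3 P (c *s v) = c ^ d * eval3 P v"
  by (induction rule: homogeneous_induct)
     (auto simp: eval3_mon power_mult_distrib power_add algebra_simps)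

definition evalv :: "'a::comm_ring_1 poly3 ^ 3 \<Rightarrow> 'a ^ 3 \<Rightarrow> 'a ^ 3" where
  "evalv b v = (\<chi> i. eval3 (b $ i) v)"

lemma evalv_nth [simp]: "evalv b v $ i = eval3 (b $ i) v"
  by (simp add: evalv_def)

lemma evalv_cross: "evalv (cross a b) v = cross (evalv a v) (evalv b v)"
  by (simp add: vec3_simps)

lemma eval3_dot: "eval3 (dot a b) v = dot (evalv a v) (evalv b v)"
  by (simp add: vec3_simps)

lemma evalv_scale: "evalv (r *s a) v = eval3 r v *s evalv a v"
  by (simp add: vec_eq_iff)

definition vars :: "'a::comm_ring_1 poly3 ^ 3" where
  "vars = vector [mon 1 1 0 0, mon 1 0 1 0, mon 1 0 0 1]"

lemma vars_3: "vars $ 1 = mon 1 1 0 0" "vars $ 2 = mon 1 0 1 0" "vars $ 3 = mon 1 0 0 1"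
  by (simp_all add: vars_def vector_3)

lemma evalv_vars [simp]: "evalv vars v = v"
  by (simp add: vec3_eq_iff vars_3 eval3_mon)

lemma eval3_vars [simp]: "eval3 (vars $ i) v = v $ i"
  by (metis evalv_nth evalv_vars)

lemma homogeneous_vars: "homogeneous 1 (vars $ i)"
  using exhaust_3[of i] by (auto simp: vars_3 intro!: homogeneous_mon)

lemma vars_nonzero: "vars $ i \<noteq> (0 :: 'a::comm_ring_1 poly3)"
proof
  assume "vars $ i = (0 :: 'a poly3)"
  then have "eval3 (vars $ i) 1 = (0 :: 'a)" by simp
  then show False by simp
qed

definition lin :: "'a::comm_ring_1 ^ 3 \<Rightarrow> 'a poly3" where
  "lin a = dot (\<chi> i. const3 (a $ i)) vars"

lemma eval3_lin [simp]: "eval3 (lin a) v = dot a v"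
  by (simp add: lin_def vec3_simps)

lemma homogeneous_lin: "homogeneous 1 (lin a)"
  unfolding lin_def dot_def
  by (intro homogeneous_sum) (simp add: homogeneous_const3_mult homogeneous_vars[unfolded One_nat_def])

lemma lin_add: "lin (a + b) = lin a + lin b" and lin_scale: "lin (c *s a) = const3 c * lin a"
  by (simp_all add: lin_def vec3_simps algebra_simps)

definition derivation :: "('b::comm_ring_1 \<Rightarrow> 'b) \<Rightarrow> bool" where
  "derivation D \<longleftrightarrow> (\<forall>a b. D (a + b) = D a + D b) \<and> (\<forall>a b. D (a * b) = a * D b + b * D a)"

lemma derivation_0: "derivation D \<Longrightarrow> D 0 = 0"
  unfolding derivation_def by (metis add_cancel_right_right)

lemma derivation_sum: "derivation D \<Longrightarrow> D (sum f T) = (\<Sum>t\<in>T. D (f t))"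
  by (induction T rule: infinite_finite_induct) (simp_all add: derivation_0, simp add: derivation_def)

text \<open>The partial derivatives in x and y act on the coefficients of the nested polynomial
  ring; this brings them under the same Leibniz rule as the one in z.\<close>

lemma derivation_map_poly:
  assumes D: "derivation D"
  shows "derivation (map_poly D)"
  unfolding derivation_def
proof (intro conjI allI)
  note [simp] = derivation_0[OF D]
  have 1: "D (a + b) = D a + D b" "D (a * b) = a * D b + b * D a" for a b
    using D by (auto simp: derivation_def)
  fix a b
  show "map_poly D (a + b) = map_poly D a + map_poly D b"
    by (rule poly_eqI) (simp add: coeff_map_poly 1)
  show "map_poly D (a * b) = a * map_poly D b + b * map_poly D a"
  proof (rule poly_eqI)
    fix n
    have e: "b * map_poly D a = map_poly D a * b" by (rule mult.commute)
    have 2: "D (a * b) = a * D b + D a * b" for a b by (simp add: 1 mult.commute)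
    show "Polynomial.coeff (map_poly D (a * b)) n = Polynomial.coeff (a * map_poly D b + b * map_poly D a) n"
      by (simp add: e coeff_map_poly coeff_mult derivation_sum[OF D] 2 sum.distrib)
  qed
qed

lemma derivation_pderiv: "derivation (pderiv :: 'a::idom poly \<Rightarrow> 'a poly)"
  by (simp add: derivation_def pderiv_add pderiv_mult)

lemma grad_3:
  "grad F $ 1 = map_poly (map_poly pderiv) F" "grad F $ 2 = map_poly pderiv F" "grad F $ 3 = pderiv F"
  by (simp_all add: grad_def vector_3)

lemma derivation_grad: "derivation (\<lambda>F. grad F $ i)"
  using exhaust_3[of i] by (auto simp: grad_3 intro!: derivation_map_poly derivation_pderiv)

lemma grad_add: "grad (A + B) = grad A + grad B"
proof -
  have "grad (A + B) $ i = grad A $ i + grad B $ i" for i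
    using derivation_grad[of i] unfolding derivation_def by blast
  then show ?thesis by (simp add: vec_eq_iff)
qed

lemma grad_mult: "grad (A * B) = A *s grad B + B *s grad A"
proof -
  have "grad (A * B) $ i = A * grad B $ i + B * grad A $ i" for i
    using derivation_grad[of i] unfolding derivation_def by blast
  then show ?thesis by (simp add: vec_eq_iff)
qed

lemma grad_0 [simp]: "grad 0 = 0"
  using grad_add[of 0 0] by simp

lemma of_nat_mult_monom: "of_nat m * monom c n = monom (of_nat m * c) n" for c :: "'a::comm_ring_1"
  by (induction m) (simp_all add: distrib_right add_monom)

lemma grad_mon:
  "grad (mon c i j k) $ 1 = mon (of_nat i * c) (i - 1) j k"
  "grad (mon c i j k) $ 2 = mon (of_nat j * c) i (j - 1) k"
  "grad (mon c i j k) $ 3 = mon (of_nat k * c) i j (k - 1)"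
  by (simp_all add: grad_3 mon_def map_poly_monom pderiv_monom of_nat_mult_monom)

lemma grad_const3 [simp]: "grad (const3 c) = 0"
  by (simp add: vec3_eq_iff const3_mon grad_mon)

lemma homogeneous_grad: "homogeneous d F \<Longrightarrow> homogeneous (d - 1) (grad F $ i)"
proof (induction rule: homogeneous_induct)
  case (mon c a b e)
  have "homogeneous (d - 1) (mon (of_nat a * c) (a - 1) b e)"
    "homogeneous (d - 1) (mon (of_nat b * c) a (b - 1) e)"
    "homogeneous (d - 1) (mon (of_nat e * c) a b (e - 1))"
    by (cases a; cases b; cases e; use mon in \<open>auto intro!: homogeneous_mon\<close>)+
  then show ?case using exhaust_3[of i] by (auto simp: grad_mon)
qed (simp add: grad_add homogeneous_add)

lemma euler: "homogeneous d F \<Longrightarrow> dot vars (grad F) = of_nat d * F"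
proof (induction rule: homogeneous_induct)
  case (mon c i j k)
  have *: "mon 1 1 0 0 * mon (of_nat i * c) (i - 1) j k = of_nat i * mon c i j k"
    "mon 1 0 1 0 * mon (of_nat j * c) i (j - 1) k = of_nat j * mon c i j k"
    "mon 1 0 0 1 * mon (of_nat k * c) i j (k - 1) = of_nat k * mon c i j k"
    by (cases i; cases j; cases k; simp add: mon_mult const3_of_nat[symmetric] const3_mon del: of_nat_Suc)+
  show ?case unfolding dot_3 vars_3 grad_mon * mon[symmetric] by (simp add: algebra_simps)
qed (simp_all add: grad_add dot_add_right algebra_simps)

lemma dot_evalv_grad:
  assumes "homogeneous d F"
  shows "dot p (evalv (grad F) p) = of_nat d * eval3 F p"
proof -
  have "dot p (evalv (grad F) p) = eval3 (dot vars (grad F)) p" by (simp add: eval3_dot)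
  then show ?thesis by (simp add: euler[OF assms] flip: const3_of_nat)
qed

lemma eval3_zero_if_grad_zero:
  fixes F :: "'a::field_char_0 poly3"
  assumes "homogeneous d F" "d \<ge> 1" "evalv (grad F) p = 0"
  shows "eval3 F p = 0"
  using dot_evalv_grad[OF assms(1), of p] assms(2,3) by simp

lemma grad_commute: "grad (grad F $ i) $ j = grad (grad F $ j) $ i"
proof (induction F rule: poly3_induct)
  case (mon c a b d)
  show ?case using exhaust_3[of i] exhaust_3[of j] by (auto simp: grad_mon mult.left_commute)
qed (simp_all add: grad_add)

lemma grad_sum: "grad (sum f T) = (\<Sum>t\<in>T. grad (f t))"
  by (induction T rule: infinite_finite_induct) (simp_all add: grad_add)

lemma grad_1 [simp]: "grad 1 = 0"
  using grad_const3[of 1] by simp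

subsection \<open>Extension of scalars to the algebraic closure\<close>

lemma ring_hom_fun_lift3: "ring_hom_fun (lift3 :: 'a::field poly3 \<Rightarrow> _)"
proof -
  have "ring_hom_fun (to_ac :: 'a \<Rightarrow> _)" by (simp add: ring_hom_fun_def)
  then show ?thesis unfolding lift3_def[abs_def] by (intro ring_hom_fun_map_poly)
qed

lemmas lift3_simps [simp] = ring_hom_funD[OF ring_hom_fun_lift3]

lemma coeff3_lift3: "coeff3 (lift3 F) i j k = to_ac (coeff3 F i j k)"
  by (simp add: coeff3_def lift3_def coeff_map_poly)

lemma lift3_mon: "lift3 (mon c i j k) = mon (to_ac c) i j k"
  by (simp add: lift3_def mon_def map_poly_monom)

lemma lift3_const3: "lift3 (const3 c) = const3 (to_ac c)"
  by (simp add: const3_mon lift3_mon)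

lemma lift3_eq_iff [simp]: "lift3 A = lift3 B \<longleftrightarrow> A = B"
  by (metis coeff3_ext coeff3_lift3 to_ac_eq_iff)

lemma lift3_eq_0_iff [simp]: "lift3 A = 0 \<longleftrightarrow> A = 0"
  by (metis lift3_eq_iff lift3_simps(2))

lemma homogeneous_lift3 [simp]: "homogeneous d (lift3 F) \<longleftrightarrow> homogeneous d F"
  by (simp add: homogeneous_def coeff3_lift3)

lemma grad_lift3: "grad (lift3 F) $ i = lift3 (grad F $ i)"
proof (induction F rule: poly3_induct)
  case (mon c a b d)
  show ?case using exhaust_3[of i] by (auto simp: grad_mon lift3_mon)
qed (simp add: grad_add)

definition liftv :: "'a::field poly3 ^ 3 \<Rightarrow> 'a alg_closure poly3 ^ 3" where
  "liftv b = (\<chi> i. lift3 (b $ i))"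

lemma liftv_nth [simp]: "liftv b $ i = lift3 (b $ i)"
  by (simp add: liftv_def)

lemma liftv_grad: "liftv (grad F) = grad (lift3 F)"
  by (simp add: vec_eq_iff grad_lift3)

lemma liftv_cross: "liftv (cross a b) = cross (liftv a) (liftv b)"
  by (simp add: vec3_simps)

lemma lift3_dot: "lift3 (dot a b) = dot (liftv a) (liftv b)"
  by (simp add: vec3_simps)

lemma liftv_0 [simp]: "liftv 0 = 0"
  by (simp add: vec_eq_iff)

text \<open>Extends the map sending 1 to 1 from the K-line through 1 to a K-linear map on the whole
  closure. It takes the place of faithful flatness in all descent arguments.\<close>

lemma ex_retraction:
  obtains r :: "'a::field alg_closure \<Rightarrow> 'a"
  where "\<And>x y. r (x + y) = r x + r y" "\<And>c x. r (to_ac c * x) = c * r x" "r 1 = 1"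
proof -
  interpret v: vector_space "\<lambda>(c::'a) (x::'a alg_closure). to_ac c * x"
    by unfold_locales (simp_all add: algebra_simps)
  interpret w: vector_space "(*) :: 'a \<Rightarrow> 'a \<Rightarrow> 'a"
    by unfold_locales (simp_all add: algebra_simps)
  interpret p: vector_space_pair "\<lambda>(c::'a) (x::'a alg_closure). to_ac c * x" "(*) :: 'a \<Rightarrow> 'a \<Rightarrow> 'a" ..
  have "v.independent {1}" by simp
  from p.linear_independent_extend[OF this, of "\<lambda>_. 1"]
  obtain r where r: "Vector_Spaces.linear (\<lambda>(c::'a) (x::'a alg_closure). to_ac c * x) (*) r" "r 1 = 1" by auto
  interpret l: Vector_Spaces.linear "\<lambda>(c::'a) (x::'a alg_closure). to_ac c * x" "(*)" r by (rule r(1))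
  show ?thesis by (rule that[of r]) (use l.add l.scale r(2) in auto)
qed

text \<open>Applied to coefficients the retraction is linear over S, so a linear equation with
  coefficients in S that is solvable over the closure is solvable over S.\<close>

lemma ex_retraction3:
  obtains R :: "'a::field alg_closure poly3 \<Rightarrow> 'a poly3"
  where "\<And>A B. R (A + B) = R A + R B" "\<And>A B. R (lift3 A * B) = A * R B" "\<And>A. R (lift3 A) = A"
proof -
  obtain r :: "'a alg_closure \<Rightarrow> 'a" where
    r: "\<And>x y. r (x + y) = r x + r y" "\<And>c x. r (to_ac c * x) = c * r x" "r 1 = 1"
    using ex_retraction by metis
  have r0: "r 0 = 0" using r(2)[of 0 0] by simp
  define R where "R = map_poly (map_poly (map_poly r))"
  have add: "R (A + B) = R A + R B" for A B
    by (rule coeff3_ext) (simp add: R_def coeff3_def coeff_map_poly r0 r)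
  have mon: "R (mon c i j k) = mon (r c) i j k" for c i j k
    by (simp add: R_def mon_def map_poly_monom r0)
  have mult: "R (lift3 A * B) = A * R B" for A B
  proof (induction A rule: poly3_induct)
    case (mon c i j k)
    show ?case
      by (induction B rule: poly3_induct)
         (simp_all add: lift3_mon mon_mult \<open>\<And>c i j k. R (mon c i j k) = mon (r c) i j k\<close> r(2) add distrib_left)
  qed (simp add: add distrib_right)
  have "R 1 = 1" using mon[of 1 0 0 0] by (simp add: mon_1 r(3))
  then have "R (lift3 A) = A" for A using mult[of A 1] by simp
  with that[of R] add mult show ?thesis by blast
qed

lemma lift3_dvd_iff: "lift3 A dvd lift3 B \<longleftrightarrow> A dvd B"
proof
  assume "lift3 A dvd lift3 B"
  then obtain Q where Q: "lift3 B = lift3 A * Q" by (auto simp: dvd_def)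
  obtain R :: "'a alg_closure poly3 \<Rightarrow> 'a poly3" where
    R: "\<And>A B. R (lift3 A * B) = A * R B" "\<And>A. R (lift3 A) = A" using ex_retraction3 by metis
  have "B = A * R Q" by (metis Q R)
  then show "A dvd B" by simp
qed (auto simp: dvd_def)

text \<open>Only the divisibility of one entry is taken from the closure; the factor itself is then
  computed in S.\<close>

lemma parallel_coprime3_descent:
  fixes a b :: "'a::field poly3 ^ 3"
  assumes par: "cross a b = 0" and cop: "coprime3 (liftv b)"
  obtains c where "a = c *s b"
proof -
  obtain j where j: "b $ j \<noteq> 0" using coprime3_nonzero[OF cop] by auto
  have "cross (liftv a) (liftv b) = 0" using par liftv_cross[of a b] by simp
  from parallel_coprime3[OF this cop] obtain c' where "liftv a = c' *s liftv b" .
  then have "lift3 (a $ j) = c' * lift3 (b $ j)" by (metis liftv_nth vector_smult_component)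
  then have "b $ j dvd a $ j" by (metis dvd_triv_right lift3_dvd_iff)
  then obtain c where c: "a $ j = b $ j * c" by (auto simp: dvd_def)
  have "a $ i = c * b $ i" for i
  proof -
    have "b $ j * a $ i = b $ j * (c * b $ i)"
      using cross_eq_0_components[OF par, of i j] by (simp add: c mult_ac)
    with j show ?thesis by simp
  qed
  then have "a = c *s b" by (simp add: vec_eq_iff)
  with that show ?thesis .
qed

section \<open>Intersections of plane curves\<close>

lemma vector_space_poly3: "vector_space (\<lambda>c P. const3 c * P :: 'b::field poly3)"
  by unfold_locales (simp_all add: algebra_simps)

global_interpretation poly3: vector_space "\<lambda>c P. const3 c * P :: 'b::field poly3"
  by (rule vector_space_poly3)

context vector_space
begin

lemma independent_finite_iff:
  assumes "finite A"
  shows "independent A \<longleftrightarrow> (\<forall>f. (\<Sum>x\<in>A. f x *s x) = 0 \<longrightarrow> (\<forall>x\<in>A. f x = 0))"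
proof
  assume "independent A"
  then show "\<forall>f. (\<Sum>x\<in>A. f x *s x) = 0 \<longrightarrow> (\<forall>x\<in>A. f x = 0)"
    using assms unfolding independent_explicit_finite_subsets by blast
qed (use independent_if_scalars_zero[OF assms] in blast)

lemma independent_Un:
  assumes fin: "finite A" "finite B" and ind: "independent A" "independent B"
    and span: "span A \<inter> span B \<subseteq> {0}"
  shows "independent (A \<union> B)" "A \<inter> B = {}"
proof -
  show disj: "A \<inter> B = {}"
    using span ind span_base dependent_zero by blast
  show "independent (A \<union> B)"
    unfolding independent_finite_iff[OF finite_UnI[OF fin]]
  proof (intro allI impI)
    fix f assume "(\<Sum>x\<in>A \<union> B. f x *s x) = 0"
    then have s: "(\<Sum>x\<in>A. f x *s x) + (\<Sum>x\<in>B. f x *s x) = 0"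
      using sum.union_disjoint[OF fin disj, of "\<lambda>x. f x *s x"] by simp
    then have "(\<Sum>x\<in>A. f x *s x) = - (\<Sum>x\<in>B. f x *s x)" by (simp add: eq_neg_iff_add_eq_0)
    moreover have "(\<Sum>x\<in>A. f x *s x) \<in> span A" "- (\<Sum>x\<in>B. f x *s x) \<in> span B"
      by (intro span_sum span_scale span_base span_neg; simp)+
    ultimately have "(\<Sum>x\<in>A. f x *s x) = 0" using span by auto
    moreover from this have "(\<Sum>x\<in>B. f x *s x) = 0" using s by simp
    ultimately show "\<forall>x\<in>A \<union> B. f x = 0"
      using ind independent_finite_iff[OF fin(1)] independent_finite_iff[OF fin(2)] by blast
  qed
qed

lemma span_Int_independent_Un:
  assumes fin: "finite A" "finite B" and ind: "independent (A \<union> B)" and disj: "A \<inter> B = {}"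
  shows "span A \<inter> span B \<subseteq> {0}"
proof
  fix x assume "x \<in> span A \<inter> span B"
  then have "x \<in> span A" "x \<in> span B" by auto
  then obtain f g where f: "x = (\<Sum>a\<in>A. f a *s a)" and g: "x = (\<Sum>b\<in>B. g b *s b)"
    unfolding span_finite[OF fin(1)] span_finite[OF fin(2)] by blast
  define h where "h y = (if y \<in> A then f y else - g y)" for y
  have "(\<Sum>y\<in>A \<union> B. h y *s y) = (\<Sum>y\<in>A. h y *s y) + (\<Sum>y\<in>B. h y *s y)"
    by (rule sum.union_disjoint[OF fin disj])
  also have "(\<Sum>y\<in>A. h y *s y) = x" unfolding f by (rule sum.cong) (auto simp: h_def)
  also have "(\<Sum>y\<in>B. h y *s y) = (\<Sum>y\<in>B. - (g y *s y))"
    by (rule sum.cong) (use disj in \<open>auto simp: h_def\<close>)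
  also have "\<dots> = - x" unfolding g by (simp add: sum_negf)
  finally have "(\<Sum>y\<in>A \<union> B. h y *s y) = 0" by simp
  then have "\<forall>y\<in>A. f y = 0"
    using ind independent_finite_iff[OF finite_UnI[OF fin]] by (metis UnI1 h_def)
  then show "x \<in> {0}" by (simp add: f)
qed

end

section \<open>Dimension count for the ideal of two coprime forms\<close>

definition monset :: "nat \<Rightarrow> 'b::field poly3 set" where
  "monset d = (\<lambda>(i, j, k). mon 1 i j k) ` triples d"

lemma inj_mon: "inj_on (\<lambda>(i, j, k). mon (1::'b::field) i j k) T"
  by (auto simp: inj_on_def) (metis coeff3_mon zero_neq_one)+

text \<open>Induction by splitting off the monomials divisible by z. The doubling avoids a division
  in the binomial coefficient.\<close>

lemma card_triples: "2 * card (triples d) = (d + 1) * (d + 2)"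
proof (induction d)
  case 0
  have "triples 0 = {(0, 0, 0)}" by (auto simp: triples_def)
  then show ?case by simp
next
  case (Suc d)
  have "triples (Suc d) = (\<lambda>(i, j, k). (i, j, Suc k)) ` triples d \<union> (\<lambda>i. (i, Suc d - i, 0)) ` {..Suc d}"
    (is "_ = ?A \<union> ?B")
  proof (rule Set.set_eqI)
    fix t :: "nat \<times> nat \<times> nat"
    obtain i j k where t: "t = (i, j, k)" by (cases t)
    show "t \<in> triples (Suc d) \<longleftrightarrow> t \<in> ?A \<union> ?B"
      by (cases k) (force simp: t triples_def image_iff)+
  qed
  moreover have "?A \<inter> ?B = {}" by auto
  moreover have "card ?A = card (triples d)" by (rule card_image) (auto simp: inj_on_def)
  moreover have "card ?B = d + 2" by (subst card_image) (auto simp: inj_on_def)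
  ultimately have "card (triples (Suc d)) = card (triples d) + (d + 2)"
    by (simp add: card_Un_disjoint)
  with Suc show ?case by (simp add: algebra_simps)
qed

lemma card_monset: "card (monset d) = card (triples d)"
  unfolding monset_def by (rule card_image[OF inj_mon])

lemma finite_monset [simp]: "finite (monset d)"
  by (simp add: monset_def)

lemma independent_monset: "poly3.independent (monset d :: 'b::field poly3 set)"
  unfolding poly3.independent_finite_iff[OF finite_monset]
proof (intro allI impI ballI)
  fix f :: "'b poly3 \<Rightarrow> 'b" and P :: "'b poly3"
  assume s: "(\<Sum>x\<in>monset d. const3 (f x) * x) = 0" and "P \<in> monset d"
  then obtain i j k where P: "P = mon 1 i j k" "(i, j, k) \<in> triples d" by (auto simp: monset_def)
  have "0 = coeff3 (\<Sum>x\<in>monset d. const3 (f x) * x) i j k" by (simp add: s)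
  also have "\<dots> = (\<Sum>t\<in>triples d. coeff3 (const3 (f (case t of (i, j, k) \<Rightarrow> mon 1 i j k)) * (case t of (i, j, k) \<Rightarrow> mon 1 i j k)) i j k)"
    unfolding monset_def coeff3_sum by (rule sum.reindex[OF inj_mon, unfolded comp_def])
  also have "\<dots> = (\<Sum>t\<in>triples d. if t = (i, j, k) then f P else 0)"
    by (rule sum.cong) (auto simp: coeff3_mon P split: if_splits)
  also have "\<dots> = f P" using P by simp
  finally show "f P = 0" by simp
qed

lemma homogeneous_span_monset:
  fixes P :: "'b::field poly3"
  assumes "homogeneous d P"
  shows "P \<in> poly3.span (monset d)"
proof -
  have e: "mon c i j k = const3 c * mon 1 i j k" for c :: 'b and i j k
    by (simp add: const3_mon mon_mult)
  have "(\<Sum>(i, j, k)\<in>triples d. mon (coeff3 P i j k) i j k)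
    = (\<Sum>(i, j, k)\<in>triples d. const3 (coeff3 P i j k) * mon 1 i j k)"
    by (rule sum.cong[OF refl]) (clarify, rule e)
  then have "P = (\<Sum>(i, j, k)\<in>triples d. const3 (coeff3 P i j k) * mon 1 i j k)"
    by (rule trans[OF homogeneous_expand[OF assms]])
  also have "\<dots> \<in> poly3.span (monset d)"
    unfolding monset_def
  proof (intro poly3.span_sum)
    fix t :: "nat \<times> nat \<times> nat" assume "t \<in> triples d"
    then have "(case t of (i, j, k) \<Rightarrow> mon (1::'b) i j k) \<in> (\<lambda>(i, j, k). mon 1 i j k) ` triples d" by (rule imageI)
    then show "(case t of (i, j, k) \<Rightarrow> const3 (coeff3 P i j k) * mon 1 i j k)
        \<in> poly3.span ((\<lambda>(i, j, k). mon 1 i j k) ` triples d)"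
      by (cases t) (simp add: poly3.span_scale poly3.span_base)
  qed
  finally show ?thesis .
qed

lemma span_homogeneous:
  assumes "P \<in> poly3.span B" "\<And>b. b \<in> B \<Longrightarrow> homogeneous d b"
  shows "homogeneous d P"
  using assms by (induction rule: poly3.span_induct_alt) (auto intro: homogeneous_add homogeneous_const3_mult)

lemma homogeneous_monset: "b \<in> monset d \<Longrightarrow> homogeneous d b"
  by (auto simp: monset_def triples_def intro: homogeneous_mon)

lemma span_times_image:
  assumes "P \<in> poly3.span ((*) G ` B)"
  shows "\<exists>Q \<in> poly3.span B. P = G * Q"
  using assms
proof (induction rule: poly3.span_induct_alt)
  case base
  show ?case using poly3.span_zero by force
next
  case (step c p r)
  then obtain b Q where "b \<in> B" "p = G * b" "Q \<in> poly3.span B" "r = G * Q" by auto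
  then show ?case
    by (intro bexI[of _ "const3 c * b + Q"])
       (auto simp: distrib_left mult.left_commute intro: poly3.span_add poly3.span_scale poly3.span_base)
qed

lemma times_span_image: "Q \<in> poly3.span B \<Longrightarrow> G * Q \<in> poly3.span ((*) G ` B)"
proof (induction rule: poly3.span_induct_alt)
  case (step c p r)
  have "G * (const3 c * p + r) = const3 c * (G * p) + G * r" by (simp add: algebra_simps)
  moreover have "const3 c * (G * p) + G * r \<in> poly3.span ((*) G ` B)"
    by (intro poly3.span_add poly3.span_scale poly3.span_base step imageI)
  ultimately show ?case by simp
qed (simp add: poly3.span_zero)

lemma independent_times_image:
  assumes "finite B" "poly3.independent B" "G \<noteq> 0"
  shows "poly3.independent ((*) G ` B)" "card ((*) G ` B) = card B"
proof -
  have inj: "inj_on ((*) G) B" using assms(3) by (auto simp: inj_on_def)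
  then show "card ((*) G ` B) = card B" by (rule card_image)
  show "poly3.independent ((*) G ` B)"
    unfolding poly3.independent_finite_iff[OF finite_imageI[OF assms(1)]]
  proof (intro allI impI ballI)
    fix f y assume s: "(\<Sum>x\<in>(*) G ` B. const3 (f x) * x) = 0" and "y \<in> (*) G ` B"
    then obtain x where x: "x \<in> B" "y = G * x" by auto
    have "0 = (\<Sum>x\<in>B. const3 (f (G * x)) * (G * x))"
      using s sum.reindex[OF inj, of "\<lambda>x. const3 (f x) * x"] by (simp add: comp_def)
    also have "\<dots> = G * (\<Sum>x\<in>B. const3 (f (G * x)) * x)" by (simp add: sum_distrib_left mult.left_commute)
    finally have "(\<Sum>x\<in>B. const3 (f (G * x)) * x) = 0" using assms(3) by simp
    then have "\<forall>x\<in>B. f (G * x) = 0"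
      using assms(2)[unfolded poly3.independent_finite_iff[OF assms(1)]] by (elim allE[of _ "\<lambda>x. f (G * x)"]) simp
    then show "f y = 0" using x by simp
  qed
qed

text \<open>The two gcd classes are imposed on the field so that the nested polynomial rings over it
  become factorial rings with gcd.\<close>

class ac_field = alg_closed_field + field_char_0 + factorial_ring_gcd + semiring_gcd_mult_normalize

instance alg_closure :: (field_char_0) ac_field ..

lemma ex_irreducible_factor:
  fixes h :: "'r::factorial_semiring"
  assumes "h \<noteq> 0" "\<not> h dvd 1"
  obtains p where "irreducible p" "p dvd h"
  using prime_divisor_exists[OF assms] prime_elem_imp_irreducible prime_imp_prime_elem by blast

text \<open>The dimension count behind Bezout's theorem: by the Koszul complex, the part of degree
  \<open>m\<close> of the ideal generated by two coprime forms has codimension \<open>d1 * d2\<close>.\<close>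

lemma ex_combination_in_ideal:
  fixes G1 G2 :: "'b::ac_field poly3"
  assumes G1: "homogeneous d1 G1" "G1 \<noteq> 0" and G2: "homogeneous d2 G2" "G2 \<noteq> 0"
    and cop: "coprime G1 G2" and m: "m \<ge> d1 + d2"
    and W: "\<And>i. i \<le> d1 * d2 \<Longrightarrow> homogeneous m (W i)"
  shows "\<exists>c A B. (\<exists>i\<le>d1 * d2. c i \<noteq> 0) \<and> (\<Sum>i\<le>d1 * d2. const3 (c i) * W i) = A * G1 + B * G2"
proof (rule ccontr)
  assume neg: "\<not> ?thesis"
  have no: "c i = 0" if "(\<Sum>i\<le>d1 * d2. const3 (c i) * W i) = A * G1 + B * G2" "i \<le> d1 * d2"
    for c A B i
    using that neg by blast
  obtain e where m_eq: "m = d1 + d2 + e" using m nat_le_iff_add by blast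
  define M where "M = (*) G2 ` (monset e :: 'b poly3 set)"
  have M: "finite M" "poly3.independent M" "card M = card (triples e)"
    using independent_times_image[OF finite_monset independent_monset G2(2), of e]
    by (auto simp: M_def card_monset)
  have Mh: "homogeneous (d2 + e) p" if "p \<in> M" for p
    using that G2 by (auto simp: M_def intro: homogeneous_mult homogeneous_monset)
  obtain X0 where X0: "M \<subseteq> X0" "X0 \<subseteq> {P :: 'b poly3. homogeneous (d2 + e) P}" "poly3.independent X0"
    "{P :: 'b poly3. homogeneous (d2 + e) P} \<subseteq> poly3.span X0"
    using poly3.maximal_independent_subset_extend[of M "{P :: 'b poly3. homogeneous (d2 + e) P}"] Mh M by blast
  have "card X0 = poly3.dim {P :: 'b poly3. homogeneous (d2 + e) P}"
    by (rule poly3.basis_card_eq_dim[OF X0(2,4,3)])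
  also have "\<dots> = card (monset (d2 + e) :: 'b poly3 set)"
    by (rule poly3.basis_card_eq_dim[symmetric])
       (auto simp: homogeneous_monset homogeneous_span_monset independent_monset)
  finally have cX0: "card X0 = card (triples (d2 + e))" by (simp add: card_monset)
  have finX0: "finite X0"
  proof -
    have "X0 \<subseteq> poly3.span (monset (d2 + e))" using X0(2) homogeneous_span_monset by blast
    then show ?thesis using poly3.independent_span_bound[OF finite_monset X0(3)] by blast
  qed
  \<comment> \<open>\<open>X1\<close> spans a complement of G2 S_e in the forms of degree d2 + e.
    Multiplying only this complement by G1 removes the Koszul overlap G1 G2 S_e, so the products
    with G1 become independent of the multiples of G2; this is where coprimality enters.\<close>
  define X1 where "X1 = X0 - M"
  have X1: "finite X1" "poly3.independent X1" "poly3.span X1 \<inter> poly3.span M \<subseteq> {0}"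
    using finX0 X0 poly3.independent_mono[of X0 X1] poly3.span_Int_independent_Un[of X1 M] M
    by (auto simp: X1_def Un_absorb2 Diff_partition)
  have cX1: "card X1 + card (triples e) = card (triples (d2 + e))"
    using card_Diff_subset[OF M(1) X0(1)] card_mono[OF finX0 X0(1)] by (simp add: X1_def cX0 M)
  define P1 where "P1 = (*) G1 ` X1"
  define P2 where "P2 = (*) G2 ` (monset (d1 + e) :: 'b poly3 set)"
  note P1 = independent_times_image[OF X1(1,2) G1(2), folded P1_def]
  note P2 = independent_times_image[OF finite_monset independent_monset G2(2), of "d1 + e", folded P2_def]
  have fin: "finite P1" "finite P2" by (simp_all add: P1_def P2_def X1)
  have X1h: "homogeneous (d2 + e) p" if "p \<in> X1" for p using that X0 by (auto simp: X1_def)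
  have "poly3.span P1 \<inter> poly3.span P2 \<subseteq> {0}"
  proof
    fix p assume "p \<in> poly3.span P1 \<inter> poly3.span P2"
    then obtain x y where x: "x \<in> poly3.span X1" "p = G1 * x" and y: "p = G2 * y"
      unfolding P1_def P2_def using span_times_image by blast
    have "G2 dvd G1 * x" using x y by (metis dvd_triv_left)
    then have "G2 dvd x" using cop by (simp add: coprime_commute coprime_dvd_mult_right_iff)
    then obtain h where h: "x = G2 * h" by (auto simp: dvd_def)
    have "homogeneous (d2 + e) x" using span_homogeneous[OF x(1) X1h] .
    then have "homogeneous e h" using homogeneous_cofactor[of d2 e G2 h] G2 h by simp
    then have "x \<in> poly3.span M"
      unfolding M_def h by (intro times_span_image homogeneous_span_monset)
    with x X1(3) show "p \<in> {0}" by auto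
  qed
  note P12 = poly3.independent_Un[OF fin P1(1) P2(1) this]
  \<comment> \<open>Repeated forms would already give the combination 0 with coefficients 1 and -1,
    so there are d1 * d2 + 1 distinct forms W i.\<close>
  have W0: "W i \<noteq> W j" if "i \<le> d1 * d2" "j < i" for i j
  proof
    assume eq: "W i = W j"
    have "(\<Sum>l\<le>d1 * d2. const3 (if l = i then 1 else if l = j then -1 else 0) * W l)
      = (\<Sum>l\<le>d1 * d2. (if l = i then W i else 0) - (if l = j then W j else 0))"
      by (rule sum.cong) (use that in auto)
    also have "\<dots> = 0 * G1 + 0 * G2" using that eq by (simp add: sum_subtractf)
    finally have s: "(\<Sum>l\<le>d1 * d2. const3 (if l = i then 1 else if l = j then -1 else 0) * W l) = 0 * G1 + 0 * G2" .
    from no[OF s that(1)] show False by simp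
  qed
  then have injW: "inj_on W {..d1 * d2}"
    by (metis (no_types, lifting) atMost_iff inj_onI linorder_neqE_nat)
  define WW where "WW = W ` {..d1 * d2}"
  have WW_sum: "(\<Sum>x\<in>WW. const3 (f x) * x) = (\<Sum>i\<le>d1 * d2. const3 (f (W i)) * W i)" for f
    unfolding WW_def by (simp add: sum.reindex[OF injW])
  have finW: "finite WW" by (simp add: WW_def)
  have WW: "card WW = d1 * d2 + 1" using card_image[OF injW] by (simp add: WW_def)
  have indW: "poly3.independent WW"
    unfolding poly3.independent_finite_iff[OF finW]
  proof (intro allI impI ballI)
    fix f x assume "(\<Sum>x\<in>WW. const3 (f x) * x) = 0" "x \<in> WW"
    then show "f x = 0" using no[of "\<lambda>i. f (W i)" 0 0] WW_sum[of f] by (auto simp: WW_def)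
  qed
  have "poly3.span WW \<inter> poly3.span (P1 \<union> P2) \<subseteq> {0}"
  proof
    fix p assume p: "p \<in> poly3.span WW \<inter> poly3.span (P1 \<union> P2)"
    then obtain f where f: "p = (\<Sum>x\<in>WW. const3 (f x) * x)"
      using poly3.span_finite[OF finW] by auto
    from p have "p \<in> poly3.span (P1 \<union> P2)" by blast
    then obtain a b where ab: "p = a + b" "a \<in> poly3.span P1" "b \<in> poly3.span P2"
      unfolding poly3.span_Un by blast
    from ab obtain A B where "a = G1 * A" "b = G2 * B"
      using span_times_image unfolding P1_def P2_def by blast
    then have "(\<Sum>i\<le>d1 * d2. const3 (f (W i)) * W i) = A * G1 + B * G2"
      using f ab WW_sum[of f] by (simp add: mult.commute)
    then have "\<forall>i\<le>d1 * d2. f (W i) = 0" using no[of "\<lambda>i. f (W i)"] by blast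
    then show "p \<in> {0}" by (simp add: f WW_sum)
  qed
  note all = poly3.independent_Un[OF finW finite_UnI[OF fin] indW P12(1) this]
  have "WW \<union> (P1 \<union> P2) \<subseteq> poly3.span (monset m)"
  proof -
    have "homogeneous m p" if "p \<in> P1" for p
      using that homogeneous_mult[OF G1(1) X1h] by (auto simp: P1_def m_eq add.assoc)
    moreover have "homogeneous m p" if "p \<in> P2" for p
    proof -
      have "m = d2 + (d1 + e)" by (simp add: m_eq)
      then show ?thesis using that homogeneous_mult[OF G2(1) homogeneous_monset, of _ "d1 + e"]
        by (auto simp: P2_def)
    qed
    ultimately show ?thesis using W by (auto simp: WW_def intro: homogeneous_span_monset)
  qed
  from poly3.independent_span_bound[OF finite_monset all(1) this]
  have "card (WW \<union> (P1 \<union> P2)) \<le> card (triples m)" by (simp add: card_monset)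
  moreover have "card (WW \<union> (P1 \<union> P2)) = d1 * d2 + 1 + (card X1 + card (triples (d1 + e)))"
    using all(2) P12(2) fin finW by (simp add: card_Un_disjoint WW P1 P2 card_monset)
  ultimately have "2 * (d1 * d2) + 2 + 2 * card (triples (d2 + e)) + 2 * card (triples (d1 + e))
    \<le> 2 * card (triples m) + 2 * card (triples e)" using cX1 by linarith
  \<comment> \<open>With N(d) = (d + 1)(d + 2)/2, the mixed difference N(d1 + d2 + e) - N(d1 + e) -
    N(d2 + e) + N(e) equals d1 d2, one less than the number of forms W i.\<close>
  then show False unfolding card_triples m_eq by (simp add: algebra_simps)
qed

text \<open>A product of one line through each v j that misses p, padded by a power of a coordinate
  nonzero at p to reach degree m.\<close>

lemma ex_separating_form:
  fixes v :: "nat \<Rightarrow> 'b::field ^ 3"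
  assumes "finite T" "\<And>j. j \<in> T \<Longrightarrow> cross p (v j) \<noteq> 0" "p \<noteq> 0" "m \<ge> card T"
  obtains W where "homogeneous m W" "eval3 W p \<noteq> 0" "\<And>j. j \<in> T \<Longrightarrow> eval3 W (v j) = 0"
proof -
  have "\<exists>a. dot a (v j) = 0 \<and> dot a p \<noteq> 0" if j: "j \<in> T" for j
  proof -
    show ?thesis using ex_separating_covector[OF assms(2)[OF j]] by metis
  qed
  then obtain a where a: "\<And>j. j \<in> T \<Longrightarrow> dot (a j) (v j) = 0 \<and> dot (a j) p \<noteq> 0" by metis
  obtain i where i: "p $ i \<noteq> 0" using assms(3) by (auto simp: vec_eq_iff)
  define W where "W = (\<Prod>j\<in>T. lin (a j)) * vars $ i ^ (m - card T)"
  have "homogeneous (sum (\<lambda>_. 1) T + (m - card T) * 1) W"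
    unfolding W_def by (intro homogeneous_mult homogeneous_prod homogeneous_power homogeneous_lin homogeneous_vars)
  then have "homogeneous m W" using assms(4) by simp
  moreover have "eval3 W p \<noteq> 0" using a i assms(1) by (simp add: W_def eval3_prod eval3_power)
  moreover have "eval3 W (v j) = 0" if "j \<in> T" for j
  proof -
    have "(\<Prod>j'\<in>T. dot (a j') (v j)) = 0" using a[OF that] assms(1) that by (intro prod_zero) auto
    then show ?thesis by (simp add: W_def eval3_prod)
  qed
  ultimately show ?thesis using that by blast
qed

text \<open>Given one point too many, take for each point a form vanishing at all the others. A
  combination lying in the ideal vanishes at every point, which kills its coefficients one by
  one.\<close>

lemma bezout_bound:
  fixes G1 G2 :: "'b::ac_field poly3"
  assumes G1: "homogeneous d1 G1" "G1 \<noteq> 0" and G2: "homogeneous d2 G2" "G2 \<noteq> 0"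
    and cop: "coprime G1 G2"
    and v: "\<And>i. i \<le> d1 * d2 \<Longrightarrow> v i \<noteq> 0 \<and> eval3 G1 (v i) = 0 \<and> eval3 G2 (v i) = 0"
    and sep: "\<And>i j. i \<le> d1 * d2 \<Longrightarrow> j \<le> d1 * d2 \<Longrightarrow> i \<noteq> j \<Longrightarrow> cross (v i) (v j) \<noteq> 0"
  shows False
proof -
  \<comment> \<open>Large enough for the dimension count and for a product of d1 * d2 lines.\<close>
  define m where "m = d1 + d2 + d1 * d2"
  have "\<exists>W. homogeneous m W \<and> eval3 W (v i) \<noteq> 0 \<and> (\<forall>j\<in>{..d1 * d2} - {i}. eval3 W (v j) = 0)"
    if "i \<le> d1 * d2" for i
  proof -
    have 1: "cross (v i) (v j) \<noteq> 0" if "j \<in> {..d1 * d2} - {i}" for j using sep[of i j] that \<open>i \<le> d1 * d2\<close> by auto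
    have 2: "card ({..d1 * d2} - {i}) \<le> m" using that by (simp add: m_def)
    have 3: "v i \<noteq> 0" using v[OF that] by blast
    obtain W where "homogeneous m W" "eval3 W (v i) \<noteq> 0" "\<And>j. j \<in> {..d1 * d2} - {i} \<Longrightarrow> eval3 W (v j) = 0"
      using ex_separating_form[of _ "v i" v m, OF _ 1 3 2] by blast
    then show ?thesis by blast
  qed
  then obtain W where W: "\<And>i. i \<le> d1 * d2 \<Longrightarrow> homogeneous m (W i) \<and> eval3 (W i) (v i) \<noteq> 0
      \<and> (\<forall>j\<in>{..d1 * d2} - {i}. eval3 (W i) (v j) = 0)"
    by metis
  obtain c A B where c: "\<exists>i\<le>d1 * d2. c i \<noteq> 0"
    and eq: "(\<Sum>i\<le>d1 * d2. const3 (c i) * W i) = A * G1 + B * G2"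
    using ex_combination_in_ideal[OF G1 G2 cop, of m W] W unfolding m_def by auto
  have "c i = 0" if i: "i \<le> d1 * d2" for i
  proof -
    have "0 = eval3 (A * G1 + B * G2) (v i)" using v[OF i] by simp
    also have "\<dots> = (\<Sum>j\<le>d1 * d2. c j * eval3 (W j) (v i))"
      unfolding eq[symmetric] by (simp add: eval3_sum)
    also have "\<dots> = (\<Sum>j\<le>d1 * d2. if j = i then c i * eval3 (W i) (v i) else 0)"
      by (rule sum.cong) (use W i in auto)
    also have "\<dots> = c i * eval3 (W i) (v i)" using i by simp
    finally show ?thesis using W[OF i] by simp
  qed
  with c show False by blast
qed

text \<open>A common tangent direction w at one of the d1 * d2 points imposes one more linear
  condition on the ideal: its members have zero derivative along w there. The separating forms
  together with one form \<open>U\<close> that tests this condition are d1 * d2 + 1 forms,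
  independent modulo the ideal.\<close>

lemma bezout_transversal:
  fixes G1 G2 :: "'b::ac_field poly3"
  assumes G1: "homogeneous d1 G1" "G1 \<noteq> 0" and G2: "homogeneous d2 G2" "G2 \<noteq> 0"
    and cop: "coprime G1 G2"
    and v: "\<And>i. i < d1 * d2 \<Longrightarrow> v i \<noteq> 0 \<and> eval3 G1 (v i) = 0 \<and> eval3 G2 (v i) = 0"
    and sep: "\<And>i j. i < d1 * d2 \<Longrightarrow> j < d1 * d2 \<Longrightarrow> i \<noteq> j \<Longrightarrow> cross (v i) (v j) \<noteq> 0"
    and i0: "i0 < d1 * d2"
    and w: "dot w (evalv (grad G1) (v i0)) = 0" "dot w (evalv (grad G2) (v i0)) = 0"
  shows "cross (v i0) w = 0"
proof (rule ccontr)
  assume nz: "cross (v i0) w \<noteq> 0"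
  let ?D = "d1 * d2"
  define m where "m = d1 + d2 + d1 * d2"
  have "\<exists>W. homogeneous m W \<and> eval3 W (v i) \<noteq> 0 \<and> (\<forall>j\<in>{..<?D} - {i}. eval3 W (v j) = 0)"
    if "i < ?D" for i
  proof -
    have 1: "cross (v i) (v j) \<noteq> 0" if "j \<in> {..<?D} - {i}" for j using sep[of i j] that \<open>i < ?D\<close> by auto
    have 2: "card ({..<?D} - {i}) \<le> m" using that by (simp add: m_def)
    have 3: "v i \<noteq> 0" using v[OF that] by blast
    obtain W where "homogeneous m W" "eval3 W (v i) \<noteq> 0" "\<And>j. j \<in> {..<?D} - {i} \<Longrightarrow> eval3 W (v j) = 0"
      using ex_separating_form[of _ "v i" v m, OF _ 1 3 2] by blast
    then show ?thesis by blast
  qed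
  then obtain W where W: "\<And>i. i < ?D \<Longrightarrow> homogeneous m (W i) \<and> eval3 (W i) (v i) \<noteq> 0
      \<and> (\<forall>j\<in>{..<?D} - {i}. eval3 (W i) (v j) = 0)"
    by metis
  have "card ({..<?D} - {i0}) \<le> m - 1" using i0 by (simp add: m_def)
  then obtain V where V: "homogeneous (m - 1) V" "eval3 V (v i0) \<noteq> 0"
    "\<And>j. j < ?D \<Longrightarrow> j \<noteq> i0 \<Longrightarrow> eval3 V (v j) = 0"
  proof -
    assume cm: "card ({..<?D} - {i0}) \<le> m - 1"
      and th: "\<And>V. homogeneous (m - 1) V \<Longrightarrow> eval3 V (v i0) \<noteq> 0 \<Longrightarrow>
        (\<And>j. j < ?D \<Longrightarrow> j \<noteq> i0 \<Longrightarrow> eval3 V (v j) = 0) \<Longrightarrow> thesis"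
    have 1: "cross (v i0) (v j) \<noteq> 0" if "j \<in> {..<?D} - {i0}" for j using sep[of i0 j] that i0 by auto
    have 3: "v i0 \<noteq> 0" using v[OF i0] by blast
    show thesis
      by (rule ex_separating_form[OF _ 1 3 cm]) (use th in auto)
  qed
  have "cross w (v i0) \<noteq> 0" using nz cross_skew[of w "v i0"] by simp
  then obtain a where a: "dot a (v i0) = 0" "dot a w \<noteq> 0" by (rule ex_separating_covector)
  \<comment> \<open>\<open>V\<close> takes care of the other points. The line \<open>lin a\<close>
    passes through v i0 but is transversal to w, so U vanishes at all the points and has nonzero
    derivative along w at v i0.\<close>
  define U where "U = lin a * V"
  have hU: "homogeneous m U"
    using homogeneous_mult[OF homogeneous_lin V(1), of a] i0 by (cases m) (auto simp: U_def m_def)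
  have Uv: "eval3 U (v j) = 0" if "j < ?D" for j
    using V(3)[OF that] a by (cases "j = i0") (auto simp: U_def)
  define W' where "W' i = (if i < ?D then W i else U)" for i
  obtain c A B where c: "\<exists>i\<le>?D. c i \<noteq> 0"
    and eq: "(\<Sum>i\<le>?D. const3 (c i) * W' i) = A * G1 + B * G2"
  proof -
    assume th: "\<And>c A B. \<exists>i\<le>?D. c i \<noteq> 0 \<Longrightarrow> (\<Sum>i\<le>?D. const3 (c i) * W' i) = A * G1 + B * G2 \<Longrightarrow> thesis"
    have "homogeneous m (W' i)" for i using W hU by (simp add: W'_def)
    moreover have "m \<ge> d1 + d2" by (simp add: m_def)
    ultimately show thesis using ex_combination_in_ideal[OF G1 G2 cop, of m W'] th by blast
  qed
  have eq': "(\<Sum>i<?D. const3 (c i) * W i) + const3 (c ?D) * U = A * G1 + B * G2"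
    using eq by (simp add: lessThan_Suc_atMost[symmetric] W'_def)
  have c0: "c i = 0" if i: "i < ?D" for i
  proof -
    have "0 = eval3 (A * G1 + B * G2) (v i)" using v[OF i] by simp
    also have "\<dots> = (\<Sum>j<?D. c j * eval3 (W j) (v i))"
      unfolding eq'[symmetric] using Uv[OF i] by (simp add: eval3_sum)
    also have "\<dots> = (\<Sum>j<?D. if j = i then c i * eval3 (W i) (v i) else 0)"
      by (rule sum.cong) (use W i in auto)
    also have "\<dots> = c i * eval3 (W i) (v i)" using i by simp
    finally show ?thesis using W[OF i] by simp
  qed
  then have "const3 (c ?D) * U = A * G1 + B * G2" using eq' by simp
  then have "dot w (evalv (grad (const3 (c ?D) * U)) (v i0)) = dot w (evalv (grad (A * G1 + B * G2)) (v i0))" by simp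
  \<comment> \<open>The derivatives of A and B carry the factors G1 and G2, which vanish at v
    i0.\<close>
  also have "\<dots> = eval3 A (v i0) * dot w (evalv (grad G1) (v i0)) + eval3 B (v i0) * dot w (evalv (grad G2) (v i0))"
    using v[OF i0] by (simp add: grad_add grad_mult dot_3 algebra_simps)
  also have "\<dots> = 0" using w by simp
  finally have "c ?D * dot w (evalv (grad U) (v i0)) = 0"
    by (simp add: grad_mult dot_3 algebra_simps)
  moreover have "evalv (grad U) (v i0) = eval3 V (v i0) *s a"
  proof -
    have "evalv (grad (lin a)) (v i0) = a"
      by (simp add: lin_def dot_3 vars_3 grad_add grad_mult vec3_eq_iff grad_mon eval3_mon)
    then have *: "eval3 (grad (lin a) $ i) (v i0) = a $ i" for i by (metis evalv_nth)
    show ?thesis by (simp add: U_def grad_mult vec_eq_iff a * mult.commute)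
  qed
  ultimately have "c ?D = 0" using V(2) a by (simp add: dot_scale_right dot_commute)
  with c c0 show False by (metis le_neq_implies_less)
qed

subsection \<open>Elimination\<close>

text \<open>The homogenization of p to degree m, with two linear forms as its variables.\<close>

definition binary_form :: "'b::comm_ring_1 ^ 3 \<Rightarrow> 'b ^ 3 \<Rightarrow> nat \<Rightarrow> 'b poly \<Rightarrow> 'b poly3" where
  "binary_form a b m p = (\<Sum>i\<le>m. const3 (Polynomial.coeff p i) * (lin a ^ i * lin b ^ (m - i)))"

lemma binary_form_Suc:
  assumes "degree p \<le> m"
  shows "binary_form a b (Suc m) p = binary_form a b m p * lin b"
proof -
  have "binary_form a b (Suc m) p = (\<Sum>i\<le>m. const3 (Polynomial.coeff p i) * (lin a ^ i * lin b ^ (Suc m - i)))"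
    using assms by (simp add: binary_form_def coeff_eq_0)
  also have "\<dots> = binary_form a b m p * lin b"
    unfolding binary_form_def sum_distrib_right by (rule sum.cong) (simp_all add: Suc_diff_le mult_ac)
  finally show ?thesis .
qed

lemma binary_form_factor_root:
  assumes "degree p \<le> m"
  shows "binary_form a b (Suc m) ([:- x, 1:] * p) = lin (a - x *s b) * binary_form a b m p"
proof -
  have "[:- x, 1:] * p = pCons 0 p - smult x p" by simp
  then have "binary_form a b (Suc m) ([:- x, 1:] * p)
    = binary_form a b (Suc m) (pCons 0 p) - const3 x * binary_form a b (Suc m) p"
    by (simp only: binary_form_def coeff_diff coeff_smult const3_simps left_diff_distrib sum_subtractf
        sum_distrib_left mult.assoc)
  also have "binary_form a b (Suc m) (pCons 0 p) = lin a * binary_form a b m p"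
    unfolding binary_form_def sum.atMost_Suc_shift sum_distrib_left by (simp add: mult_ac)
  also have "binary_form a b (Suc m) p = binary_form a b m p * lin b" by (rule binary_form_Suc[OF assms])
  also have "lin a * binary_form a b m p - const3 x * (binary_form a b m p * lin b)
    = lin (a - x *s b) * binary_form a b m p"
    using lin_add[of "a - x *s b" "x *s b"] by (simp add: lin_scale algebra_simps)
  finally show ?thesis .
qed

text \<open>Over an algebraically closed field binary forms split. A root x of p contributes
  \<open>lin (a - x *s b)\<close>; each unit by which m exceeds the degree of p is a root at
  infinity and contributes \<open>lin b\<close>.\<close>

lemma binary_form_factorization:
  fixes p :: "'b::ac_field poly"
  assumes "p \<noteq> 0" "degree p \<le> m" "cross a b \<noteq> 0"
  shows "\<exists>qs c. c \<noteq> 0 \<and> binary_form a b m p = const3 c * (\<Prod>q\<leftarrow>qs. lin q) \<and>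
    (\<forall>q\<in>set qs. q \<noteq> 0 \<and> (\<exists>x y. q = x *s a + y *s b))"
  using assms(1,2)
proof (induction m arbitrary: p)
  case 0
  then show ?case
    by (intro exI[of _ "[]"] exI[of _ "Polynomial.coeff p 0"])
       (auto simp: binary_form_def elim: degree_eq_zeroE)
next
  case (Suc m)
  show ?case
  proof (cases "degree p \<le> m")
    case True
    from Suc.IH[OF Suc.prems(1) True] obtain qs c where *: "c \<noteq> 0"
      "binary_form a b m p = const3 c * (\<Prod>q\<leftarrow>qs. lin q)"
      "\<forall>q\<in>set qs. q \<noteq> 0 \<and> (\<exists>x y. q = x *s a + y *s b)" by blast
    have "b \<noteq> 0" using assms(3) by auto
    moreover have "\<exists>x y. b = x *s a + y *s b" by (rule exI[of _ 0], rule exI[of _ 1]) simp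
    ultimately show ?thesis using *
      by (intro exI[of _ "b # qs"] exI[of _ c]) (auto simp: binary_form_Suc[OF True] mult_ac)
  next
    case False
    then obtain x where "poly p x = 0" using alg_closed_imp_poly_has_root[of p] by auto
    then obtain p' where p': "p = [:- x, 1:] * p'" by (auto simp: poly_eq_0_iff_dvd dvd_def)
    with Suc.prems have "p' \<noteq> 0" by auto
    then have "degree p = Suc (degree p')" unfolding p' by (subst degree_mult_eq) auto
    then have deg: "degree p' \<le> m" using Suc.prems by simp
    from Suc.IH[OF \<open>p' \<noteq> 0\<close> deg] obtain qs c where *: "c \<noteq> 0"
      "binary_form a b m p' = const3 c * (\<Prod>q\<leftarrow>qs. lin q)"
      "\<forall>q\<in>set qs. q \<noteq> 0 \<and> (\<exists>x y. q = x *s a + y *s b)" by blast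
    have nz: "a - x *s b \<noteq> 0"
    proof
      assume "a - x *s b = 0"
      then have "a = x *s b" by simp
      then have "cross a b = 0" by (simp add: cross_scale_left)
      with assms(3) show False by blast
    qed
    have "\<exists>y z. a - x *s b = y *s a + z *s b"
      by (rule exI[of _ 1], rule exI[of _ "- x"]) (simp add: vec_eq_iff)
    moreover have "binary_form a b (Suc m) p = const3 c * (\<Prod>q\<leftarrow>(a - x *s b) # qs. lin q)"
      by (simp only: p' binary_form_factor_root[OF deg] *(2) list.map prod_list.Cons mult.left_commute)
    ultimately show ?thesis using nz *(1,3)
      by (intro exI[of _ "(a - x *s b) # qs"] exI[of _ c]) auto
  qed
qed

text \<open>Applies the dimension count to monomials in \<open>lin a\<close> and
  \<open>lin b\<close>. The binary form found in the ideal plays the part of a resultant and splits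
  into lines through the point \<open>cross a b\<close>.\<close>

lemma elimination:
  fixes G1 G2 :: "'b::ac_field poly3"
  assumes G1: "homogeneous d1 G1" "G1 \<noteq> 0" and G2: "homogeneous d2 G2" "G2 \<noteq> 0"
    and cop: "coprime G1 G2" and ab: "cross a b \<noteq> 0"
  obtains qs A B where "(\<Prod>q\<leftarrow>qs. lin q) = A * G1 + B * G2"
    "\<And>q. q \<in> set qs \<Longrightarrow> q \<noteq> 0 \<and> (\<exists>x y. q = x *s a + y *s b)"
proof -
  let ?D = "d1 * d2"
  define m where "m = d1 + d2 + ?D"
  have "homogeneous m (lin a ^ i * lin b ^ (m - i))" if "i \<le> ?D" for i
  proof -
    have "homogeneous (i * 1 + (m - i) * 1) (lin a ^ i * lin b ^ (m - i))"
      by (intro homogeneous_mult homogeneous_power homogeneous_lin)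
    then show ?thesis using that by (simp add: m_def)
  qed
  moreover have "m \<ge> d1 + d2" by (simp add: m_def)
  ultimately obtain c A B where c: "\<exists>i\<le>?D. c i \<noteq> 0"
    and eq: "(\<Sum>i\<le>?D. const3 (c i) * (lin a ^ i * lin b ^ (m - i))) = A * G1 + B * G2"
    using ex_combination_in_ideal[OF G1 G2 cop, of m "\<lambda>i. lin a ^ i * lin b ^ (m - i)"] by blast
  define p where "p = (\<Sum>i\<le>?D. monom (c i) i)"
  have cp: "Polynomial.coeff p i = (if i \<le> ?D then c i else 0)" for i
    by (simp add: p_def coeff_sum)
  have p: "p \<noteq> 0" using c cp by (metis coeff_0)
  have "degree p \<le> m"
    by (rule degree_le) (auto simp: cp m_def)
  have "binary_form a b m p = (\<Sum>i\<le>?D. const3 (c i) * (lin a ^ i * lin b ^ (m - i)))"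
    unfolding binary_form_def by (rule sum.mono_neutral_cong_right) (auto simp: cp m_def)
  with binary_form_factorization[OF p \<open>degree p \<le> m\<close> ab] eq obtain qs e where
    qs: "e \<noteq> 0" "const3 e * (\<Prod>q\<leftarrow>qs. lin q) = A * G1 + B * G2"
      "\<forall>q\<in>set qs. q \<noteq> 0 \<and> (\<exists>x y. q = x *s a + y *s b)" by auto
  have "(\<Prod>q\<leftarrow>qs. lin q) = const3 (1 / e) * (const3 e * (\<Prod>q\<leftarrow>qs. lin q))"
    by (simp only: mult.assoc[symmetric] const3_inverse[OF qs(1)] mult_1)
  also have "\<dots> = (const3 (1 / e) * A) * G1 + (const3 (1 / e) * B) * G2"
    unfolding qs(2) by (simp add: algebra_simps)
  finally show ?thesis using that qs(3) by blast
qed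

subsection \<open>Zeros of a form\<close>

lemma ex_poly_nonzero:
  fixes p :: "'r::idom poly" and h :: "'b::field_char_0 \<Rightarrow> 'r"
  assumes "p \<noteq> 0" "inj h"
  shows "\<exists>c. poly p (h c) \<noteq> 0"
proof (rule ccontr)
  assume "\<not> ?thesis"
  then have "range h \<subseteq> {x. poly p x = 0}" by auto
  moreover have "infinite (range h)" using assms(2) infinite_UNIV_char_0 finite_imageD by blast
  ultimately show False using poly_roots_finite[OF assms(1)] finite_subset by blast
qed

lemma ex_eval3_nonzero:
  fixes P :: "'b::field_char_0 poly3"
  assumes "P \<noteq> 0"
  obtains v where "eval3 P v \<noteq> 0"
proof -
  obtain z where "poly P [:[:z:]:] \<noteq> 0"
    using ex_poly_nonzero[OF assms, of "\<lambda>z::'b. [:[:z:]:]"] by (auto simp: inj_def)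
  then obtain y where "poly (poly P [:[:z:]:]) [:y:] \<noteq> 0"
    using ex_poly_nonzero[of "poly P [:[:z:]:]" "\<lambda>y::'b. [:y:]"] by (auto simp: inj_def)
  then obtain x where "poly (poly (poly P [:[:z:]:]) [:y:]) x \<noteq> 0"
    using ex_poly_nonzero[of _ "\<lambda>x::'b. x"] by (auto simp: inj_def)
  then have "eval3 P (vector [x, y, z]) \<noteq> 0" by (simp add: eval3_def vector_3)
  with that show ?thesis .
qed

lemma eval3_homogeneous_0:
  assumes "homogeneous d P" "d \<ge> 1"
  shows "eval3 P 0 = 0"
  using eval3_homogeneous_scale[OF assms(1), of 0 0] assms(2) by (simp add: power_0_left)

lemma coeff_mult_top:
  assumes "degree p \<le> m" "degree q \<le> n"
  shows "Polynomial.coeff (p * q) (m + n) = Polynomial.coeff p m * Polynomial.coeff q n"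
proof -
  have "Polynomial.coeff (p * q) (m + n)
    = (\<Sum>i\<le>m + n. if i = m then Polynomial.coeff p m * Polynomial.coeff q n else 0)"
    unfolding coeff_mult
  proof (rule sum.cong)
    fix i assume "i \<in> {..m + n}"
    consider "i < m" | "i = m" | "i > m" by linarith
    then show "Polynomial.coeff p i * Polynomial.coeff q (m + n - i) =
      (if i = m then Polynomial.coeff p m * Polynomial.coeff q n else 0)"
      by cases (use assms in \<open>auto simp: coeff_eq_0\<close>)
  qed simp
  then show ?thesis by simp
qed

text \<open>The coefficient in degree d is recorded because, for p off the curve, it shows that the
  restriction keeps the full degree d and so acquires a root over an algebraically closed
  field.\<close>

lemma restrict_to_line:
  fixes P :: "'b::field poly3"
  assumes "homogeneous d P"
  shows "\<exists>q. degree q \<le> d \<and> Polynomial.coeff q d = eval3 P p \<and> (\<forall>s. poly q s = eval3 P (s *s p + w))"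
  using assms
proof (induction rule: homogeneous_induct)
  case (mon c i j k)
  have pw: "degree ([:w $ l, p $ l:] ^ n) \<le> n \<and> Polynomial.coeff ([:w $ l, p $ l:] ^ n) n = (p $ l) ^ n" for l n
  proof (induction n)
    case (Suc n)
    have 1: "degree [:w $ l, p $ l:] \<le> 1" by simp
    from coeff_mult_top[OF this, of "[:w $ l, p $ l:] ^ n" n] Suc degree_mult_le[of "[:w $ l, p $ l:]" "[:w $ l, p $ l:] ^ n"] 1
    show ?case by (simp add: del: mult_pCons_left)
  qed simp
  define f where "f = [:w $ 1, p $ 1:] ^ i"
  define g where "g = [:w $ 2, p $ 2:] ^ j"
  define h where "h = [:w $ 3, p $ 3:] ^ k"
  have F: "degree f \<le> i" "Polynomial.coeff f i = (p $ 1) ^ i" and G: "degree g \<le> j" "Polynomial.coeff g j = (p $ 2) ^ j"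
    and H: "degree h \<le> k" "Polynomial.coeff h k = (p $ 3) ^ k"
    using pw by (auto simp: f_def g_def h_def)
  have fg: "degree (f * g) \<le> i + j" using F G degree_mult_le[of f g] by linarith
  then have fgh: "degree (f * g * h) \<le> d" using H degree_mult_le[of "f * g" h] mon by linarith
  have "Polynomial.coeff (f * g * h) d = (p $ 1) ^ i * (p $ 2) ^ j * (p $ 3) ^ k"
    using coeff_mult_top[OF fg H(1)] coeff_mult_top[OF F(1) G(1)] mon F G H by simp
  then show ?case using fgh
    by (intro exI[of _ "smult c (f * g * h)"])
       (auto simp: eval3_mon f_def g_def h_def algebra_simps intro: order_trans[OF degree_smult_le])
next
  case (add A B)
  then obtain q r where "degree q \<le> d \<and> Polynomial.coeff q d = eval3 A p \<and> (\<forall>s. poly q s = eval3 A (s *s p + w))"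
    "degree r \<le> d \<and> Polynomial.coeff r d = eval3 B p \<and> (\<forall>s. poly r s = eval3 B (s *s p + w))" by blast
  then show ?case by (intro exI[of _ "q + r"]) (auto intro: degree_add_le)
qed

text \<open>Adding multiples of p does not change a determinant that contains p; this separates
  points on different lines through p.\<close>

lemma det_shear:
  "dot p (cross (a *s p + (e + x *s e')) (b *s p + (e + y *s e'))) = (y - x) * dot p (cross e e')"
  by (simp add: vec3_simps algebra_simps)

text \<open>Projects from a point p off the curve. Each of the infinitely many lines through p and e
  + i e' carries a zero, and the determinant with p shows that zeros on different lines are not
  proportional.\<close>

lemma form_zeros:
  fixes P :: "'b::ac_field poly3"
  assumes P: "homogeneous d P" "d \<ge> 1" "P \<noteq> 0"
  obtains v :: "nat \<Rightarrow> 'b ^ 3" where "\<And>i. v i \<noteq> 0" "\<And>i. eval3 P (v i) = 0"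
    "\<And>i j. i \<noteq> j \<Longrightarrow> cross (v i) (v j) \<noteq> 0"
proof -
  obtain p where p: "eval3 P p \<noteq> 0" using ex_eval3_nonzero[OF P(3)] .
  then have "p \<noteq> 0" using eval3_homogeneous_0[OF P(1,2)] by auto
  then consider "p $ 1 \<noteq> 0" | "p $ 2 \<noteq> 0" | "p $ 3 \<noteq> 0" by (auto simp: vec3_eq_iff)
  then obtain e e' where e: "dot p (cross e e') \<noteq> 0"
  proof cases
    case 1 with that[of "vector [0, 1, 0]" "vector [0, 0, 1]"] show ?thesis by (simp add: vec3_simps vector_3)
  next
    case 2 with that[of "vector [0, 0, 1]" "vector [1, 0, 0]"] show ?thesis by (simp add: vec3_simps vector_3)
  next
    case 3 with that[of "vector [1, 0, 0]" "vector [0, 1, 0]"] show ?thesis by (simp add: vec3_simps vector_3)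
  qed
  have "\<exists>s. eval3 P (s *s p + w) = 0" for w
  proof -
    obtain q where q: "degree q \<le> d" "Polynomial.coeff q d = eval3 P p" "\<forall>s. poly q s = eval3 P (s *s p + w)"
      using restrict_to_line[OF P(1), of p w] by blast
    then have "degree q > 0" using p P(2) le_degree[of q d] by auto
    then show ?thesis using alg_closed_imp_poly_has_root[of q] q(3) by auto
  qed
  then obtain s where s: "\<And>w. eval3 P (s w *s p + w) = 0" by metis
  define w where "w i = e + of_nat i *s e'" for i :: nat
  define v where "v i = s (w i) *s p + w i" for i
  have cr: "cross (v i) (v j) \<noteq> 0" if "i \<noteq> j" for i j
  proof
    assume "cross (v i) (v j) = 0"
    then have "dot p (cross (v i) (v j)) = 0" by simp
    moreover have "dot p (cross (v i) (v j)) = (of_nat j - of_nat i) * dot p (cross e e')"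
      unfolding v_def w_def by (rule det_shear)
    ultimately show False using e that by simp
  qed
  moreover have "v i \<noteq> 0" for i using cr[of i "Suc i"] by auto
  ultimately show ?thesis using that[of v] s by (auto simp: v_def)
qed

text \<open>The Nullstellensatz for an irreducible form: if P did not divide H, the two would be
  coprime with infinitely many common zeros, against \<open>bezout_bound\<close>.\<close>

lemma irreducible_dvd_if_zeros:
  fixes P H :: "'b::ac_field poly3"
  assumes P: "homogeneous d P" "irreducible P" and H: "homogeneous e H"
    and zeros: "\<And>v. v \<noteq> 0 \<Longrightarrow> eval3 P v = 0 \<Longrightarrow> eval3 H v = 0"
  shows "P dvd H"
proof (rule ccontr)
  assume nd: "\<not> P dvd H"
  then have "H \<noteq> 0" by auto
  have P0: "P \<noteq> 0" "\<not> P dvd 1" using P(2) by (auto simp: irreducible_def)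
  then have "d \<ge> 1" using homogeneous_unit_iff[OF P(1)] by (cases d) auto
  obtain v :: "nat \<Rightarrow> 'b ^ 3" where v: "\<And>i. v i \<noteq> 0" "\<And>i. eval3 P (v i) = 0"
    "\<And>i j. i \<noteq> j \<Longrightarrow> cross (v i) (v j) \<noteq> 0"
    using form_zeros[OF P(1) \<open>d \<ge> 1\<close> P0(1)] by metis
  have "coprime P H" using P(2) nd by (simp add: prime_elem_imp_coprime irreducible_imp_prime_elem)
  with bezout_bound[OF P(1) P0(1) H \<open>H \<noteq> 0\<close>, of v] v zeros show False by blast
qed

lemma parallel_field:
  fixes a b :: "'b::field ^ 3"
  assumes "cross a b = 0" "a \<noteq> 0"
  obtains c where "b = c *s a"
proof -
  obtain j where j: "a $ j \<noteq> 0" using assms(2) by (auto simp: vec_eq_iff)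
  have "b $ i = (b $ j / a $ j) * a $ i" for i
  proof -
    have "b $ i = (a $ j * b $ i) / a $ j" using j by simp
    also have "a $ j * b $ i = a $ i * b $ j"
      by (rule cross_eq_0_components[OF assms(1), symmetric])
    finally show ?thesis by simp
  qed
  then have "b = (b $ j / a $ j) *s a"
    unfolding vec_eq_iff vector_smult_component by blast
  then show ?thesis by (rule that)
qed

text \<open>A largest set of pairwise nonproportional common zeros does it;
  \<open>bezout_bound\<close> limits the size of such sets.\<close>

lemma finite_common_zeros:
  fixes G1 G2 :: "'b::ac_field poly3"
  assumes G1: "homogeneous d1 G1" "G1 \<noteq> 0" and G2: "homogeneous d2 G2" "G2 \<noteq> 0"
    and cop: "coprime G1 G2"
  obtains Z where "finite Z" "0 \<notin> Z"
    "\<And>v. v \<noteq> 0 \<Longrightarrow> eval3 G1 v = 0 \<Longrightarrow> eval3 G2 v = 0 \<Longrightarrow> \<exists>z\<in>Z. cross z v = 0"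
proof -
  define good where "good S \<longleftrightarrow> finite S \<and> (\<forall>v\<in>S. v \<noteq> 0 \<and> eval3 G1 v = 0 \<and> eval3 G2 v = 0) \<and>
    (\<forall>v\<in>S. \<forall>w\<in>S. v \<noteq> w \<longrightarrow> cross v w \<noteq> 0)" for S :: "('b ^ 3) set"
  have bound: "card S \<le> d1 * d2" if S: "good S" for S
  proof (rule ccontr)
    assume large: "\<not> ?thesis"
    have "finite S" using S by (simp add: good_def)
    then obtain v where v: "bij_betw v {0..<card S} S"
      using ex_bij_betw_nat_finite by blast
    have i: "i < card S" if "i \<le> d1 * d2" for i using that large by linarith
    have vS: "v i \<in> S" if "i \<le> d1 * d2" for i
      using bij_betw_apply[OF v] i[OF that] by simp
    have ne: "v i \<noteq> v j" if "i < card S" "j < card S" "i \<noteq> j" for i j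
      using v that by (auto simp: bij_betw_def inj_on_def)
    have z: "v i \<noteq> 0 \<and> eval3 G1 (v i) = 0 \<and> eval3 G2 (v i) = 0" if "i \<le> d1 * d2" for i
      using S vS[OF that] unfolding good_def by blast
    have "cross (v i) (v j) \<noteq> 0" if "i \<le> d1 * d2" "j \<le> d1 * d2" "i \<noteq> j" for i j
      using S vS[OF that(1)] vS[OF that(2)] ne[OF i[OF that(1)] i[OF that(2)] that(3)]
      unfolding good_def by blast
    from bezout_bound[OF G1 G2 cop, of v, OF z this] show False by blast
  qed
  have "\<exists>Z. good Z \<and> (\<forall>S. good S \<longrightarrow> card S \<le> card Z)"
  proof -
    have "good {}" by (simp add: good_def)
    from ex_has_greatest_nat[of good, OF this, of card "d1 * d2 + 1"] bound show ?thesis by fastforce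
  qed
  then obtain Z where Z: "good Z" "\<And>S. good S \<Longrightarrow> card S \<le> card Z" by blast
  have "\<exists>z\<in>Z. cross z v = 0" if v: "v \<noteq> 0" "eval3 G1 v = 0" "eval3 G2 v = 0" for v
  proof (rule ccontr)
    assume no: "\<not> ?thesis"
    then have "v \<notin> Z" by auto
    have "good (insert v Z)"
      using no Z(1) v cross_skew[of v] unfolding good_def by auto
    from Z(2)[OF this] show False using Z(1) \<open>v \<notin> Z\<close> by (simp add: good_def)
  qed
  moreover have "finite Z" "0 \<notin> Z" using Z(1) by (auto simp: good_def)
  ultimately show ?thesis using that by blast
qed

text \<open>Points and lines exchange roles: a point v off all the lines \<open>lin z\<close> is
  read as a line. The normalized last coefficient makes \<open>lin a\<close> monic in z.\<close>

lemma ex_avoiding_form: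
  fixes Z :: "('b::field_char_0 ^ 3) set"
  assumes "finite Z" "0 \<notin> Z"
  obtains a where "a $ 3 = 1" "\<And>z. z \<in> Z \<Longrightarrow> dot a z \<noteq> 0"
proof -
  have "lin z \<noteq> 0" if "z \<in> Z" for z
  proof
    assume "lin z = 0"
    then have d: "dot z v = 0" for v by (metis eval3_lin eval3_simps(2))
    have "z = 0"
      using d[of "axis 1 1"] d[of "axis 2 1"] d[of "axis 3 1"]
      by (auto simp: vec3_simps axis_def)
    with that assms show False by blast
  qed
  then have "(\<Prod>z\<in>Z. lin z) * vars $ 3 \<noteq> 0" using assms(1) vars_nonzero by simp
  then obtain v where v: "eval3 ((\<Prod>z\<in>Z. lin z) * vars $ 3) v \<noteq> 0" using ex_eval3_nonzero by blast
  then have v3: "v $ 3 \<noteq> 0" and vz: "\<And>z. z \<in> Z \<Longrightarrow> dot z v \<noteq> 0"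
    using assms(1) by (auto simp: eval3_prod)
  show ?thesis
    by (rule that[of "(1 / v $ 3) *s v"]) (use v3 vz in \<open>auto simp: dot_scale_left dot_commute[of v]\<close>)
qed

section \<open>A local-to-global principle\<close>

text \<open>Reduction modulo \<open>lin a\<close> when the last coefficient of a is 1: z becomes -
  a1 x - a2 y, and the quotient is the factorial ring of polynomials in x and y.\<close>

definition at_line :: "'b::field ^ 3 \<Rightarrow> 'b poly3 \<Rightarrow> 'b poly poly" where
  "at_line a F = poly F [:[:0, - a $ 1:], [:- a $ 2:]:]"

lemma ring_hom_fun_at_line: "ring_hom_fun (at_line a)"
  by (simp add: ring_hom_fun_def at_line_def[abs_def])

lemmas at_line_simps [simp] = ring_hom_funD[OF ring_hom_fun_at_line]

lemma lin_monic:
  assumes "a $ 3 = 1"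
  shows "lin a = [:- [:[:0, - a $ 1:], [:- a $ 2:]:], 1:]"
  by (simp add: lin_def dot_3 vars_3 mon_def const3_def monom_Suc monom_0 assms one_pCons)

lemma at_line_eq_0_iff: "a $ 3 = 1 \<Longrightarrow> at_line a F = 0 \<longleftrightarrow> lin a dvd F"
  by (simp add: lin_monic at_line_def poly_eq_0_iff_dvd)

lemma at_line_const [simp]: "at_line a [:h:] = h"
  by (simp add: at_line_def)

lemma at_line_smult [simp]: "at_line a (smult h F) = h * at_line a F"
  by (simp add: at_line_def)

lemma at_line_mon: "[:at_line a (mon c i j k):] = mon c i j 0 * lin (vector [- a $ 1, - a $ 2, 0]) ^ k"
proof -
  have "lin (vector [- a $ 1, - a $ 2, 0]) = [:[:[:0, - a $ 1:], [:- a $ 2:]:]:]"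
    by (simp add: lin_def dot_3 vars_3 mon_def const3_def monom_Suc monom_0 one_pCons vector_3)
  moreover have "[:q:] ^ k = [:q ^ k:]" for q :: "'a poly poly" by (induction k) (simp_all add: one_pCons)
  ultimately show ?thesis by (simp add: at_line_def mon_def poly_monom monom_0)
qed

lemma homogeneous_at_line: "homogeneous d F \<Longrightarrow> homogeneous d [:at_line a F:]"
proof (induction rule: homogeneous_induct)
  case (mon c i j k)
  have "homogeneous (i + j + k * 1) (mon c i j 0 * lin (vector [- a $ 1, - a $ 2, 0]) ^ k)"
    by (intro homogeneous_mult homogeneous_power homogeneous_lin homogeneous_mon) simp
  then show ?case using mon by (simp add: at_line_mon)
next
  case (add A B)
  then show ?case using homogeneous_add[of d "[:at_line a A:]" "[:at_line a B:]"] by simp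
qed

lemma eval3_at_line:
  "eval3 [:at_line a F:] v = eval3 F (vector [v $ 1, v $ 2, - a $ 1 * v $ 1 - a $ 2 * v $ 2])"
proof (induction F rule: poly3_induct)
  case (mon c i j k)
  show ?case by (simp add: at_line_mon eval3_mon eval3_power dot_3 vector_3)
next
  case (add A B)
  have "[:at_line a (A + B):] = [:at_line a A:] + [:at_line a B:]" by simp
  then show ?case using add by (simp only: eval3_simps)
qed

text \<open>A common factor of the restrictions is again a form in x and y. If it were not constant,
  a zero of it would give a zero of u on the line.\<close>

lemma coprime3_at_line:
  fixes u :: "'b::ac_field poly3 ^ 3"
  assumes hom: "\<And>i. homogeneous d (u $ i)" and a3: "a $ 3 = 1"
    and nz: "\<And>v. v \<noteq> 0 \<Longrightarrow> dot a v = 0 \<Longrightarrow> evalv u v \<noteq> 0"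
  shows "coprime3 (\<chi> i. at_line a (u $ i))"
  unfolding coprime3_def
proof (intro allI impI)
  fix h assume "\<forall>i. h dvd (\<chi> i. at_line a (u $ i)) $ i"
  then have dvd: "h dvd at_line a (u $ i)" for i by simp
  have ex0: "\<exists>i. eval3 [:at_line a (u $ i):] v \<noteq> 0" if "v $ 1 \<noteq> 0 \<or> v $ 2 \<noteq> 0" for v
  proof -
    let ?v = "vector [v $ 1, v $ 2, - a $ 1 * v $ 1 - a $ 2 * v $ 2] :: 'b ^ 3"
    have "?v \<noteq> 0" using that by (auto simp: vec3_eq_iff vector_3)
    moreover have "dot a ?v = 0" by (simp add: dot_3 vector_3 a3)
    ultimately have "evalv u ?v \<noteq> 0" using nz by blast
    then show ?thesis by (auto simp: vec_eq_iff eval3_at_line)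
  qed
  obtain i where i: "at_line a (u $ i) \<noteq> 0"
    using ex0[of "vector [1, 0, 0]"] by (metis eval3_simps(2) pCons_0_0 vector_3(1) zero_neq_one)
  have D: "[:h:] dvd [:at_line a (u $ j):]" for j
    using dvd[of j] by (auto simp: dvd_def intro: exI[of _ "[:_:]"])
  obtain e where e: "homogeneous e [:h:]"
    using homogeneous_dvd[OF homogeneous_at_line[OF hom[of i], of a] _ D] i by auto
  have h0: "[:h:] \<noteq> 0" using dvd[of i] i by auto
  show "h dvd 1"
  proof (cases "e = 0")
    case True
    then obtain c where c: "[:h:] = const3 c" using e homogeneous_0_const by blast
    then have "c \<noteq> 0" using h0 by auto
    then show ?thesis using c by (auto simp: const3_def is_unit_poly_iff dvd_field_iff)
  next
    case False
    then have "e \<ge> 1" by simp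
    then obtain v :: "nat \<Rightarrow> 'b ^ 3" where v: "\<And>i. v i \<noteq> 0" "\<And>i. eval3 [:h:] (v i) = 0"
      "\<And>i j. i \<noteq> j \<Longrightarrow> cross (v i) (v j) \<noteq> 0"
      using form_zeros[OF e _ h0] by metis
    \<comment> \<open>\<open>[:h:]\<close> does not involve z, so a zero on the z-axis gives no
      point of the line. Two nonproportional zeros cannot both lie on that axis.\<close>
    have "\<exists>i. v i $ 1 \<noteq> 0 \<or> v i $ 2 \<noteq> 0"
    proof (rule ccontr)
      assume "\<not> ?thesis"
      then have "cross (v 0) (v 1) = 0" by (simp add: vec3_simps)
      with v(3)[of 0 1] show False by simp
    qed
    then obtain k where "v k $ 1 \<noteq> 0 \<or> v k $ 2 \<noteq> 0" by blast
    then obtain i where "eval3 [:at_line a (u $ i):] (v k) \<noteq> 0" using ex0 by blast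
    with eval3_dvd[OF D v(2)] show ?thesis by blast
  qed
qed

text \<open>Modulo \<open>lin a\<close> the vectors u and v become proportional while u stays
  coprime, so v is congruent to a multiple h u. Subtracting h u does not change the cross product
  and makes v divisible by \<open>lin a\<close>.\<close>

lemma cross_divide_linear:
  fixes u :: "'b::ac_field poly3 ^ 3"
  assumes hom: "\<And>i. homogeneous d (u $ i)" and a3: "a $ 3 = 1"
    and nz: "\<And>v. v \<noteq> 0 \<Longrightarrow> dot a v = 0 \<Longrightarrow> evalv u v \<noteq> 0"
    and eq: "lin a *s G = cross u v"
  obtains v' where "G = cross u v'"
proof -
  define U where "U = (\<chi> i. at_line a (u $ i))"
  define V where "V = (\<chi> i. at_line a (v $ i))"
  have "at_line a (lin a) = 0" using at_line_eq_0_iff[OF a3] by simp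
  then have z: "at_line a ((lin a *s G) $ i) = 0" for i by simp
  have "cross V U = 0"
    using z[of 1] z[of 2] z[of 3] unfolding eq by (simp add: V_def U_def vec3_simps algebra_simps)
  moreover have "coprime3 U" unfolding U_def by (rule coprime3_at_line[OF hom a3 nz])
  ultimately obtain h where h: "V = h *s U" by (rule parallel_coprime3)
  have "lin a dvd (v - [:h:] *s u) $ i" for i
  proof -
    have "V $ i = h * U $ i" using h by simp
    then have "at_line a ((v - [:h:] *s u) $ i) = 0" by (simp add: V_def U_def)
    then show ?thesis using at_line_eq_0_iff[OF a3] by blast
  qed
  then obtain w where "\<And>i. (v - [:h:] *s u) $ i = lin a * w i" unfolding dvd_def by metis
  then have v: "v = [:h:] *s u + lin a *s (\<chi> i. w i)" by (simp add: vec_eq_iff algebra_simps)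
  have "lin a *s G = lin a *s cross u (\<chi> i. w i)"
    unfolding eq v by (simp add: cross_add_right cross_scale_right)
  moreover have "lin a \<noteq> 0" using lin_monic[OF a3] by simp
  ultimately have "G = cross u (\<chi> i. w i)" by (simp add: vec_eq_iff)
  with that show ?thesis .
qed

text \<open>Cramer's rule: x is expanded in the dual basis of the covectors t, a, b.\<close>

lemma dot_cross_mult:
  "dot t (cross a b) * x $ i = cross a b $ i * dot t x + cross b t $ i * dot a x + cross t a $ i * dot b x"
proof -
  consider "i = 1" | "i = 2" | "i = 3" using exhaust_3[of i] by blast
  then show ?thesis by cases (simp_all add: dot_3 cross_3 algebra_simps)
qed

text \<open>Modulo the ideal of the point \<open>cross a b\<close> every variable is proportional to
  \<open>lin t\<close>, with ratio given by the coordinates of the point. The power on the left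
  clears the denominators \<open>dot t (cross a b)\<close>.\<close>

lemma form_mod_point:
  fixes q :: "'b::field poly3"
  assumes "homogeneous e q"
  shows "\<exists>A B. const3 (dot t (cross a b) ^ e) * q
    = const3 (eval3 q (cross a b)) * lin t ^ e + A * lin a + B * lin b"
proof -
  define p where "p = cross a b"
  define cong where "cong P Q \<longleftrightarrow> (\<exists>A B. P = Q + A * lin a + B * lin b)" for P Q :: "'b poly3"
  have cong_refl: "cong P P" for P unfolding cong_def by (intro exI[of _ 0]) simp
  have cong_mult: "cong (P * P') (Q * Q')" if "cong P Q" "cong P' Q'" for P Q P' Q'
  proof -
    from that obtain A B A' B' where "P = Q + A * lin a + B * lin b" "P' = Q' + A' * lin a + B' * lin b"
      unfolding cong_def by blast
    then have "P * P' = Q * Q' + (A * P' + Q * A') * lin a + (B * P' + Q * B') * lin b"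
      by (simp add: algebra_simps)
    then show ?thesis unfolding cong_def by blast
  qed
  have cong_add: "cong (P + P') (Q + Q')" if "cong P Q" "cong P' Q'" for P Q P' Q'
  proof -
    from that obtain A B A' B' where "P = Q + A * lin a + B * lin b" "P' = Q' + A' * lin a + B' * lin b"
      unfolding cong_def by blast
    then have "P + P' = Q + Q' + (A + A') * lin a + (B + B') * lin b"
      by (simp add: algebra_simps)
    then show ?thesis unfolding cong_def by blast
  qed
  have cong_power: "cong (P ^ m) (Q ^ m)" if "cong P Q" for P Q m
    by (induction m) (auto intro: cong_refl cong_mult that)
  have vars: "cong (const3 (dot t p) * vars $ i) (const3 (p $ i) * lin t)" for i
  proof -
    have "const3 (dot t p) * vars $ i = const3 (p $ i) * lin t
      + const3 (cross b t $ i) * lin a + const3 (cross t a $ i) * lin b"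
    proof -
      have dot: "const3 (dot v w) = dot (\<chi> i. const3 (v $ i)) (\<chi> i. const3 (w $ i))" for v w :: "'b ^ 3"
        by (simp add: dot_3)
      have cross: "(\<chi> i. const3 (cross v w $ i)) = cross (\<chi> i. const3 (v $ i)) (\<chi> i. const3 (w $ i))"
        for v w :: "'b ^ 3"
        by (simp add: vec3_eq_iff cross_3)
      have "const3 (cross v w $ i) = cross (\<chi> i. const3 (v $ i)) (\<chi> i. const3 (w $ i)) $ i" for v w :: "'b ^ 3"
        unfolding cross[symmetric] by simp
      then show ?thesis
        unfolding p_def dot cross lin_def by (simp only: dot_cross_mult)
    qed
    then show ?thesis unfolding cong_def by blast
  qed
  from assms have "cong (const3 (dot t p ^ e) * q) (const3 (eval3 q p) * lin t ^ e)"
  proof (induction rule: homogeneous_induct)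
    case (mon c i j k)
    have m: "mon c i j k = const3 c * (vars $ 1 ^ i * vars $ 2 ^ j * vars $ 3 ^ k)"
      by (simp add: vars_3 mon_power mon_mult const3_mon)
    have "const3 (dot t p ^ e) * mon c i j k = const3 c * ((const3 (dot t p) * vars $ 1) ^ i
       * (const3 (dot t p) * vars $ 2) ^ j * (const3 (dot t p) * vars $ 3) ^ k)"
      unfolding m mon[symmetric] by (simp add: power_mult_distrib power_add const3_power mult_ac)
    moreover have "const3 (eval3 (mon c i j k) p) * lin t ^ e = const3 c * ((const3 (p $ 1) * lin t) ^ i
       * (const3 (p $ 2) * lin t) ^ j * (const3 (p $ 3) * lin t) ^ k)"
      unfolding mon[symmetric] by (simp add: eval3_mon power_mult_distrib power_add const3_power mult_ac)
    ultimately show ?case by (simp only:) (intro cong_mult cong_power cong_refl vars)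
  next
    case (add A B)
    then show ?case using cong_add by (simp add: distrib_left distrib_right)
  qed
  then show ?thesis unfolding cong_def p_def .
qed

text \<open>Strip the factors one at a time: q is the factor whose removal takes the product out of
  I, and r is the product of the factors after it.\<close>

lemma prod_list_split_ideal:
  assumes "s \<notin> I" "(\<Prod>q\<leftarrow>qs. f q) * s \<in> I" and mult: "\<And>r x. x \<in> I \<Longrightarrow> r * x \<in> I"
  shows "\<exists>q\<in>set qs. \<exists>r::'c::comm_monoid_mult. r * s \<notin> I \<and> f q * (r * s) \<in> I"
  using assms(2)
proof (induction qs)
  case Nil
  then show ?case using assms(1) by simp
next
  case (Cons q qs)
  show ?case
  proof (cases "(\<Prod>q\<leftarrow>qs. f q) * s \<in> I")
    case True
    then show ?thesis using Cons.IH by auto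
  next
    case False
    then show ?thesis using Cons.prems by (auto simp: mult.assoc)
  qed
qed

text \<open>Each prime factor of A divides B + x C for at most one constant x, since it cannot
  divide both B and C; infinitely many constants are available.\<close>

lemma ex_coprime_combination:
  fixes A B C :: "'b::ac_field poly3"
  assumes A: "A \<noteq> 0" and cop: "\<And>h. h dvd A \<Longrightarrow> h dvd B \<Longrightarrow> h dvd C \<Longrightarrow> h dvd 1"
  obtains x where "coprime A (B + const3 x * C)"
proof -
  define bad where "bad p = {x. p dvd B + const3 x * C}" for p
  have fin: "finite (bad p)" if p: "p \<in> prime_factors A" for p
  proof -
    have "x = y" if "x \<in> bad p" "y \<in> bad p" for x y
    proof (rule ccontr)
      assume ne: "x \<noteq> y"
      have "p dvd (B + const3 x * C) - (B + const3 y * C)" using that unfolding bad_def by (intro dvd_diff) auto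
      then have "p dvd const3 (x - y) * C" by (simp add: algebra_simps)
      moreover have "const3 (x - y) dvd (1 :: 'b poly3)" unfolding is_unit_poly3_iff using ne by (intro exI[of _ "x - y"]) simp
      ultimately have pC: "p dvd C" by (metis dvd_mult_unit_iff' mult.commute)
      moreover have "p dvd B" using pC that(1) unfolding bad_def by (auto simp: dvd_add_left_iff split: if_splits)
      ultimately have "p dvd 1" using cop p by (metis in_prime_factors_iff)
      with p show False by (metis in_prime_factors_iff not_prime_unit)
    qed
    then have "bad p \<subseteq> {SOME x. x \<in> bad p}" by (metis singletonI someI subsetI)
    then show ?thesis using finite_subset by blast
  qed
  have "finite (\<Union>p\<in>prime_factors A. bad p)" using fin by (intro finite_UN_I) auto
  then obtain x where x: "x \<notin> (\<Union>p\<in>prime_factors A. bad p)"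
    using ex_new_if_finite[OF infinite_UNIV_char_0] by blast
  have "coprime A (B + const3 x * C)"
  proof (rule ccontr)
    assume "\<not> ?thesis"
    then have "\<not> is_unit (gcd A (B + const3 x * C))" by (simp add: coprime_iff_gcd_eq_1)
    then obtain p where "prime p" "p dvd gcd A (B + const3 x * C)"
      using prime_divisor_exists[of "gcd A (B + const3 x * C)"] A by auto
    then have "p \<in> prime_factors A" "x \<in> bad p" using A by (auto simp: in_prime_factors_iff bad_def)
    with x show False by blast
  qed
  with that show ?thesis .
qed

lemma coprime3_ex_two:
  fixes u :: "'b::ac_field poly3 ^ 3"
  assumes "coprime3 u" "\<And>i. homogeneous d (u $ i)"
  obtains c c' where "dot (\<chi> i. const3 (c $ i)) u \<noteq> 0" "coprime (dot (\<chi> i. const3 (c $ i)) u) (dot (\<chi> i. const3 (c' $ i)) u)"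
proof -
  obtain i where i: "u $ i \<noteq> 0" using coprime3_nonzero[OF assms(1)] by blast
  have cop: "h dvd 1" if "h dvd u $ 1" "h dvd u $ 2" "h dvd u $ 3" for h
    using assms(1) that unfolding coprime3_def forall_3 by blast
  consider "i = 1" | "i = 2" | "i = 3" using exhaust_3[of i] by blast
  then show ?thesis
  proof cases
    case 1
    obtain x where "coprime (u $ 1) (u $ 2 + const3 x * u $ 3)"
      using ex_coprime_combination[of "u $ 1" "u $ 2" "u $ 3"] cop i 1 by blast
    then show ?thesis using i 1 by (intro that[of "vector [1, 0, 0]" "vector [0, 1, x]"]) (simp_all add: dot_3 vector_3)
  next
    case 2
    obtain x where "coprime (u $ 2) (u $ 1 + const3 x * u $ 3)"
      using ex_coprime_combination[of "u $ 2" "u $ 1" "u $ 3"] cop i 2 by blast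
    then show ?thesis using i 2 by (intro that[of "vector [0, 1, 0]" "vector [1, 0, x]"]) (simp_all add: dot_3 vector_3)
  next
    case 3
    obtain x where "coprime (u $ 3) (u $ 1 + const3 x * u $ 2)"
      using ex_coprime_combination[of "u $ 3" "u $ 1" "u $ 2"] cop i 3 by blast
    then show ?thesis using i 3 by (intro that[of "vector [0, 0, 1]" "vector [1, x, 0]"]) (simp_all add: dot_3 vector_3)
  qed
qed

lemma homogeneous_const_dot:
  "(\<And>i. homogeneous d (u $ i)) \<Longrightarrow> homogeneous d (dot (\<chi> i. const3 (c $ i)) u)"
  unfolding dot_def by (intro homogeneous_sum) (simp add: homogeneous_const3_mult)

lemma coprime3_two:
  fixes u :: "'b::ac_field poly3 ^ 3"
  assumes cop: "coprime3 u" and hom: "\<And>i. homogeneous d (u $ i)" and d: "d \<ge> 1"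
  obtains c c' where "dot (\<chi> i. const3 (c $ i)) u \<noteq> 0" "dot (\<chi> i. const3 (c' $ i)) u \<noteq> 0"
    "coprime (dot (\<chi> i. const3 (c $ i)) u) (dot (\<chi> i. const3 (c' $ i)) u)"
proof -
  obtain c c' where c: "dot (\<chi> i. const3 (c $ i)) u \<noteq> 0"
    "coprime (dot (\<chi> i. const3 (c $ i)) u) (dot (\<chi> i. const3 (c' $ i)) u)"
    using coprime3_ex_two[OF cop hom] by metis
  have "dot (\<chi> i. const3 (c' $ i)) u \<noteq> 0"
  proof
    assume "dot (\<chi> i. const3 (c' $ i)) u = 0"
    then have "dot (\<chi> i. const3 (c $ i)) u dvd 1" using c(2) by simp
    then show False using homogeneous_unit_iff[OF homogeneous_const_dot[OF hom] c(1)] d by simp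
  qed
  with c that show ?thesis by blast
qed

lemma evalv_0_dot: "evalv u v = 0 \<Longrightarrow> eval3 (dot w u) v = 0"
  by (simp add: eval3_dot)

text \<open>The multipliers q for which q G has a solution form an ideal \<open>I\<close>. If it is
  proper, elimination produces an element w outside I that two independent linear forms multiply
  into I, so the obstruction sits at a single point p. A multiplier not vanishing at p is, modulo
  those two forms and up to a constant, a power of a line avoiding the zeros of u. That power can be
  cancelled, which puts w into I.\<close>

theorem local_to_global:
  fixes u G :: "'b::ac_field poly3 ^ 3"
  assumes hom: "\<And>i. homogeneous d (u $ i)" and cop: "coprime3 u" and orth: "dot u G = 0"
    and loc: "\<And>p. p \<noteq> 0 \<Longrightarrow> evalv u p = 0 \<Longrightarrow> \<exists>q e v. homogeneous e q \<and> eval3 q p \<noteq> 0 \<and> q *s G = cross u v"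
  obtains v where "G = cross u v"
\<comment> \<open>A constant u is treated apart, because \<open>coprime3_two\<close> asks for
  positive degree.\<close>
proof (cases "d = 0")
  case True
  obtain i where i: "u $ i \<noteq> 0" using coprime3_nonzero[OF cop] by blast
  obtain c where c: "u $ i = const3 c" using homogeneous_0_const[of "u $ i"] hom True by blast
  then have "c \<noteq> 0" using i by auto
  have "cross u (cross G (axis i 1)) = (u $ i) *s G"
    using orth unfolding cross_cross_right by (simp add: dot_axis_right)
  then have "G = const3 (1 / c) *s cross u (cross G (axis i 1))"
    using \<open>c \<noteq> 0\<close> by (simp add: c vector_smult_assoc const3_inverse)
  then show ?thesis using that[of "const3 (1 / c) *s cross G (axis i 1)"] by (simp add: cross_scale_right)
next
  case False
  define I where "I = {q. \<exists>v. q *s G = cross u v}"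
  have I_mult: "r * q \<in> I" if "q \<in> I" for r q
    using that unfolding I_def by (auto simp: vector_smult_assoc[symmetric] cross_scale_right[symmetric] intro: exI)
  have I_add: "q + q' \<in> I" if "q \<in> I" "q' \<in> I" for q q'
    using that unfolding I_def
    by (auto simp: vector_sadd_rdistrib cross_add_right[symmetric])
  have I_u: "dot w u \<in> I" for w
  proof -
    have "cross u (cross G w) = dot w u *s G"
      using orth unfolding cross_cross_right by (simp add: dot_commute)
    then show ?thesis unfolding I_def by (auto intro: exI[of _ "cross G w"])
  qed
  show ?thesis
  proof (rule ccontr)
    assume no: "\<not> thesis"
    then have "1 \<notin> I" using that unfolding I_def by auto
    obtain c c' where c: "dot (\<chi> i. const3 (c $ i)) u \<noteq> 0" "dot (\<chi> i. const3 (c' $ i)) u \<noteq> 0"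
      "coprime (dot (\<chi> i. const3 (c $ i)) u) (dot (\<chi> i. const3 (c' $ i)) u)"
      using coprime3_two[OF cop hom] False by (metis One_nat_def Suc_leI not_gr_zero)
    note U = homogeneous_const_dot[OF hom, of c] c(1) homogeneous_const_dot[OF hom, of c'] c(2,3)
    obtain Z where Z: "finite Z" "0 \<notin> Z"
      "\<And>v. v \<noteq> 0 \<Longrightarrow> evalv u v = 0 \<Longrightarrow> \<exists>z\<in>Z. cross z v = 0"
      using finite_common_zeros[OF U] evalv_0_dot by metis
    \<comment> \<open>Some product of lines through \<open>cross a b\<close> lies in the ideal of
      two coprime combinations of the entries of u, hence in I. Splitting it yields a multiple of s
      that is still outside I but is carried into I by a single line.\<close>
    have elim: "\<exists>q r. r * s \<notin> I \<and> lin q * (r * s) \<in> I \<and> q \<noteq> 0 \<and> (\<exists>x y. q = x *s a + y *s b)"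
      if ab: "cross a b \<noteq> 0" and s: "s \<notin> I" for a b s
    proof -
      obtain qs A B where qs: "(\<Prod>q\<leftarrow>qs. lin q) = A * dot (\<chi> i. const3 (c $ i)) u + B * dot (\<chi> i. const3 (c' $ i)) u"
        "\<And>q. q \<in> set qs \<Longrightarrow> q \<noteq> 0 \<and> (\<exists>x y. q = x *s a + y *s b)"
        using elimination[OF U ab] by metis
      have "(\<Prod>q\<leftarrow>qs. lin q) * s \<in> I"
        unfolding qs(1) by (subst mult.commute) (intro I_mult I_add I_u)
      from prod_list_split_ideal[OF s this I_mult] qs(2) show ?thesis by blast
    qed
    have "cross (axis 1 1) (axis 2 1) \<noteq> (0 :: 'b ^ 3)" by (simp add: vec3_simps axis_def)
    from elim[OF this \<open>1 \<notin> I\<close>] obtain a s where a: "s \<notin> I" "lin a * s \<in> I" "a \<noteq> 0"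
      "\<exists>x y. a = x *s axis 1 1 + y *s axis 2 1" by auto
    then have a3: "a $ 3 = 0" by (auto simp: axis_def)
    \<comment> \<open>The second elimination must give a line not proportional to a, so b and b' are
      axis vectors whose span does not contain a.\<close>
    obtain b b' where bb: "cross b b' \<noteq> 0" "\<And>x y. x *s b + y *s b' \<noteq> 0 \<Longrightarrow> cross a (x *s b + y *s b') \<noteq> 0"
    proof (cases "a $ 1 = 0")
      case True
      then have "a $ 2 \<noteq> 0" using a(3) a3 by (auto simp: vec3_eq_iff)
      then show ?thesis using True a3
        by (intro that[of "axis 1 1" "axis 3 1"]) (auto simp: vec3_simps axis_def)
    next
      case False
      then show ?thesis using a3
        by (intro that[of "axis 2 1" "axis 3 1"]) (auto simp: vec3_simps axis_def)
    qed
    from elim[OF bb(1) a(1)] obtain a' r where a': "r * s \<notin> I" "lin a' * (r * s) \<in> I" "cross a a' \<noteq> 0"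
      using bb(2) by metis
    define p where "p = cross a a'"
    define w where "w = r * s"
    have w: "w \<notin> I" "lin a' * w \<in> I" "lin a * w \<in> I"
      using a' I_mult[OF a(2), of r] by (simp_all add: w_def mult.left_commute)
    have "p \<noteq> 0" using a' by (simp add: p_def)
    obtain q e where q: "homogeneous e q" "eval3 q p \<noteq> 0" "q \<in> I"
    proof (cases "evalv u p = 0")
      case True
      with loc[OF \<open>p \<noteq> 0\<close>] that show ?thesis unfolding I_def by blast
    next
      case False
      then obtain i where i: "eval3 (u $ i) p \<noteq> 0" by (auto simp: vec_eq_iff)
      have "u $ i \<in> I" using I_u[of "axis i 1"] by (simp add: dot_axis)
      with that[OF hom i] show ?thesis .
    qed
    obtain t where t: "t $ 3 = 1" "\<And>z. z \<in> insert p Z \<Longrightarrow> dot t z \<noteq> 0"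
      using ex_avoiding_form[of "insert p Z"] Z \<open>p \<noteq> 0\<close> by auto
    have avoid: "evalv u v \<noteq> 0" if "v \<noteq> 0" "dot t v = 0" for v
    proof
      assume v0: "evalv u v = 0"
      from Z(3)[OF that(1) v0] obtain z where z: "z \<in> Z" "cross z v = 0" ..
      have "z \<noteq> 0" using Z(2) z(1) by auto
      with z(2) obtain l where l: "v = l *s z" by (rule parallel_field)
      then have "l * dot t z = 0" using that by (simp add: dot_scale_right)
      then have "l = 0" using t(2) z by simp
      then show False using l that by simp
    qed
    have cancel: "x \<in> I" if x: "lin t * x \<in> I" for x
    proof -
      obtain v where "lin t *s (x *s G) = cross u v"
        using x unfolding I_def by (auto simp: vector_smult_assoc)
      from cross_divide_linear[OF hom t(1) avoid this] show ?thesis unfolding I_def by blast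
    qed
    have cancel_power: "lin t ^ m * x \<in> I \<Longrightarrow> x \<in> I" for m x
      by (induction m) (auto simp: mult.assoc intro: cancel)
    obtain A B where AB: "const3 (dot t p ^ e) * q = const3 (eval3 q p) * lin t ^ e + A * lin a + B * lin a'"
      using form_mod_point[OF q(1), of t a a'] unfolding p_def by blast
    let ?k = "eval3 q p"
    \<comment> \<open>After multiplication by w, the terms with \<open>lin a\<close>,
      \<open>lin a'\<close> and q all lie in I; what remains is the power of
      \<open>lin t\<close>.\<close>
    have "lin t ^ e * w = const3 (1 / ?k) * (const3 ?k * lin t ^ e) * w"
      by (simp only: mult.assoc[symmetric] const3_inverse[OF q(2)] mult_1)
    also have "\<dots> = const3 (1 / ?k) * (const3 (dot t p ^ e) * q - A * lin a - B * lin a') * w"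
      by (simp add: AB)
    also have "\<dots> = (const3 (1 / ?k) * const3 (dot t p ^ e) * w) * q
        + (- (const3 (1 / ?k) * A)) * (lin a * w) + (- (const3 (1 / ?k) * B)) * (lin a' * w)"
      by (simp add: algebra_simps)
    also have "\<dots> \<in> I" by (intro I_add I_mult q w)
    finally have "w \<in> I" by (rule cancel_power)
    with w show False by blast
  qed
qed

section \<open>Pencils of plane curves\<close>

lemma prime_elem_dvd_prod:
  fixes f :: "'i \<Rightarrow> 'r::{comm_semiring_1}"
  assumes "prime_elem p" "finite S" "p dvd prod f S"
  shows "\<exists>x\<in>S. p dvd f x"
  using assms(2,3)
proof (induction S rule: finite_induct)
  case empty
  then show ?case using assms(1) by (simp add: prime_elem_def)
next
  case (insert x S)
  then show ?case using assms(1) by (auto dest: prime_elem_dvd_multD)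
qed

text \<open>A partial derivative has smaller degree than p, so p divides it only if it is zero; if
  all were zero, Euler's relation would give e p = 0.\<close>

lemma irreducible_not_dvd_grad:
  fixes p :: "'b::field_char_0 poly3"
  assumes p: "homogeneous e p" "p \<noteq> 0" "\<not> p dvd 1"
  shows "\<exists>i. \<not> p dvd grad p $ i"
proof (rule ccontr)
  assume no: "\<not> ?thesis"
  have e: "e \<noteq> 0" using homogeneous_unit_iff[OF p(1,2)] p(3) by auto
  have "grad p $ i = 0" for i
  proof (rule ccontr)
    assume nz: "grad p $ i \<noteq> 0"
    obtain q where q: "grad p $ i = p * q" using no by (auto simp: dvd_def)
    obtain e1 e2 where "homogeneous e1 p" "homogeneous e2 q" "e1 + e2 = e - 1"
      using homogeneous_factors[of "e - 1" p q] homogeneous_grad[OF p(1), of i] nz q by metis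
    moreover from this have "e1 = e" using homogeneous_degree_unique p by blast
    ultimately show False using e by simp
  qed
  then have "of_nat e * p = 0" using euler[OF p(1)] by (simp add: dot_def)
  then show False using e p by simp
qed

definition det2 :: "'b::comm_ring ^ 2 \<Rightarrow> 'b ^ 2 \<Rightarrow> 'b" where
  "det2 v w = v $ 1 * w $ 2 - v $ 2 * w $ 1"

lemma vec2_eq_iff: "a = b \<longleftrightarrow> a $ 1 = b $ 1 \<and> a $ 2 = b $ 2" for a b :: "'b ^ 2"
  by (simp add: vec_eq_iff forall_2)

lemma ex_det2_1:
  fixes v :: "'b::field ^ 2"
  assumes "v \<noteq> 0"
  obtains w where "det2 v w = 1" "w \<noteq> 0"
proof (cases "v $ 1 = 0")
  case True
  then have "v $ 2 \<noteq> 0" using assms by (auto simp: vec2_eq_iff)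
  then show ?thesis using True
    by (intro that[of "vector [- 1 / v $ 2, 0]"]) (auto simp: det2_def vector_2 vec2_eq_iff)
next
  case False
  then show ?thesis
    by (intro that[of "vector [0, 1 / v $ 1]"]) (auto simp: det2_def vector_2 vec2_eq_iff)
qed

text \<open>The members with f and g already over the closure, so that the geometry can be developed
  over any field of class \<open>ac_field\<close>.\<close>

definition pencil_at :: "'b::comm_ring_1 poly3 \<Rightarrow> 'b poly3 \<Rightarrow> 'b ^ 2 \<Rightarrow> 'b poly3" where
  "pencil_at f g v = const3 (v $ 1) * f + const3 (v $ 2) * g"

lemma grad_pencil_at: "grad (pencil_at f g v) = const3 (v $ 1) *s grad f + const3 (v $ 2) *s grad g"
  by (simp add: pencil_at_def grad_add grad_mult)

lemma cross_combination:
  "cross (a *s v + b *s w) (c *s v + d *s w) = (a * d - b * c) *s cross v w"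
  by (simp add: vec3_eq_iff cross_3 algebra_simps)

text \<open>The hypotheses translated to coordinate vectors, where two nonzero vectors give the same
  point iff their cross product vanishes. The clause \<open>singular_finite\<close> says that
  finitely many members carry all singular points.\<close>

locale pencil =
  fixes f g :: "'b::ac_field poly3" and n :: nat
  assumes n_pos: "n \<ge> 1" and hom_f: "homogeneous n f" and hom_g: "homogeneous n g"
    and member_nonzero: "\<And>v. v \<noteq> 0 \<Longrightarrow> pencil_at f g v \<noteq> 0"
    and member_squarefree: "\<And>v. v \<noteq> 0 \<Longrightarrow> squarefree (pencil_at f g v)"
    and base_finite: "\<And>p. (\<And>i::nat. p i \<noteq> 0 \<and> eval3 f (p i) = 0 \<and> eval3 g (p i) = 0) \<Longrightarrow>
      \<exists>i j. i \<noteq> j \<and> cross (p i) (p j) = 0"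
    and base_points: "\<exists>p. (\<forall>i<n * n. p i \<noteq> 0 \<and> eval3 f (p i) = 0 \<and> eval3 g (p i) = 0) \<and>
      (\<forall>i<n * n. \<forall>j<n * n. i \<noteq> j \<longrightarrow> cross (p i) (p j) \<noteq> 0) \<and>
      (\<forall>q. q \<noteq> 0 \<longrightarrow> eval3 f q = 0 \<longrightarrow> eval3 g q = 0 \<longrightarrow> (\<exists>i<n * n. cross (p i) q = 0))"
    and singular_finite: "\<exists>S. finite S \<and> 0 \<notin> S \<and> (\<forall>v p. v \<noteq> 0 \<longrightarrow> p \<noteq> 0 \<longrightarrow>
      evalv (grad (pencil_at f g v)) p = 0 \<longrightarrow> (\<exists>w\<in>S. eval3 (pencil_at f g w) p = 0))"
begin

abbreviation "m \<equiv> pencil_at f g"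

definition u where "u = cross (grad f) (grad g)"

lemma hom_m: "homogeneous n (m v)"
  unfolding pencil_at_def by (intro homogeneous_add homogeneous_const3_mult hom_f hom_g)

lemma hom_u: "homogeneous (2 * n - 2) (u $ i)"
proof -
  have "homogeneous (n - 1 + (n - 1)) (u $ i)"
    using exhaust_3[of i] unfolding u_def
    by (auto simp: cross_3 intro!: homogeneous_diff homogeneous_mult
          homogeneous_grad[OF hom_f, unfolded One_nat_def] homogeneous_grad[OF hom_g, unfolded One_nat_def])
  moreover have "n - 1 + (n - 1) = 2 * n - 2" by simp
  ultimately show ?thesis by metis
qed

lemma f_nonzero: "f \<noteq> 0" and g_nonzero: "g \<noteq> 0"
proof -
  have "m (vector [1, 0]) \<noteq> 0" "m (vector [0, 1]) \<noteq> 0"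
    by (rule member_nonzero; auto simp: vec2_eq_iff vector_2)+
  then show "f \<noteq> 0" "g \<noteq> 0" by (auto simp: pencil_at_def vector_2)
qed

text \<open>A nonconstant common factor would have infinitely many zeros, all of them base
  points.\<close>

lemma coprime_fg: "coprime f g"
proof (rule ccontr)
  assume "\<not> ?thesis"
  then have nu: "\<not> gcd f g dvd 1" by (simp add: coprime_iff_gcd_eq_1)
  have nz: "gcd f g \<noteq> 0" using f_nonzero by simp
  obtain e where e: "homogeneous e (gcd f g)"
    using homogeneous_dvd[OF hom_f f_nonzero gcd_dvd1] by blast
  have "e \<ge> 1" using homogeneous_unit_iff[OF e nz] nu by simp
  obtain p where p: "\<And>i::nat. p i \<noteq> 0" "\<And>i. eval3 (gcd f g) (p i) = 0" "\<And>i j. i \<noteq> j \<Longrightarrow> cross (p i) (p j) \<noteq> 0"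
    using form_zeros[OF e \<open>e \<ge> 1\<close> nz] by metis
  have "p i \<noteq> 0 \<and> eval3 f (p i) = 0 \<and> eval3 g (p i) = 0" for i
    using p eval3_dvd[OF gcd_dvd1 p(2)] eval3_dvd[OF gcd_dvd2 p(2)] by blast
  from base_finite[OF this] p(3) show False by blast
qed

text \<open>A change of generators multiplies u by its determinant, so any two members v, w with
  \<open>det2 v w = 1\<close> can replace f and g.\<close>

lemma cross_members: "cross (grad (m v)) (grad (m w)) = const3 (det2 v w) *s u"
  unfolding grad_pencil_at u_def det2_def cross_combination by simp

lemma combination_f: "det2 v w = 1 \<Longrightarrow> f = const3 (w $ 2) * m v - const3 (v $ 2) * m w"
  and combination_g: "det2 v w = 1 \<Longrightarrow> g = const3 (v $ 1) * m w - const3 (w $ 1) * m v"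
proof -
  assume "det2 v w = 1"
  then have *: "const3 (v $ 1) * const3 (w $ 2) - const3 (v $ 2) * const3 (w $ 1) = (1 :: 'b poly3)"
    by (simp add: det2_def flip: const3_simps)
  have "const3 (w $ 2) * m v - const3 (v $ 2) * m w
    = (const3 (v $ 1) * const3 (w $ 2) - const3 (v $ 2) * const3 (w $ 1)) * f"
    by (simp add: pencil_at_def algebra_simps)
  then show "f = const3 (w $ 2) * m v - const3 (v $ 2) * m w" by (simp add: *)
  have "const3 (v $ 1) * m w - const3 (w $ 1) * m v
    = (const3 (v $ 1) * const3 (w $ 2) - const3 (v $ 2) * const3 (w $ 1)) * g"
    by (simp add: pencil_at_def algebra_simps)
  then show "g = const3 (v $ 1) * m w - const3 (w $ 1) * m v" by (simp add: *)
qed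

lemma m_combination:
  assumes "det2 v w = 1"
  shows "m x = const3 (det2 x w) * m v + const3 (det2 v x) * m w"
proof -
  have "m x = const3 (x $ 1) * (const3 (w $ 2) * m v - const3 (v $ 2) * m w)
    + const3 (x $ 2) * (const3 (v $ 1) * m w - const3 (w $ 1) * m v)"
    using combination_f[OF assms] combination_g[OF assms] unfolding pencil_at_def[of f g x] by simp
  then show ?thesis by (simp add: det2_def algebra_simps)
qed

lemma m_scale: "m (c *s w) = const3 c * m w"
  by (simp add: pencil_at_def algebra_simps)

lemma m_dvd_both:
  assumes "det2 v w \<noteq> 0" "h dvd m v" "h dvd m w"
  shows "h dvd 1"
proof -
  define w' where "w' = (1 / det2 v w) *s w"
  have "det2 v (c *s w) = c * det2 v w" for c by (simp add: det2_def algebra_simps)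
  then have d: "det2 v w' = 1" using assms(1) by (simp add: w'_def)
  have "m w' = const3 (1 / det2 v w) * m w" unfolding w'_def by (rule m_scale)
  then have "h dvd m w'" using assms(3) by simp
  then have "h dvd f" "h dvd g"
    using combination_f[OF d] combination_g[OF d] assms(2) by (metis dvd_diff dvd_mult)+
  then show ?thesis using coprime_fg coprime_common_divisor by blast
qed

lemma m_parallel:
  assumes "det2 v w = 0" "v \<noteq> 0"
  obtains c where "m w = const3 c * m v" "w = c *s v"
proof -
  have "\<exists>c. w = c *s v"
  proof (cases "v $ 1 = 0")
    case True
    then have "v $ 2 \<noteq> 0" using assms(2) by (auto simp: vec2_eq_iff)
    with True assms show ?thesis by (intro exI[of _ "w $ 2 / v $ 2"]) (auto simp: vec2_eq_iff det2_def)
  next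
    case False
    then show ?thesis using assms
      by (intro exI[of _ "w $ 1 / v $ 1"]) (auto simp: vec2_eq_iff det2_def field_simps)
  qed
  then obtain c where "w = c *s v" ..
  moreover from this have "m w = const3 c * m v" by (simp add: pencil_at_def algebra_simps)
  ultimately show ?thesis using that by blast
qed

text \<open>Cramer's rule expresses f and g at p, up to the determinant, by the two members; hence
  off the base locus the member through a point is unique.\<close>

lemma m_common_zero:
  assumes "eval3 (m v) p = 0" "eval3 (m w) p = 0" "\<not> (eval3 f p = 0 \<and> eval3 g p = 0)"
  shows "det2 v w = 0"
proof -
  have "eval3 f p * det2 v w = w $ 2 * eval3 (m v) p - v $ 2 * eval3 (m w) p"
    "eval3 g p * det2 v w = v $ 1 * eval3 (m w) p - w $ 1 * eval3 (m v) p"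
    unfolding pencil_at_def det2_def by (simp_all add: algebra_simps)
  with assms show ?thesis by auto
qed

lemma squarefree_member_prime:
  assumes "v \<noteq> 0" "p * h = m v" "homogeneous e p" "irreducible p"
  shows "\<not> p dvd h"
proof
  assume "p dvd h"
  then have "p * p dvd m v" unfolding assms(2)[symmetric] by (rule mult_dvd_mono[OF dvd_refl])
  then have "p ^ 2 dvd m v" by (simp add: power2_eq_square)
  then have "p dvd 1" using member_squarefree[OF assms(1)] unfolding squarefree_def by blast
  then show False using assms(4) by (auto simp: irreducible_def)
qed

text \<open>With m v = p h, the gradient is h times grad p modulo p. Reducedness keeps p from
  dividing h, so p would divide its own gradient.\<close>

lemma not_dvd_grad_member:
  assumes "v \<noteq> 0" "irreducible p" "p dvd m v"
  shows "\<exists>i. \<not> p dvd grad (m v) $ i"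
proof (rule ccontr)
  assume no: "\<not> ?thesis"
  obtain e where e: "homogeneous e p" using homogeneous_dvd[OF hom_m member_nonzero[OF assms(1)] assms(3)] by blast
  obtain h where h: "m v = p * h" using assms(3) by (auto simp: dvd_def)
  have "\<not> p dvd h" using squarefree_member_prime[OF assms(1) h[symmetric] e assms(2)] .
  moreover have "p dvd h * grad p $ i" for i
  proof -
    have "p dvd grad (m v) $ i" using no by blast
    moreover have "grad (m v) $ i = p * grad h $ i + h * grad p $ i" by (simp add: h grad_mult)
    ultimately show ?thesis by (metis dvd_add_right_iff dvd_triv_left)
  qed
  ultimately have "\<And>i. p dvd grad p $ i"
    using irreducible_imp_prime_elem[OF assms(2)] prime_elem_dvd_mult_iff by blast
  moreover have "p \<noteq> 0" "\<not> p dvd 1" using assms(2) by (auto simp: irreducible_def)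
  ultimately show False using irreducible_not_dvd_grad[OF e] by blast
qed

text \<open>By Euler's relation both gradients are orthogonal to p. If they are also proportional to
  each other, the curves share a tangent direction w independent of p.\<close>

lemma u_nonzero_base_aux:
  assumes p: "p \<noteq> 0" "eval3 f p = 0" "eval3 g p = 0" and u0: "evalv u p = 0"
  obtains w where "dot w (evalv (grad f) p) = 0" "dot w (evalv (grad g) p) = 0" "cross p w \<noteq> 0"
proof -
  define A where "A = evalv (grad f) p"
  define B where "B = evalv (grad g) p"
  have pA: "dot p A = 0" and pB: "dot p B = 0"
    using p by (simp_all add: A_def B_def dot_evalv_grad[OF hom_f] dot_evalv_grad[OF hom_g])
  have AB: "cross A B = 0" using u0 by (simp add: u_def evalv_cross A_def B_def)
  obtain i where i: "p $ i \<noteq> 0" using p(1) by (auto simp: vec_eq_iff)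
  have pe: "dot p (axis i 1) \<noteq> 0" using i by (simp add: dot_axis_right)
  \<comment> \<open>For a vector C spanning the direction of both gradients,
    \<open>cross C (axis i 1)\<close> is orthogonal to both, and its cross product with p is a
    nonzero multiple of C.\<close>
  have key: "\<exists>w. dot w A = 0 \<and> dot w B = 0 \<and> cross p w \<noteq> 0" if C: "C \<noteq> 0" "dot p C = 0" "cross C A = 0" "cross C B = 0" for C
  proof -
    obtain a where a: "A = a *s C" using parallel_field[OF C(3,1)] .
    obtain b where b: "B = b *s C" using parallel_field[OF C(4,1)] .
    let ?w = "cross C (axis i 1)"
    have "dot ?w C = 0" by (simp add: dot_commute)
    then have "dot ?w A = 0" "dot ?w B = 0" by (simp_all add: a b dot_scale_right)
    moreover have "cross p ?w = dot p (axis i 1) *s C" using C(2) by (simp add: cross_cross_right)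
    moreover have "dot p (axis i 1) *s C \<noteq> 0" using pe C(1) by (auto simp: vec_eq_iff)
    ultimately show ?thesis by metis
  qed
  have "\<exists>w. dot w A = 0 \<and> dot w B = 0 \<and> cross p w \<noteq> 0"
  proof (cases "A = 0")
    case False
    then show ?thesis using key[of A] pA AB by simp
  next
    case A0: True
    show ?thesis
    proof (cases "B = 0")
      case False
      then show ?thesis using key[of B] pB A0 by simp
    next
      case True
      have "\<exists>w. cross p w \<noteq> 0"
      proof (rule ccontr)
        assume no: "\<not> ?thesis"
        have "p $ 1 = 0 \<and> p $ 2 = 0 \<and> p $ 3 = 0"
          using no[simplified, rule_format, of "axis 1 1"] no[simplified, rule_format, of "axis 2 1"]
          by (auto simp: vec3_simps axis_def)
        then show False using p by (simp add: vec3_eq_iff)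
      qed
      then show ?thesis using A0 True by simp
    qed
  qed
  then show ?thesis using that unfolding A_def B_def by blast
qed

lemma u_nonzero_base:
  assumes q: "q \<noteq> 0" "eval3 f q = 0" "eval3 g q = 0"
  shows "evalv u q \<noteq> 0"
proof
  assume u0: "evalv u q = 0"
  obtain p where p: "\<And>i. i < n * n \<Longrightarrow> p i \<noteq> 0 \<and> eval3 f (p i) = 0 \<and> eval3 g (p i) = 0"
    "\<And>i j. i < n * n \<Longrightarrow> j < n * n \<Longrightarrow> i \<noteq> j \<Longrightarrow> cross (p i) (p j) \<noteq> 0"
    "\<And>q. q \<noteq> 0 \<Longrightarrow> eval3 f q = 0 \<Longrightarrow> eval3 g q = 0 \<Longrightarrow> \<exists>i<n * n. cross (p i) q = 0"
    using base_points by blast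
  from p(3)[OF q] obtain i where i: "i < n * n" "cross (p i) q = 0" by blast
  then have "cross q (p i) = 0" using cross_skew[of q "p i"] by simp
  then obtain c where c: "p i = c *s q" using parallel_field q by blast
  have "evalv u (p i) = 0"
    using u0 by (simp add: vec_eq_iff c eval3_homogeneous_scale[OF hom_u])
  from u_nonzero_base_aux[OF _ _ _ this] p(1)[OF i(1)] obtain w where
    w: "dot w (evalv (grad f) (p i)) = 0" "dot w (evalv (grad g) (p i)) = 0" "cross (p i) w \<noteq> 0" by metis
  from bezout_transversal[OF hom_f f_nonzero hom_g g_nonzero coprime_fg, of p i w, OF p(1,2) i(1) w(1,2)] w(3)
  show False by blast
qed

text \<open>The coefficients of a linear dependence between the gradients of f and g at p are the
  parameters of the member.\<close>

lemma singular_member_of_zero: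
  assumes "evalv u p = 0"
  obtains v where "v \<noteq> 0" "evalv (grad (m v)) p = 0"
proof (cases "evalv (grad f) p = 0")
  case True
  show ?thesis
    by (rule that[of "vector [1, 0]"]) (use True in \<open>auto simp: vec2_eq_iff vector_2 grad_pencil_at vec_eq_iff\<close>)
next
  case False
  have "cross (evalv (grad f) p) (evalv (grad g) p) = 0" using assms by (simp add: u_def evalv_cross)
  from parallel_field[OF this False] obtain c where c: "evalv (grad g) p = c *s evalv (grad f) p" .
  have "eval3 (grad g $ i) p = c * eval3 (grad f $ i) p" for i
    using c by (metis evalv_nth vector_smult_component)
  then show ?thesis
    by (intro that[of "vector [- c, 1]"]) (auto simp: vec2_eq_iff vector_2 grad_pencil_at vec_eq_iff)
qed

lemma zero_of_singular_member:
  assumes "v \<noteq> 0" "evalv (grad (m v)) p = 0"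
  shows "evalv u p = 0" "eval3 (m v) p = 0"
proof -
  obtain w where "det2 v w = 1" using ex_det2_1[OF assms(1)] .
  then have "u = cross (grad (m v)) (grad (m w))" by (simp add: cross_members)
  then show "evalv u p = 0" using assms(2) by (simp add: evalv_cross)
  show "eval3 (m v) p = 0" by (rule eval3_zero_if_grad_zero[OF hom_m n_pos assms(2)])
qed

lemma not_base_if_u_zero: "p \<noteq> 0 \<Longrightarrow> evalv u p = 0 \<Longrightarrow> \<not> (eval3 f p = 0 \<and> eval3 g p = 0)"
  using u_nonzero_base by blast

lemma u_nonzero: "\<exists>i. u $ i \<noteq> 0"
proof -
  obtain p where "p \<noteq> 0" "eval3 f p = 0" "eval3 g p = 0"
    using base_points n_pos by (metis One_nat_def Suc_le_lessD nat_0_less_mult_iff)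
  then have "evalv u p \<noteq> 0" by (rule u_nonzero_base)
  then show ?thesis by (metis evalv_nth eval3_simps(2) vec_eq_iff zero_index)
qed

text \<open>Suppose an irreducible p divides u. Its zeros are singular points of members, and
  finitely many members carry these, so p divides one member m v = p k. Modulo p, u is k times the
  cross product of grad p with the gradient of a complementary member m w, so p divides that cross
  product. Crossing it with the coordinates and using Euler's relation, p divides n (m w) grad p;
  being prime to n and to m w, it divides its own gradient.\<close>

lemma coprime3_u: "coprime3 u"
  unfolding coprime3_def
proof (intro allI impI, rule ccontr)
  fix h assume h: "\<forall>i. h dvd u $ i" and nu: "\<not> h dvd 1"
  obtain i where i: "u $ i \<noteq> 0" using u_nonzero by blast
  then have "h \<noteq> 0" using h by auto
  then obtain p where p: "irreducible p" "p dvd h" using ex_irreducible_factor nu by blast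
  have pu: "p dvd u $ j" for j using p h dvd_trans by blast
  obtain e where e: "homogeneous e p" using homogeneous_dvd[OF hom_u i pu] by blast
  have prime: "prime_elem p" using p(1) by (rule irreducible_imp_prime_elem)
  obtain S where S: "finite S" "0 \<notin> S" "\<And>v p. v \<noteq> 0 \<Longrightarrow> p \<noteq> 0 \<Longrightarrow>
      evalv (grad (m v)) p = 0 \<Longrightarrow> \<exists>w\<in>S. eval3 (m w) p = 0"
    using singular_finite by blast
  have "p dvd prod m S"
  proof (rule irreducible_dvd_if_zeros[OF e p(1)])
    show "homogeneous (sum (\<lambda>_. n) S) (prod m S)" by (intro homogeneous_prod hom_m)
    fix x assume x: "x \<noteq> 0" "eval3 p x = 0"
    have "evalv u x = 0" using eval3_dvd[OF pu x(2)] by (simp add: vec_eq_iff)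
    then obtain v where "v \<noteq> 0" "evalv (grad (m v)) x = 0" by (rule singular_member_of_zero)
    from S(3)[OF this(1) x(1) this(2)] show "eval3 (prod m S) x = 0"
      using S(1) by (auto simp: eval3_prod)
  qed
  then obtain v where v: "v \<in> S" "p dvd m v" using prime_elem_dvd_prod[OF prime S(1)] by blast
  then have v0: "v \<noteq> 0" using S by auto
  obtain w where w: "det2 v w = 1" "w \<noteq> 0" using ex_det2_1[OF v0] .
  obtain k where k: "m v = p * k" using v(2) by (auto simp: dvd_def)
  have nk: "\<not> p dvd k" using squarefree_member_prime[OF v0 k[symmetric] e p(1)] .
  have "p dvd cross (grad p) (grad (m w)) $ i" for i
  proof -
    have "u = cross (grad (m v)) (grad (m w))" using w by (simp add: cross_members)
    also have "\<dots> = p *s cross (grad k) (grad (m w)) + k *s cross (grad p) (grad (m w))"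
      by (simp add: k grad_mult cross_add_left cross_scale_left)
    finally have "u $ i = p * cross (grad k) (grad (m w)) $ i + k * cross (grad p) (grad (m w)) $ i" by simp
    then have "p dvd k * cross (grad p) (grad (m w)) $ i"
      using pu[of i] by (metis dvd_add_right_iff dvd_triv_left)
    then show ?thesis using prime nk prime_elem_dvd_mult_iff by blast
  qed
  then have "p dvd cross vars (cross (grad p) (grad (m w))) $ i" for i
    using exhaust_3[of i] by (auto simp: cross_3[of vars])
  moreover have "cross vars (cross (grad p) (grad (m w)))
    = (of_nat n * m w) *s grad p - (of_nat e * p) *s grad (m w)"
    by (simp add: cross_cross_right euler[OF hom_m] euler[OF e])
  then have "cross vars (cross (grad p) (grad (m w))) $ i
      = of_nat n * m w * grad p $ i - p * (of_nat e * grad (m w) $ i)" for i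
    by (simp add: mult_ac)
  ultimately have "p dvd of_nat n * m w * grad p $ i - p * (of_nat e * grad (m w) $ i)" for i
    by simp
  then have d: "p dvd of_nat n * m w * grad p $ i" for i
    by (metis dvd_diff_left_iff dvd_triv_left)
  have "\<not> p dvd m w" using m_dvd_both[of v w p] v(2) w p(1) by (auto simp: irreducible_def)
  moreover have "\<not> p dvd of_nat n"
  proof
    assume pn: "p dvd of_nat n"
    have "const3 (of_nat n :: 'b) dvd 1" unfolding is_unit_poly3_iff using n_pos by (intro exI[of _ "of_nat n"]) auto
    then have "p dvd 1" using pn dvd_trans by (auto simp: const3_of_nat)
    then show False using p(1) by (auto simp: irreducible_def)
  qed
  ultimately have "p dvd grad p $ i" for i using d[of i] prime by (auto simp: prime_elem_dvd_mult_iff)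
  moreover have "p \<noteq> 0" "\<not> p dvd 1" using p(1) by (auto simp: irreducible_def)
  ultimately show False using irreducible_not_dvd_grad[OF e] by blast
qed

end

text \<open>Differentiating the relation between b and grad F and exchanging second derivatives
  shows that the derivation b sends each partial derivative to a combination of partial derivatives.
  The Leibniz rule extends this to the Jacobian ideal.\<close>

lemma dot_grad_jacobian:
  assumes "dot b (grad F) = 0"
  shows "\<exists>w'. dot b (grad (dot w (grad F))) = dot w' (grad F)"
proof -
  define t where "t = (\<chi> i. \<Sum>j\<in>UNIV. grad (b $ j) $ i * grad F $ j)"
  have c: "(\<Sum>j\<in>UNIV. b $ j * grad (grad F $ i) $ j) = - t $ i" for i
  proof -
    have "grad (dot b (grad F)) $ i = 0" using assms by simp
    then have "(\<Sum>j\<in>UNIV. b $ j * grad (grad F $ j) $ i + grad F $ j * grad (b $ j) $ i) = 0"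
      by (simp add: dot_def grad_sum grad_mult)
    then show ?thesis
      by (simp add: t_def sum.distrib grad_commute[of F _ i] mult.commute eq_neg_iff_add_eq_0)
  qed
  have "dot b (grad (dot w (grad F)))
    = (\<Sum>j\<in>UNIV. \<Sum>i\<in>UNIV. b $ j * (w $ i * grad (grad F $ i) $ j + grad F $ i * grad (w $ i) $ j))"
    by (simp add: dot_def grad_sum grad_mult sum_distrib_left)
  also have "\<dots> = (\<Sum>i\<in>UNIV. \<Sum>j\<in>UNIV. b $ j * (w $ i * grad (grad F $ i) $ j + grad F $ i * grad (w $ i) $ j))"
    by (rule sum.swap)
  also have "\<dots> = (\<Sum>i\<in>UNIV. w $ i * (\<Sum>j\<in>UNIV. b $ j * grad (grad F $ i) $ j) + (\<Sum>j\<in>UNIV. b $ j * grad (w $ i) $ j) * grad F $ i)"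
    by (simp add: sum.distrib sum_distrib_left sum_distrib_right algebra_simps)
  also have "\<dots> = (\<Sum>i\<in>UNIV. - (w $ i * t $ i) + (\<Sum>j\<in>UNIV. b $ j * grad (w $ i) $ j) * grad F $ i)"
    by (simp add: c)
  also have "\<dots> = (\<Sum>i\<in>UNIV. (\<Sum>j\<in>UNIV. b $ j * grad (w $ i) $ j) * grad F $ i) - (\<Sum>i\<in>UNIV. w $ i * t $ i)"
    by (simp add: sum.distrib sum_negf sum_subtractf)
  also have "(\<Sum>i\<in>UNIV. w $ i * t $ i) = (\<Sum>i\<in>UNIV. \<Sum>j\<in>UNIV. w $ i * (grad (b $ j) $ i * grad F $ j))"
    by (simp add: t_def sum_distrib_left)
  also have "\<dots> = (\<Sum>j\<in>UNIV. (\<Sum>i\<in>UNIV. w $ i * grad (b $ j) $ i) * grad F $ j)"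
    by (subst sum.swap) (simp add: sum_distrib_right mult.assoc)
  finally show ?thesis
    by (intro exI[of _ "(\<chi> i. (\<Sum>j\<in>UNIV. b $ j * grad (w $ i) $ j) - (\<Sum>j\<in>UNIV. w $ j * grad (b $ i) $ j))"])
       (simp add: dot_def algebra_simps sum_subtractf)
qed

section \<open>Unions of members of a pencil\<close>

locale pencil_union = pencil f g n for f g :: "'b::ac_field poly3" and n :: nat +
  fixes k :: nat and w :: "nat \<Rightarrow> 'b ^ 2"
  assumes k: "k > 1" and w_nonzero: "\<And>i. i < k \<Longrightarrow> w i \<noteq> 0"
    and w_distinct: "\<And>i j. i < k \<Longrightarrow> j < k \<Longrightarrow> i \<noteq> j \<Longrightarrow> det2 (w i) (w j) \<noteq> 0"
begin

definition F where "F = (\<Prod>i<k. m (w i))"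

definition P where "P i = (\<Prod>j\<in>{..<k} - {i}. m (w j))"

lemma hom_F: "homogeneous (n * k) F"
proof -
  have "homogeneous (\<Sum>i<k. n) F" unfolding F_def by (intro homogeneous_prod hom_m)
  then show ?thesis by (simp add: mult.commute)
qed

lemma F_nonzero: "F \<noteq> 0"
  unfolding F_def using member_nonzero w_nonzero by simp

lemma F_split: "i < k \<Longrightarrow> F = m (w i) * P i"
  unfolding F_def P_def by (subst prod.remove[of _ i]) auto

lemma nk: "n * k \<ge> 2" using n_pos k by (metis Suc_1 Suc_leI mult_le_mono nat_mult_1)

lemma eval3_F_0_if_grad: "evalv (grad F) p = 0 \<Longrightarrow> eval3 F p = 0"
  by (rule eval3_zero_if_grad_zero[OF hom_F]) (use nk in linarith)

text \<open>Every member is a combination of two of them, so by the Leibniz rule the gradient of a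
  product of members lies in the span of two fixed gradients, whose cross product is u.\<close>

lemma grad_prod_members:
  assumes "det2 v e = 1" "finite T"
  shows "\<exists>A B. grad (\<Prod>j\<in>T. m (w j)) = A *s grad (m v) + B *s grad (m e)"
  using assms(2)
proof (induction T rule: finite_induct)
  case empty
  show ?case by (intro exI[of _ 0]) simp
next
  case (insert x T)
  then obtain A B where AB: "grad (\<Prod>j\<in>T. m (w j)) = A *s grad (m v) + B *s grad (m e)" by blast
  define Q where "Q = (\<Prod>j\<in>T. m (w j))"
  have "grad (m (w x)) = const3 (det2 (w x) e) *s grad (m v) + const3 (det2 v (w x)) *s grad (m e)"
    by (subst m_combination[OF assms(1)]) (simp add: grad_add grad_mult)
  then have "grad (\<Prod>j\<in>insert x T. m (w j)) = (m (w x) * A + Q * const3 (det2 (w x) e)) *s grad (m v)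
    + (m (w x) * B + Q * const3 (det2 v (w x))) *s grad (m e)"
    using insert AB by (simp add: grad_mult Q_def vec_eq_iff algebra_simps)
  then show ?case by blast
qed

lemma dot_u_grad_F: "dot u (grad F) = 0"
proof -
  obtain e where e: "det2 (w 0) e = 1" using ex_det2_1 w_nonzero[of 0] k by auto
  have u: "u = cross (grad (m (w 0))) (grad (m e))" by (simp add: cross_members e)
  obtain A B where "grad F = A *s grad (m (w 0)) + B *s grad (m e)"
    unfolding F_def using grad_prod_members[OF e] by blast
  then show ?thesis unfolding u by (simp add: dot_add_right dot_scale_right dot_commute[of "cross _ _"])
qed

text \<open>By Euler's relation a common factor divides F. A prime factor of it divides exactly one
  member and not the product of the others, so it would have to divide the gradient of that
  member.\<close>

lemma coprime3_grad_F: "coprime3 (grad F)"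
  unfolding coprime3_def
proof (intro allI impI, rule ccontr)
  fix h assume h: "\<forall>i. h dvd grad F $ i" and nu: "\<not> h dvd 1"
  have "h dvd dot vars (grad F)" unfolding dot_def using h by (intro dvd_sum dvd_mult) auto
  then have hF: "h dvd of_nat (n * k) * F" by (simp only: euler[OF hom_F])
  have unit: "const3 (of_nat (n * k) :: 'b) dvd 1"
    unfolding is_unit_poly3_iff using n_pos k by (intro exI[of _ "of_nat (n * k)"]) auto
  have hF: "h dvd F" using hF unit by (metis const3_of_nat dvd_mult_unit_iff')
  have "h \<noteq> 0" using hF F_nonzero by auto
  then obtain p where p: "irreducible p" "p dvd h" using ex_irreducible_factor nu by blast
  have prime: "prime_elem p" using p(1) by (rule irreducible_imp_prime_elem)
  have "p dvd F" using p hF dvd_trans by blast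
  then obtain i where i: "i < k" "p dvd m (w i)"
    using prime_elem_dvd_prod[OF prime, of "{..<k}"] unfolding F_def by auto
  have nP: "\<not> p dvd P i"
  proof
    assume "p dvd P i"
    then obtain j where "j < k" "j \<noteq> i" "p dvd m (w j)"
      using prime_elem_dvd_prod[OF prime, of "{..<k} - {i}"] unfolding P_def by auto
    then have "p dvd 1" using m_dvd_both[OF w_distinct[of i j]] i by auto
    with p(1) show False by (auto simp: irreducible_def)
  qed
  have "p dvd grad (m (w i)) $ l" for l
  proof -
    have "p dvd grad F $ l" using h p(2) dvd_trans by blast
    moreover have "grad F $ l = m (w i) * grad (P i) $ l + P i * grad (m (w i)) $ l"
      by (simp add: F_split[OF i(1)] grad_mult)
    ultimately have "p dvd P i * grad (m (w i)) $ l"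
      using i(2) by (metis dvd_add_right_iff dvd_mult2)
    then show ?thesis using prime nP prime_elem_dvd_mult_iff by blast
  qed
  then show False using not_dvd_grad_member[OF w_nonzero[OF i(1)] p(1) i(2)] by blast
qed

lemma P_at_zero:
  assumes "i < k" "eval3 (m (w i)) p = 0" "\<not> (eval3 f p = 0 \<and> eval3 g p = 0)"
  shows "eval3 (P i) p \<noteq> 0"
proof
  assume "eval3 (P i) p = 0"
  then obtain j where "j < k" "j \<noteq> i" "eval3 (m (w j)) p = 0" by (auto simp: P_def eval3_prod)
  then show False using m_common_zero[OF assms(2) _ assms(3)] w_distinct assms(1) by metis
qed

lemma zero_F:
  assumes "eval3 F p = 0"
  obtains i where "i < k" "eval3 (m (w i)) p = 0"
  using assms by (auto simp: F_def eval3_prod)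

text \<open>Crossing both sides of the equation for b with grad (m e) turns them into multiples of
  u. Comparing the factors identifies c, up to sign and the factor P i, with the derivative of the
  complementary member along b.\<close>

lemma dot_complement:
  assumes i: "i < k" and e: "det2 (w i) e = 1" and b: "cross u b = c *s grad F"
    and p: "eval3 (m (w i)) p = 0"
  shows "dot (evalv (grad (m e)) p) (evalv b p) = - (eval3 c p * eval3 (P i) p)"
proof -
  let ?v = "grad (m (w i))" and ?e = "grad (m e)"
  have u: "u = cross ?v ?e" by (simp add: cross_members e)
  obtain A B where AB: "grad (P i) = A *s ?v + B *s ?e"
    unfolding P_def using grad_prod_members[OF e, of "{..<k} - {i}"] by blast
  have "grad F = (P i + m (w i) * A) *s ?v + (m (w i) * B) *s ?e"
    by (simp add: F_split[OF i] grad_mult AB vec_eq_iff algebra_simps)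
  then have "cross (grad F) ?e = (P i + m (w i) * A) *s u"
    unfolding u by (simp add: cross_add_left cross_scale_left)
  then have "cross (cross u b) ?e = (c * (P i + m (w i) * A)) *s u"
    by (simp add: b cross_scale_left vector_smult_assoc)
  moreover have "cross u b = dot ?v b *s ?e - dot ?e b *s ?v"
    unfolding u by (rule cross_cross_left)
  then have "cross (cross u b) ?e = (- dot ?e b) *s u"
    unfolding u by (simp add: vec_eq_iff cross_3 algebra_simps)
       (simp add: vec3_simps algebra_simps)
  ultimately have eq: "(- dot ?e b) *s u = (c * (P i + m (w i) * A)) *s u" by simp
  obtain l where "u $ l \<noteq> 0" using u_nonzero by blast
  moreover have "(- dot ?e b) * u $ l = (c * (P i + m (w i) * A)) * u $ l"
    using eq by (metis vector_smult_component)
  ultimately have "- dot ?e b = c * (P i + m (w i) * A)"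
    using mult_right_cancel by blast
  then have "dot ?e b = - (c * (P i + m (w i) * A))" by (metis minus_minus)
  then show ?thesis using p by (simp flip: eval3_dot)
qed

text \<open>Here c = 1 in \<open>dot_complement\<close>, and P i does not vanish at p because p is
  not a base point.\<close>

lemma nonvanishing_partner:
  assumes v: "grad F = cross u v" and p: "p \<noteq> 0" "evalv u p = 0"
  shows "evalv v p \<noteq> 0" "eval3 F p = 0"
proof -
  show F0: "eval3 F p = 0" by (rule eval3_F_0_if_grad) (simp add: v evalv_cross p)
  obtain i where i: "i < k" "eval3 (m (w i)) p = 0" using zero_F[OF F0] .
  obtain e where e: "det2 (w i) e = 1" using ex_det2_1 w_nonzero[OF i(1)] by blast
  have "cross u v = 1 *s grad F" using v by simp
  from dot_complement[OF i(1) e this i(2)] P_at_zero[OF i not_base_if_u_zero[OF p]]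
  show "evalv v p \<noteq> 0" by auto
qed

text \<open>A singular point is never a base point, so the member through it is unique and occurs
  among the factors of F.\<close>

lemma member_dvd_F_if_singular:
  assumes "v \<noteq> 0" "p \<noteq> 0" "evalv (grad (m v)) p = 0" "eval3 F p = 0"
  shows "m v dvd F"
proof -
  have z: "evalv u p = 0" "eval3 (m v) p = 0" using zero_of_singular_member[OF assms(1,3)] .
  obtain i where i: "i < k" "eval3 (m (w i)) p = 0" using zero_F[OF assms(4)] .
  have "det2 (w i) v = 0" using m_common_zero[OF i(2) z(2)] not_base_if_u_zero[OF assms(2) z(1)] by blast
  then have d: "det2 v (w i) = 0" by (simp add: det2_def algebra_simps)
  obtain c where "m (w i) = const3 c * m v" using m_parallel[OF d assms(1)] by metis
  then show ?thesis using F_split[OF i(1)] by simp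
qed

text \<open>Elimination puts a product of lines in the span of a and a' into the Jacobian ideal.
  Those not proportional to a do not vanish at p, because a' does not, and they are collected in
  s.\<close>

lemma local_power:
  assumes p: "p \<noteq> 0" and a: "dot a p = 0" "a \<noteq> 0"
  obtains s r N where "eval3 s p \<noteq> 0" "s * lin a ^ N = dot r (grad F)"
proof -
  obtain j where j: "p $ j \<noteq> 0" using p by (auto simp: vec_eq_iff)
  define a' where "a' = (axis j 1 :: 'b ^ 3)"
  have a': "dot a' p \<noteq> 0" using j by (simp add: a'_def dot_axis)
  have ab: "cross a a' \<noteq> 0"
  proof
    assume "cross a a' = 0"
    then obtain l where "a' = l *s a" using parallel_field a(2) by blast
    then show False using a a' by (simp add: dot_scale_left)
  qed
  have d1: "n * k - 1 \<ge> 1" using nk by simp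
  obtain c c' where c: "dot (\<chi> i. const3 (c $ i)) (grad F) \<noteq> 0" "dot (\<chi> i. const3 (c' $ i)) (grad F) \<noteq> 0"
    "coprime (dot (\<chi> i. const3 (c $ i)) (grad F)) (dot (\<chi> i. const3 (c' $ i)) (grad F))"
    using coprime3_two[OF coprime3_grad_F homogeneous_grad[OF hom_F] d1] by metis
  note U = homogeneous_const_dot[of _ "grad F", OF homogeneous_grad[OF hom_F]]
  obtain qs A B where qs: "(\<Prod>q\<leftarrow>qs. lin q) = A * dot (\<chi> i. const3 (c $ i)) (grad F) + B * dot (\<chi> i. const3 (c' $ i)) (grad F)"
    "\<And>q. q \<in> set qs \<Longrightarrow> q \<noteq> 0 \<and> (\<exists>x y. q = x *s a + y *s a')"
    using elimination[OF U[of c] c(1) U[of c'] c(2) c(3) ab] by metis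
  have "\<exists>s N. (\<Prod>q\<leftarrow>qs. lin q) = s * lin a ^ N \<and> eval3 s p \<noteq> 0"
    using qs(2)
  proof (induction qs)
    case Nil
    show ?case by (intro exI[of _ 1] exI[of _ 0]) simp
  next
    case (Cons q qs)
    then obtain s N where s: "(\<Prod>q\<leftarrow>qs. lin q) = s * lin a ^ N" "eval3 s p \<noteq> 0" by fastforce
    obtain x y where q: "q \<noteq> 0" "q = x *s a + y *s a'" using Cons.prems[of q] by auto
    show ?case
    proof (cases "y = 0")
      case True
      then have "x \<noteq> 0" using q by auto
      have "(\<Prod>q\<leftarrow>q # qs. lin q) = (const3 x * s) * lin a ^ Suc N"
        using True q s by (simp add: lin_scale mult_ac)
      then show ?thesis using \<open>x \<noteq> 0\<close> s by (intro exI[of _ "const3 x * s"] exI[of _ "Suc N"]) simp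
    next
      case False
      have "(\<Prod>q\<leftarrow>q # qs. lin q) = (lin q * s) * lin a ^ N" using s by (simp add: mult_ac)
      moreover have "eval3 (lin q * s) p \<noteq> 0"
        using False s a' a q by (simp add: dot_add_left dot_scale_left)
      ultimately show ?thesis by blast
    qed
  qed
  then obtain s N where s: "(\<Prod>q\<leftarrow>qs. lin q) = s * lin a ^ N" "eval3 s p \<noteq> 0" by blast
  have "s * lin a ^ N = dot (A *s (\<chi> i. const3 (c $ i)) + B *s (\<chi> i. const3 (c' $ i))) (grad F)"
    unfolding s(1)[symmetric] qs(1) by (simp add: dot_add_left dot_scale_left)
  with s that show ?thesis by blast
qed

lemma grad_lin: "grad (lin a) = (\<chi> i. const3 (a $ i))"
  by (simp add: vec3_eq_iff lin_def dot_3 vars_3 grad_add grad_mult grad_mon const3_mon mon_mult)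

text \<open>The derivation \<open>b\<close> of \<open>F\<close> preserves the Jacobian ideal, which locally at \<open>p\<close> contains a
  power of a linear form \<open>lin a\<close> vanishing at \<open>p\<close>. If \<open>b\<close> did not vanish on \<open>lin a\<close> at \<open>p\<close>, the
  exponent could be lowered down to zero (characteristic zero), but \<open>p\<close> is singular.\<close>

lemma no_transversal_derivation:
  assumes p: "p \<noteq> 0" "evalv (grad F) p = 0" and b: "dot b (grad F) = 0"
  shows "cross (evalv b p) p = 0"
proof (rule ccontr)
  assume nz: "cross (evalv b p) p \<noteq> 0"
  from nz obtain a where a: "dot a p = 0" "dot a (evalv b p) \<noteq> 0" by (rule ex_separating_covector)
  then have "a \<noteq> 0" by auto
  define Q where "Q N \<longleftrightarrow> (\<exists>s r. eval3 s p \<noteq> 0 \<and> s * lin a ^ N = dot r (grad F))" for N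
  have "\<exists>N. Q N" using local_power[OF p(1) a(1) \<open>a \<noteq> 0\<close>] unfolding Q_def by metis
  define N where "N = (LEAST N. Q N)"
  have QN: "Q N" and least: "\<And>M. Q M \<Longrightarrow> N \<le> M"
    using \<open>\<exists>N. Q N\<close> unfolding N_def by (auto intro: LeastI_ex Least_le)
  obtain s r where s: "eval3 s p \<noteq> 0" "s * lin a ^ N = dot r (grad F)" using QN unfolding Q_def by blast
  show False
  proof (cases N)
    case 0
    then have "eval3 s p = eval3 (dot r (grad F)) p" using s(2) by simp
    then show False using s(1) p(2) by (simp add: eval3_dot)
  next
    case (Suc M)
    define D where "D H = dot b (grad H)" for H
    obtain r' where r': "D (s * lin a ^ N) = dot r' (grad F)"
      unfolding s(2) D_def using dot_grad_jacobian[OF b] by blast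
    have Dpow: "D (lin a ^ Suc L) = of_nat (Suc L) * lin a ^ L * D (lin a)" for L
    proof (induction L)
      case (Suc L)
      have "D (lin a ^ Suc (Suc L)) = lin a * D (lin a ^ Suc L) + lin a ^ Suc L * D (lin a)"
        unfolding D_def power_Suc[of _ "Suc L"] by (simp only: grad_mult dot_add_right dot_scale_right)
      then show ?case unfolding Suc by (simp add: algebra_simps)
    qed simp
    have Ds: "D (s * lin a ^ N) = s * D (lin a ^ N) + lin a ^ N * D s"
      by (simp add: D_def grad_mult dot_add_right dot_scale_right)
    \<comment> \<open>Multiplying by s and subtracting D s times the relation cancels the term in
      which D falls on s. What is left is N s^2 D(lin a) times the next lower power of
      \<open>lin a\<close>.\<close>
    define s' where "s' = of_nat N * s * s * D (lin a)"
    have "s * D (s * lin a ^ N) - D s * (s * lin a ^ N) = s * s * D (lin a ^ N)"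
      unfolding Ds by (simp add: algebra_simps)
    then have "s' * lin a ^ M = s * D (s * lin a ^ N) - D s * (s * lin a ^ N)"
      unfolding s'_def Suc Dpow by (simp only: mult_ac)
    also have "\<dots> = s * dot r' (grad F) - D s * (s * lin a ^ N)" by (simp only: r')
    also have "\<dots> = dot (s *s r' - D s *s r) (grad F)"
      unfolding s(2) by (simp add: dot_commute[of _ "grad F"] dot_diff_right dot_scale_right)
    finally have e: "s' * lin a ^ M = dot (s *s r' - D s *s r) (grad F)" .
    have "eval3 (D (lin a)) p = dot a (evalv b p)"
      by (simp add: D_def eval3_dot grad_lin dot_commute) (simp add: dot_def mult.commute)
    then have "eval3 s' p \<noteq> 0"
      using a s(1) Suc by (simp add: s'_def del: of_nat_Suc flip: const3_of_nat)
    with e have "Q M" unfolding Q_def by blast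
    from least[OF this] Suc show False by simp
  qed
qed

text \<open>Both u and b are orthogonal to grad F, so their cross product is c grad F; this c is the
  multiplier sought.\<close>

lemma local_solution:
  assumes p: "p \<noteq> 0" "evalv u p = 0" "eval3 F p = 0"
    and b: "\<And>i. homogeneous d (b $ i)" "dot b (grad F) = 0" "evalv b p \<noteq> 0"
  shows "\<exists>q e v. homogeneous e q \<and> eval3 q p \<noteq> 0 \<and> q *s grad F = cross u v"
proof -
  have "cross (cross u b) (grad F) = 0"
    using dot_u_grad_F b(2) by (simp add: cross_cross_left)
  then obtain c where c: "cross u b = c *s grad F"
    using parallel_coprime3[OF _ coprime3_grad_F] by metis
  obtain j where j: "grad F $ j \<noteq> 0" using coprime3_nonzero[OF coprime3_grad_F] by blast
  have hj: "homogeneous (2 * n - 2 + d) (cross u b $ j)"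
    using exhaust_3[of j] by (auto simp: cross_3 intro!: homogeneous_diff homogeneous_mult hom_u b(1))
  obtain i where i: "i < k" "eval3 (m (w i)) p = 0" using zero_F[OF p(3)] .
  note nb = not_base_if_u_zero[OF p(1,2)]
  have P: "eval3 (P i) p \<noteq> 0" using P_at_zero[OF i nb] .
  obtain e where e: "det2 (w i) e = 1" using ex_det2_1 w_nonzero[OF i(1)] by blast
  note dc = dot_complement[OF i(1) e c i(2)]
  \<comment> \<open>The member through p is singular there, so grad F vanishes at p and b(p) is
    proportional to p. If c(p) = 0, then \<open>dot_complement\<close> and Euler's relation make the
    complementary member vanish at p as well, which forces p to be a base point.\<close>
  have "eval3 c p \<noteq> 0"
  proof
    assume c0: "eval3 c p = 0"
    obtain v where v: "v \<noteq> 0" "evalv (grad (m v)) p = 0" using singular_member_of_zero[OF p(2)] .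
    have "eval3 (m v) p = 0" using zero_of_singular_member[OF v] by blast
    then have "det2 v (w i) = 0" using m_common_zero i(2) nb by blast
    then obtain l where "w i = l *s v" using m_parallel v(1) by metis
    then have "m (w i) = const3 l * m v" by (simp add: m_scale)
    then have "evalv (grad (m (w i))) p = 0" using v(2) by (simp add: grad_mult evalv_scale vec_eq_iff)
    then have "evalv (grad F) p = 0" using i(2)
      by (simp add: F_split[OF i(1)] grad_mult vec_eq_iff)
    from no_transversal_derivation[OF p(1) this b(2)] obtain l where l: "p = l *s evalv b p"
      using parallel_field b(3) by metis
    have "dot (evalv (grad (m e)) p) (evalv b p) = 0" using dc c0 by simp
    then have "dot (evalv (grad (m e)) p) p = 0" by (subst (2) l) (simp add: dot_scale_right)
    then have "of_nat n * eval3 (m e) p = 0" by (simp add: dot_commute[of _ p] dot_evalv_grad[OF hom_m])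
    then have "eval3 (m e) p = 0" using n_pos by simp
    from m_common_zero[OF i(2) this nb] e show False by simp
  qed
  moreover have "\<exists>e. homogeneous e c"
  proof (rule ccontr)
    assume no: "\<not> ?thesis"
    then have "c \<noteq> 0" by auto
    then show False using no homogeneous_factors[of "2 * n - 2 + d" c "grad F $ j"] hj j c
      by (metis mult_eq_0_iff vector_smult_component)
  qed
  ultimately show ?thesis using c by metis
qed

theorem ex_partner:
  assumes "\<And>p. p \<noteq> 0 \<Longrightarrow> evalv u p = 0 \<Longrightarrow>
    eval3 F p = 0 \<and> (\<exists>d b. (\<forall>i. homogeneous d (b $ i)) \<and> dot b (grad F) = 0 \<and> evalv b p \<noteq> 0)"
  obtains v where "grad F = cross u v"
proof (rule local_to_global[OF hom_u coprime3_u dot_u_grad_F])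
  fix p assume p: "p \<noteq> 0" "evalv u p = 0"
  then obtain d b where "eval3 F p = 0" "\<And>i. homogeneous d (b $ i)" "dot b (grad F) = 0" "evalv b p \<noteq> 0"
    using assms by blast
  from local_solution[OF p this] show "\<exists>q e v. homogeneous e q \<and> eval3 q p \<noteq> 0 \<and> q *s grad F = cross u v" .
qed (use that in blast)

end

section \<open>Sections over open subsets of the projective plane\<close>

text \<open>An elementary form of the ideals of HOL-Algebra; \<open>ideal_type_algebra_iff\<close>
  links the two.\<close>

definition is_ideal :: "'r::comm_ring_1 set \<Rightarrow> bool" where
  "is_ideal I \<longleftrightarrow> 0 \<in> I \<and> (\<forall>a\<in>I. \<forall>b\<in>I. a + b \<in> I) \<and> (\<forall>a\<in>I. \<forall>r. r * a \<in> I)"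

lemma is_idealD:
  assumes "is_ideal I"
  shows "0 \<in> I" "a \<in> I \<Longrightarrow> b \<in> I \<Longrightarrow> a + b \<in> I" "a \<in> I \<Longrightarrow> r * a \<in> I" "a \<in> I \<Longrightarrow> a * r \<in> I"
    "a \<in> I \<Longrightarrow> - a \<in> I" "a \<in> I \<Longrightarrow> b \<in> I \<Longrightarrow> a - b \<in> I"
proof -
  show *: "0 \<in> I" "a \<in> I \<Longrightarrow> b \<in> I \<Longrightarrow> a + b \<in> I" "a \<in> I \<Longrightarrow> r * a \<in> I" for a b r
    using assms by (auto simp: is_ideal_def)
  show "a \<in> I \<Longrightarrow> a * r \<in> I" using *(3)[of a r] by (simp add: mult.commute)
  show m: "a \<in> I \<Longrightarrow> - a \<in> I" for a using *(3)[of a "- 1"] by simp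
  show "a \<in> I \<Longrightarrow> b \<in> I \<Longrightarrow> a - b \<in> I" using *(2)[of a "- b"] m[of b] by simp
qed

lemma is_ideal_sum: "is_ideal I \<Longrightarrow> (\<And>t. t \<in> T \<Longrightarrow> h t \<in> I) \<Longrightarrow> sum h T \<in> I"
  by (induction T rule: infinite_finite_induct) (auto simp: is_idealD)

lemma type_algebra_simps:
  "carrier ring_of_type_algebra = UNIV" "monoid.mult ring_of_type_algebra = (*)"
  "monoid.one ring_of_type_algebra = 1" "ring.zero ring_of_type_algebra = 0"
  "ring.add ring_of_type_algebra = (+)"
  by (simp_all add: ring_of_type_algebra_def)

lemma ideal_type_algebra_iff:
  fixes I :: "'r::comm_ring_1 set"
  shows "ideal I ring_of_type_algebra \<longleftrightarrow> is_ideal I"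
proof
  assume "ideal I ring_of_type_algebra"
  then interpret ideal I ring_of_type_algebra .
  show "is_ideal I"
    using additive_subgroup.zero_closed[OF is_additive_subgroup]
      additive_subgroup.a_closed[OF is_additive_subgroup] I_l_closed
    by (auto simp: is_ideal_def type_algebra_simps)
next
  assume I: "is_ideal I"
  have R: "ring (ring_of_type_algebra :: 'r ring)" by (rule ring_from_type_algebra)
  interpret ring "ring_of_type_algebra :: 'r ring" by (rule R)
  have neg: "\<ominus>\<^bsub>ring_of_type_algebra\<^esub> a = - a" for a :: 'r
    by (rule minus_equality) (simp_all add: type_algebra_simps)
  have ne: "I \<noteq> {}" using is_idealD(1)[OF I] by blast
  show "ideal I ring_of_type_algebra"
  proof (rule idealI[OF R])
    show "subgroup I (add_monoid ring_of_type_algebra)"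
      using I neg ne by (intro add.subgroupI) (auto simp: is_idealD type_algebra_simps a_inv_def[symmetric])
  qed (use I in \<open>auto simp: is_idealD type_algebra_simps\<close>)
qed

lemma primeideal_type_algebra_iff:
  fixes I :: "'r::comm_ring_1 set"
  shows "primeideal I ring_of_type_algebra \<longleftrightarrow>
    is_ideal I \<and> 1 \<notin> I \<and> (\<forall>a b. a * b \<in> I \<longrightarrow> a \<in> I \<or> b \<in> I)"
proof
  assume "primeideal I ring_of_type_algebra"
  then interpret primeideal I ring_of_type_algebra .
  have I: "is_ideal I" using ideal_type_algebra_iff is_ideal by blast
  moreover have "1 \<notin> I"
  proof
    assume "1 \<in> I"
    then have "r \<in> I" for r using is_idealD(3)[OF I, of 1 r] by simp
    then show False using I_notcarr by (auto simp: type_algebra_simps)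
  qed
  ultimately show "is_ideal I \<and> 1 \<notin> I \<and> (\<forall>a b. a * b \<in> I \<longrightarrow> a \<in> I \<or> b \<in> I)"
    using I_prime by (auto simp: type_algebra_simps)
next
  assume "is_ideal I \<and> 1 \<notin> I \<and> (\<forall>a b. a * b \<in> I \<longrightarrow> a \<in> I \<or> b \<in> I)"
  then show "primeideal I ring_of_type_algebra"
    using cring_from_type_algebra[where 'a = 'r]
    by (intro primeidealI) (auto simp: ideal_type_algebra_iff type_algebra_simps)
qed

lemma genideal_type_algebra:
  fixes A :: "'r::comm_ring_1 set"
  shows "genideal ring_of_type_algebra A = \<Inter>{I. is_ideal I \<and> A \<subseteq> I}"
  by (simp add: genideal_def ideal_type_algebra_iff)

lemma homogeneous_ideal_iff:
  "homogeneous_ideal I \<longleftrightarrow> is_ideal I \<and>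
    (\<forall>J. is_ideal J \<longrightarrow> {F \<in> I. \<exists>d. homogeneous d F} \<subseteq> J \<longrightarrow> I \<subseteq> J)"
  unfolding homogeneous_ideal_def ideal_type_algebra_iff genideal_type_algebra by blast

lemma homogeneous_ideal_if_hpart:
  assumes I: "is_ideal I" and h: "\<And>F d. F \<in> I \<Longrightarrow> hpart d F \<in> I"
  shows "homogeneous_ideal I"
  unfolding homogeneous_ideal_iff
proof (intro conjI I allI impI subsetI)
  fix J F assume J: "is_ideal J" "{F \<in> I. \<exists>d. homogeneous d F} \<subseteq> J" and F: "F \<in> I"
  obtain N where N: "F = (\<Sum>d\<le>N. hpart d F)" by (rule sum_hpart)
  have "hpart d F \<in> J" for d using J(2) h[OF F] homogeneous_hpart by blast
  then show "F \<in> J" by (subst N) (rule is_ideal_sum[OF J(1)])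
qed

lemma homogeneous_ideal_0: "homogeneous_ideal {0}"
  by (rule homogeneous_ideal_if_hpart) (auto simp: is_ideal_def)

text \<open>A prime omits some element of b I iff it omits b and some element of I, so b I defines
  the part of an open set where b does not vanish. Generation by homogeneous elements is inherited
  through the ideal quotient of J by b.\<close>

lemma homogeneous_ideal_times:
  assumes I: "homogeneous_ideal I" and b: "homogeneous e b"
  shows "homogeneous_ideal ((*) b ` I)"
  unfolding homogeneous_ideal_iff
proof (intro conjI allI impI subsetI)
  have I': "is_ideal I" using I by (simp add: homogeneous_ideal_iff)
  show "is_ideal ((*) b ` I)"
    unfolding is_ideal_def
  proof (intro conjI ballI allI)
    show "0 \<in> (*) b ` I" using is_idealD(1)[OF I'] by force
    fix x assume "x \<in> (*) b ` I"
    then obtain a where a: "a \<in> I" "x = b * a" by auto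
    show "r * x \<in> (*) b ` I" for r
    proof -
      have "r * x = b * (r * a)" by (simp add: a mult.left_commute)
      then show ?thesis using is_idealD(3)[OF I' a(1), of r] by blast
    qed
    fix y assume "y \<in> (*) b ` I"
    then obtain a' where "a' \<in> I" "y = b * a'" by auto
    then show "x + y \<in> (*) b ` I"
      using is_idealD(2)[OF I' a(1)] a(2) by (intro image_eqI[of _ _ "a + a'"]) (auto simp: algebra_simps)
  qed
  fix J x assume J: "is_ideal J" "{F \<in> (*) b ` I. \<exists>d. homogeneous d F} \<subseteq> J" and x: "x \<in> (*) b ` I"
  have "is_ideal {F. b * F \<in> J}" using J(1) by (auto simp: is_ideal_def algebra_simps)
  moreover have "{F \<in> I. \<exists>d. homogeneous d F} \<subseteq> {F. b * F \<in> J}"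
    using J(2) homogeneous_mult[OF b] by blast
  ultimately have "I \<subseteq> {F. b * F \<in> J}" using I unfolding homogeneous_ideal_iff by blast
  with x show "x \<in> J" by auto
qed

lemma homogeneous_ideal_UNIV: "homogeneous_ideal UNIV"
  by (rule homogeneous_ideal_if_hpart) (auto simp: is_ideal_def)

lemma proj_plane_iff:
  "p \<in> proj_plane \<longleftrightarrow> is_ideal p \<and> 1 \<notin> p \<and> (\<forall>a b. a * b \<in> p \<longrightarrow> a \<in> p \<or> b \<in> p) \<and>
    homogeneous_ideal p \<and> \<not> irrelevant_ideal \<subseteq> p"
  by (auto simp: proj_plane_def primeideal_type_algebra_iff)

lemma proj_plane_mult: "p \<in> proj_plane \<Longrightarrow> a \<notin> p \<Longrightarrow> b \<notin> p \<Longrightarrow> a * b \<notin> p"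
  by (auto simp: proj_plane_iff)

lemma proj_plane_power: "p \<in> proj_plane \<Longrightarrow> a \<notin> p \<Longrightarrow> a ^ m \<notin> p"
  by (induction m) (auto simp: proj_plane_iff)

lemma proj_plane_ideal: "p \<in> proj_plane \<Longrightarrow> is_ideal p"
  by (simp add: proj_plane_iff)

lemma proj_plane_unit: "p \<in> proj_plane \<Longrightarrow> b dvd 1 \<Longrightarrow> b \<notin> p"
  unfolding proj_plane_iff by (metis dvd_def is_idealD(4))

lemma proj_plane_const3: "p \<in> proj_plane \<Longrightarrow> c \<noteq> 0 \<Longrightarrow> const3 c \<notin> p"
  by (rule proj_plane_unit) (auto simp: is_unit_poly3_iff)

lemma irrelevant_ideal_subset:
  fixes p :: "'a::field poly3 set"
  assumes p: "is_ideal p" and v: "\<And>i. vars $ i \<in> p"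
  shows "irrelevant_ideal \<subseteq> p"
proof
  fix F :: "'a poly3" assume F: "F \<in> irrelevant_ideal"
  obtain N where N: "F = (\<Sum>d\<le>N. hpart d F)" by (rule sum_hpart)
  have "hpart d F \<in> p" for d
  proof (cases d)
    case 0
    have "hpart 0 F = 0"
      using F by (intro coeff3_ext) (simp add: coeff3_hpart irrelevant_ideal_def)
    then show ?thesis using p 0 by (simp add: is_idealD)
  next
    case (Suc e)
    from homogeneous_hpart[of d F] show ?thesis
    proof (induction rule: homogeneous_induct)
      case (mon c i j k)
      then consider "i > 0" | "j > 0" | "k > 0" using Suc by fastforce
      then show ?case
      proof cases
        case 1
        then have "mon c i j k = mon c (i - 1) j k * vars $ 1" by (simp add: vars_3 mon_mult)
        then show ?thesis using is_idealD(3)[OF p v[of 1]] by simp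
      next
        case 2
        then have "mon c i j k = mon c i (j - 1) k * vars $ 2" by (simp add: vars_3 mon_mult)
        then show ?thesis using is_idealD(3)[OF p v[of 2]] by simp
      next
        case 3
        then have "mon c i j k = mon c i j (k - 1) * vars $ 3" by (simp add: vars_3 mon_mult)
        then show ?thesis using is_idealD(3)[OF p v[of 3]] by simp
      qed
    qed (simp add: is_idealD p)
  qed
  then show "F \<in> p" by (subst N) (rule is_ideal_sum[OF p])
qed

lemma proj_plane_var: "p \<in> proj_plane \<Longrightarrow> \<exists>i. vars $ i \<notin> p"
  using irrelevant_ideal_subset by (auto simp: proj_plane_iff)

lemma generic_point: "{0} \<in> (proj_plane :: 'a::field poly3 set set)"
proof -
  have "vars $ 1 \<in> irrelevant_ideal" by (simp add: irrelevant_ideal_def vars_3 coeff3_mon)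
  moreover have "vars $ 1 \<noteq> (0 :: 'a poly3)" by (rule vars_nonzero)
  ultimately have "\<not> irrelevant_ideal \<subseteq> {0 :: 'a poly3}" by blast
  then show ?thesis
    unfolding proj_plane_iff using homogeneous_ideal_0 by (auto simp: is_ideal_def)
qed

lemma zariski_open_subset: "zariski_open U \<Longrightarrow> U \<subseteq> proj_plane"
  by (auto simp: zariski_open_def)

text \<open>An ideal not contained in p is nonzero, so it is not contained in the generic point {0}
  either. Sections will be identified with their values there.\<close>

lemma zariski_open_generic:
  assumes "zariski_open U" "p \<in> U"
  shows "{0} \<in> U"
proof -
  obtain I where I: "homogeneous_ideal I" "U = {p \<in> proj_plane. \<not> I \<subseteq> p}"
    using assms(1) by (auto simp: zariski_open_def)
  have "0 \<in> p" using assms I proj_plane_ideal is_idealD(1) by blast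
  then have "\<not> I \<subseteq> {0}" using assms(2) I by auto
  then show ?thesis using I generic_point by blast
qed

lemma zariski_open_basic:
  assumes U: "zariski_open U" and b: "homogeneous e b"
  shows "zariski_open {p \<in> U. b \<notin> p}"
proof -
  obtain I where I: "homogeneous_ideal I" "U = {p \<in> proj_plane. \<not> I \<subseteq> p}"
    using U by (auto simp: zariski_open_def)
  have "{p \<in> U. b \<notin> p} = {p \<in> proj_plane. \<not> (*) b ` I \<subseteq> p}"
  proof (intro subset_antisym subsetI)
    fix p assume p: "p \<in> {p \<in> U. b \<notin> p}"
    then obtain a where "a \<in> I" "a \<notin> p" using I by auto
    then show "p \<in> {p \<in> proj_plane. \<not> (*) b ` I \<subseteq> p}" using p I proj_plane_mult by blast
  next
    fix p assume p: "p \<in> {p \<in> proj_plane. \<not> (*) b ` I \<subseteq> p}"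
    then obtain a where "a \<in> I" "b * a \<notin> p" by auto
    then show "p \<in> {p \<in> U. b \<notin> p}" using p I proj_plane_ideal[of p] is_idealD(3,4)[of p] by blast
  qed
  then show ?thesis using homogeneous_ideal_times[OF I(1) b] unfolding zariski_open_def by blast
qed

lemma zariski_open_proj_plane: "zariski_open proj_plane"
proof -
  have "\<not> UNIV \<subseteq> p" if "p \<in> proj_plane" for p :: "'a::field poly3 set"
    using proj_plane_unit[OF that, of 1] by auto
  then show ?thesis
    unfolding zariski_open_def using homogeneous_ideal_UNIV by (intro exI[of _ UNIV]) blast
qed

text \<open>The part of degree m of the homogeneous localization at p, seen inside the fraction
  field of S.\<close>

definition regular :: "int \<Rightarrow> 'a::field poly3 set \<Rightarrow> 'a poly3 fract \<Rightarrow> bool" where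
  "regular m p x \<longleftrightarrow> (\<exists>a b d e. homogeneous d a \<and> homogeneous e b \<and> int d = int e + m \<and> b \<notin> p \<and>
    x = to_fract a / to_fract b)"

text \<open>Every neighbourhood on which a section is one fraction contains the generic point, so
  all values agree with the value there, and the local condition becomes regularity of one element
  at every point of U.\<close>

lemma twist_iff:
  assumes U: "zariski_open U"
  shows "s \<in> twist m U \<longleftrightarrow> (\<forall>p. p \<notin> U \<longrightarrow> s p = 0) \<and> (\<forall>p\<in>U. s p = s {0} \<and> regular m p (s {0}))"
proof
  assume s: "s \<in> twist m U"
  have "s p = s {0} \<and> regular m p (s {0})" if p: "p \<in> U" for p
  proof -
    obtain V a b d e where V: "zariski_open V" "p \<in> V" "V \<subseteq> U" "homogeneous d a" "homogeneous e b"
      "int d = int e + m" "\<forall>q\<in>V. b \<notin> q \<and> s q = to_fract a / to_fract b"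
      using s p unfolding twist_def by blast
    then show ?thesis using zariski_open_generic[OF V(1,2)] unfolding regular_def by metis
  qed
  then show "(\<forall>p. p \<notin> U \<longrightarrow> s p = 0) \<and> (\<forall>p\<in>U. s p = s {0} \<and> regular m p (s {0}))"
    using s unfolding twist_def by blast
next
  assume *: "(\<forall>p. p \<notin> U \<longrightarrow> s p = 0) \<and> (\<forall>p\<in>U. s p = s {0} \<and> regular m p (s {0}))"
  have "\<exists>V a b d e. zariski_open V \<and> p \<in> V \<and> V \<subseteq> U \<and> homogeneous d a \<and> homogeneous e b \<and>
      int d = int e + m \<and> (\<forall>q\<in>V. b \<notin> q \<and> s q = to_fract a / to_fract b)" if p: "p \<in> U" for p
  proof -
    obtain a b d e where ab: "homogeneous d a" "homogeneous e b" "int d = int e + m" "b \<notin> p"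
      "s {0} = to_fract a / to_fract b" using * p unfolding regular_def by blast
    show ?thesis
      by (rule exI[of _ "{p \<in> U. b \<notin> p}"], rule exI[of _ a], rule exI[of _ b], rule exI[of _ d], rule exI[of _ e])
         (use ab p * zariski_open_basic[OF U ab(2)] in auto)
  qed
  with * show "s \<in> twist m U" unfolding twist_def by blast
qed

lemma regular_0: "p \<in> proj_plane \<Longrightarrow> regular m p 0"
proof -
  assume p: "p \<in> proj_plane"
  obtain i where i: "vars $ i \<notin> p" using proj_plane_var[OF p] by blast
  \<comment> \<open>Degrees are natural numbers, so for negative m even the fraction 0 needs a
    denominator of degree at least |m|. The degrees chosen are |m| + m and |m|.\<close>
  have "homogeneous (nat \<bar>m\<bar> * 1) (vars $ i ^ nat \<bar>m\<bar>)" by (intro homogeneous_power homogeneous_vars)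
  then show ?thesis unfolding regular_def
    by (intro exI[of _ 0] exI[of _ "vars $ i ^ nat \<bar>m\<bar>"] exI[of _ "nat (\<bar>m\<bar> + m)"] exI[of _ "nat \<bar>m\<bar>"])
       (use proj_plane_power[OF p i] in auto)
qed

lemma notin_ideal_nonzero: "p \<in> proj_plane \<Longrightarrow> b \<notin> p \<Longrightarrow> b \<noteq> 0"
  using is_idealD(1) proj_plane_ideal by blast

lemma regular_add:
  assumes p: "p \<in> proj_plane" and "regular m p x" "regular m p y"
  shows "regular m p (x + y)"
proof -
  obtain a b d e where x: "homogeneous d a" "homogeneous e b" "int d = int e + m" "b \<notin> p"
      "x = to_fract a / to_fract b" using assms unfolding regular_def by blast
  obtain a' b' d' e' where y: "homogeneous d' a'" "homogeneous e' b'" "int d' = int e' + m" "b' \<notin> p"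
      "y = to_fract a' / to_fract b'" using assms unfolding regular_def by blast
  have nz: "b \<noteq> 0" "b' \<noteq> 0" using x y notin_ideal_nonzero[OF p] by auto
  have "d' + e = d + e'" using x y by linarith
  then have "homogeneous (d + e') (a * b' + a' * b)"
    using homogeneous_mult[OF x(1) y(2)] homogeneous_mult[OF y(1) x(2)] by (intro homogeneous_add) auto
  moreover have "x + y = to_fract (a * b' + a' * b) / to_fract (b * b')"
    using nz x y by (simp add: field_simps)
  moreover have "int (d + e') = int (e + e') + m" using x by simp
  ultimately show ?thesis unfolding regular_def
    using homogeneous_mult[OF x(2) y(2)] proj_plane_mult[OF p x(4) y(4)] by blast
qed

lemma regular_mult:
  assumes p: "p \<in> proj_plane" and "regular m p x" "regular m' p y"
  shows "regular (m + m') p (x * y)"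
proof -
  obtain a b d e where x: "homogeneous d a" "homogeneous e b" "int d = int e + m" "b \<notin> p"
      "x = to_fract a / to_fract b" using assms unfolding regular_def by blast
  obtain a' b' d' e' where y: "homogeneous d' a'" "homogeneous e' b'" "int d' = int e' + m'" "b' \<notin> p"
      "y = to_fract a' / to_fract b'" using assms unfolding regular_def by blast
  have "x * y = to_fract (a * a') / to_fract (b * b')" using x y by simp
  moreover have "int (d + d') = int (e + e') + (m + m')" using x y by simp
  ultimately show ?thesis unfolding regular_def
    using homogeneous_mult[OF x(1) y(1)] homogeneous_mult[OF x(2) y(2)] proj_plane_mult[OF p x(4) y(4)] by blast
qed

lemma regular_polynomial:
  assumes "p \<in> proj_plane" "homogeneous d a"
  shows "regular (int d) p (to_fract a)"
  unfolding regular_def using assms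
  by (intro exI[of _ a] exI[of _ 1] exI[of _ d] exI[of _ 0]) (auto simp: proj_plane_iff)

lemma regular_inverse:
  assumes "homogeneous d a" "a \<notin> p"
  shows "regular (- int d) p (1 / to_fract a)"
  unfolding regular_def using assms
  by (intro exI[of _ 1] exI[of _ a] exI[of _ 0] exI[of _ d]) auto

text \<open>The contraction to S of the prime ideal generated by r over the closure. It cannot
  contain all the variables, because r has a nonzero vector as a zero.\<close>

lemma proj_plane_contraction:
  fixes r :: "'a::field_char_0 alg_closure poly3"
  assumes r: "homogeneous e r" "irreducible r"
  shows "{Q. r dvd lift3 Q} \<in> proj_plane"
proof -
  let ?p = "{Q. r dvd lift3 Q}"
  have prime: "prime_elem r" using r(2) by (rule irreducible_imp_prime_elem)
  have nz: "r \<noteq> 0" "\<not> r dvd 1" using r(2) by (auto simp: irreducible_def)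
  have "e \<ge> 1" using homogeneous_unit_iff[OF r(1) nz(1)] nz(2) by (cases e) auto
  have id: "is_ideal ?p" by (auto simp: is_ideal_def)
  have "homogeneous_ideal ?p"
  proof (rule homogeneous_ideal_if_hpart[OF id])
    fix Q d assume "Q \<in> ?p"
    then obtain R where R: "lift3 Q = r * R" by (auto simp: dvd_def)
    have "lift3 (hpart d Q) = hpart d (lift3 Q)"
      by (rule coeff3_ext) (simp add: coeff3_lift3 coeff3_hpart)
    then show "hpart d Q \<in> ?p" by (simp add: R hpart_mult_homogeneous[OF r(1)])
  qed
  moreover have "\<not> irrelevant_ideal \<subseteq> ?p"
  proof
    assume sub: "irrelevant_ideal \<subseteq> ?p"
    obtain v :: "nat \<Rightarrow> 'a alg_closure ^ 3" where v: "\<And>i. v i \<noteq> 0" "\<And>i. eval3 r (v i) = 0"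
      using form_zeros[OF r(1) \<open>e \<ge> 1\<close> nz(1)] by metis
    have "v 0 $ i = 0" for i
    proof -
      have "vars $ i \<in> (irrelevant_ideal :: 'a poly3 set)"
        using exhaust_3[of i] by (auto simp: irrelevant_ideal_def vars_3 coeff3_mon)
      then have "r dvd lift3 (vars $ i :: 'a poly3)" using sub by blast
      then have "eval3 (lift3 (vars $ i :: 'a poly3)) (v 0) = 0" using eval3_dvd v(2) by blast
      moreover have "lift3 (vars $ i :: 'a poly3) = vars $ i"
        using exhaust_3[of i] by (auto simp: vars_3 lift3_mon)
      ultimately show ?thesis by simp
    qed
    then show False using v(1)[of 0] by (simp add: vec_eq_iff)
  qed
  ultimately show ?thesis
    unfolding proj_plane_iff using id prime nz by (auto simp: prime_elem_dvd_mult_iff)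
qed

text \<open>In lowest terms over the closure, an irreducible factor r of the denominator would
  contradict regularity at the contraction of the ideal of r. So the denominator divides the
  numerator, first over the closure and then in S.\<close>

lemma polynomial_if_regular:
  fixes x :: "'a::field_char_0 poly3 fract"
  assumes reg: "\<And>p. p \<in> proj_plane \<Longrightarrow> regular (int m) p x"
  obtains R where "homogeneous m R" "x = to_fract R"
proof -
  obtain a b d e where ab: "homogeneous d a" "homogeneous e b" "int d = int e + int m" "b \<noteq> 0"
      "x = to_fract a / to_fract b" using reg[OF generic_point] unfolding regular_def by auto
  define h where "h = gcd (lift3 a) (lift3 b)"
  have h0: "h \<noteq> 0" using ab by (simp add: h_def)
  obtain a' b' where a': "lift3 a = a' * h" and b': "lift3 b = b' * h" and cop: "coprime a' b'"
    using gcd_coprime_exists[of "lift3 a" "lift3 b"] h0 unfolding h_def by blast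
  have "b' dvd 1"
  proof (rule ccontr)
    assume nu: "\<not> b' dvd 1"
    have "b' \<noteq> 0" using b' ab by auto
    then obtain r where r: "irreducible r" "r dvd b'" using ex_irreducible_factor nu by blast
    have "r dvd lift3 b" using r b' by simp
    then obtain er where er: "homogeneous er r"
      using homogeneous_dvd[of e "lift3 b" r] ab by auto
    obtain a1 b1 where a1: "\<not> r dvd lift3 b1" "x = to_fract a1 / to_fract b1"
      using reg[OF proj_plane_contraction[OF er r(1)]] unfolding regular_def by auto
    then have "b1 \<noteq> 0" by auto
    then have "to_fract (a * b1) = to_fract (a1 * b)"
      using a1(2) ab(4,5) by (simp add: field_simps)
    then have "a * b1 = a1 * b" by (simp only: to_fract_eq_iff)
    then have "lift3 a * lift3 b1 = lift3 a1 * lift3 b" by (metis lift3_simps(4))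
    then have "h * (a' * lift3 b1) = h * (lift3 a1 * b')" by (simp add: a' b' mult_ac)
    then have "a' * lift3 b1 = lift3 a1 * b'" using h0 by simp
    then have "r dvd a' * lift3 b1" using r(2) by simp
    then have "r dvd a'" using a1(1) irreducible_imp_prime_elem[OF r(1)] prime_elem_dvd_mult_iff by blast
    then have "r dvd 1" using cop r(2) coprime_common_divisor by blast
    then show False using r(1) by (auto simp: irreducible_def)
  qed
  then have "lift3 b dvd lift3 a" unfolding a' b' by (intro mult_dvd_mono) (auto intro: dvd_trans)
  then obtain R where R: "a = b * R" unfolding lift3_dvd_iff by (auto simp: dvd_def)
  have "d = e + m" using ab(3) by linarith
  then have "homogeneous (e + m) (b * R)" using ab(1) R by simp
  then have "homogeneous m R" using ab(2,4) by (rule homogeneous_cofactor)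
  moreover have "x = to_fract R" using ab by (simp add: R)
  ultimately show ?thesis using that by blast
qed

section \<open>Free curves and bases of the syzygy module\<close>

definition to_fractv :: "'r::idom ^ 3 \<Rightarrow> 'r fract ^ 3" where
  "to_fractv r = (\<chi> i. to_fract (r $ i))"

lemma to_fractv_nth [simp]: "to_fractv r $ i = to_fract (r $ i)"
  by (simp add: to_fractv_def)

lemma to_fractv_cross: "to_fractv (cross r s) = cross (to_fractv r) (to_fractv s)"
  by (simp add: vec3_eq_iff cross_3)

lemma to_fract_dot: "to_fract (dot r s) = dot (to_fractv r) (to_fractv s)"
  by (simp add: dot_def)

lemma to_fractv_scale: "to_fractv (c *s r) = to_fract c *s to_fractv r"
  by (simp add: vec_eq_iff)

lemma derivation_sheaf_iff:
  assumes U: "zariski_open U"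
  shows "s \<in> derivation_sheaf F U \<longleftrightarrow> (\<forall>p. p \<notin> U \<longrightarrow> s p = 0) \<and>
    (\<forall>p\<in>U. s p = s {0} \<and> (\<forall>i. regular 0 p (s {0} $ i)) \<and> dot (to_fractv (grad F)) (s {0}) = 0)"
    (is "?L \<longleftrightarrow> ?R")
proof
  assume L: ?L
  then have t: "(\<forall>p. p \<notin> U \<longrightarrow> s p $ i = 0) \<and> (\<forall>p\<in>U. s p $ i = s {0} $ i \<and> regular 0 p (s {0} $ i))" for i
    using twist_iff[OF U, of "\<lambda>p. s p $ i" 0] unfolding derivation_sheaf_def by blast
  have d: "dot (to_fractv (grad F)) (s p) = 0" if "p \<in> U" for p
    using L that unfolding derivation_sheaf_def by (simp add: dot_def)
  have "s p = s {0}" if "p \<in> U" for p using t that by (simp add: vec_eq_iff)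
  with t d show ?R by (metis vec_eq_iff zero_index)
next
  assume R: ?R
  have "(\<lambda>p. s p $ i) \<in> twist 0 U" for i
    unfolding twist_iff[OF U] using R by simp
  moreover have "(\<Sum>i\<in>UNIV. to_fract (grad F $ i) * s p $ i) = 0" if "p \<in> U" for p
    using R that by (simp add: dot_def)
  ultimately show ?L unfolding derivation_sheaf_def by blast
qed

lemma split_sheaf_iff:
  assumes U: "zariski_open U"
  shows "s \<in> split_sheaf a b U \<longleftrightarrow> (\<forall>p. p \<notin> U \<longrightarrow> s p = 0) \<and>
    (\<forall>p\<in>U. s p = s {0} \<and> regular a p (s {0} $ 1) \<and> regular b p (s {0} $ 2))"
  unfolding split_sheaf_def mem_Collect_eq twist_iff[OF U] by (auto simp: vec2_eq_iff)

lemma bij_betw_inverse: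
  assumes "\<And>x. x \<in> A \<Longrightarrow> f x \<in> B" "\<And>y. y \<in> B \<Longrightarrow> g y \<in> A"
    "\<And>x. x \<in> A \<Longrightarrow> g (f x) = x" "\<And>y. y \<in> B \<Longrightarrow> f (g y) = y"
  shows "bij_betw f A B"
  using assms by (intro bij_betw_byWitness[of _ g]) auto

text \<open>By Cramer's rule, the coordinates of a local syzygy with respect to \<open>r1, r2\<close> are quotients of
  entries of cross products, hence defined wherever the syzygy is, because the gradient has
  coprime entries.\<close>

lemma free_curve_if_basis:
  fixes F :: "'a::field_char_0 poly3"
  assumes hF: "homogeneous d F" and cop: "coprime3 (liftv (grad F))" and ab: "a + b = d - 1"
    and r1: "\<And>i. homogeneous a (r1 $ i)" "dot (grad F) r1 = 0"
    and r2: "\<And>i. homogeneous b (r2 $ i)" "dot (grad F) r2 = 0"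
    and c: "cross r1 r2 = const3 c *s grad F" "c \<noteq> 0"
  shows "free_curve F a b"
proof -
  obtain j where "liftv (grad F) $ j \<noteq> 0" using coprime3_nonzero[OF cop] by blast
  then have j: "grad F $ j \<noteq> 0" by simp
  define D where "D = to_fract (const3 c * grad F $ j)"
  have D0: "D \<noteq> 0" using j c by (simp add: D_def)
  define R1 where "R1 = to_fractv r1"
  define R2 where "R2 = to_fractv r2"
  let ?G = "to_fractv (grad F)"
  have R12: "cross R1 R2 = to_fract (const3 c) *s ?G"
    unfolding R1_def R2_def to_fractv_cross[symmetric] c(1) to_fractv_scale ..
  then have D: "D = cross R1 R2 $ j" by (simp add: D_def)
  have GR: "dot ?G R1 = 0" "dot ?G R2 = 0"
    unfolding R1_def R2_def using r1(2) r2(2) by (simp_all flip: to_fract_dot)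
  \<comment> \<open>Cramer's rule, read off in the component j, where grad F does not
    vanish.\<close>
  define co where "co x = (vector [cross x R2 $ j / D, cross R1 x $ j / D] :: 'a poly3 fract ^ 2)" for x
  have co_add: "co (x + y) = co x + co y" for x y
    by (simp add: co_def vec2_eq_iff vector_2 cross_add_left cross_add_right add_divide_distrib)
  have co_scale: "co (t *s x) = t *s co x" for t x
    by (simp add: co_def vec2_eq_iff vector_2 cross_scale_left cross_scale_right)
  have co_0: "co 0 = 0" by (simp add: co_def vec2_eq_iff vector_2)
  define li where "li y = (y $ 1) *s R1 + (y $ 2) *s R2" for y :: "'a poly3 fract ^ 2"
  have co_li: "co (li y) = y" for y
    using D0 unfolding co_def li_def D
    by (simp add: vec2_eq_iff vector_2 cross_add_left cross_add_right cross_scale_left cross_scale_right)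
  have li_co: "li (co x) = x" if x: "dot ?G x = 0" for x
  proof -
    have "dot x (cross R1 R2) = 0" unfolding R12 using x by (simp add: dot_scale_right dot_commute)
    then have "cross R1 R2 $ j * x $ i = cross x R2 $ j * R1 $ i + cross R1 x $ j * R2 $ i" for i
    proof -
      have "dot x (cross R1 R2) * axis i 1 $ j
        = cross R1 R2 $ j * x $ i + cross R2 x $ j * R1 $ i + cross x R1 $ j * R2 $ i"
        using dot_cross_mult[of x R1 R2 "axis i 1" j] by (simp only: dot_axis_right)
      then show ?thesis
        using \<open>dot x (cross R1 R2) = 0\<close>
        by (simp add: cross_skew[of x R2] cross_skew[of R1 x] eq_neg_iff_add_eq_0 algebra_simps)
    qed
    then have "D * x $ i = D * li (co x) $ i" for i
      using D0 unfolding D[symmetric] by (simp add: li_def co_def vector_2 field_simps)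
    then show ?thesis using D0 by (simp add: vec_eq_iff)
  qed
  have li_dot: "dot ?G (li y) = 0" for y
    using GR by (simp add: li_def dot_add_right dot_scale_right)
  have reg_li: "regular 0 p (li y $ i)"
    if p: "p \<in> proj_plane" and y: "regular (- int a) p (y $ 1)" "regular (- int b) p (y $ 2)" for p y i
  proof -
    have "regular (- int a + int a) p (y $ 1 * R1 $ i)" "regular (- int b + int b) p (y $ 2 * R2 $ i)"
      unfolding R1_def R2_def to_fractv_nth
      by (intro regular_mult p y regular_polynomial r1 r2)+
    then show ?thesis using regular_add[OF p] by (simp add: li_def)
  qed
  \<comment> \<open>The product of h with an entry of grad F has degree E + b', and a nonzero entry
    has degree d - 1 = a' + b'. So a nonzero h has degree E - a', as the twist requires.\<close>
  have quot: "regular (- int a') p (to_fract h / D')"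
    if p: "p \<in> proj_plane" and h: "homogeneous (E + b') (h * grad F $ j)" and B: "homogeneous E B" "B \<notin> p"
      and ab': "a' + b' = d - 1" and D': "D' = to_fract (const3 c * B)" for p h E B a' b' D'
  proof (cases "h = 0")
    case True
    then show ?thesis using regular_0[OF p] by simp
  next
    case False
    obtain e1 e2 where e: "homogeneous e1 h" "homogeneous e2 (grad F $ j)" "e1 + e2 = E + b'"
      using homogeneous_factors[OF h] False j by auto
    then have "e2 = d - 1" using homogeneous_degree_unique[OF e(2) homogeneous_grad[OF hF] j] by simp
    then have "int e1 = int E + (- int a')" using e(3) ab' by linarith
    then show ?thesis unfolding regular_def D'
      using e(1) homogeneous_const3_mult[OF B(1)] proj_plane_mult[OF p proj_plane_const3[OF p c(2)] B(2)]
      by blast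
  qed
  have reg_co: "regular (- int a) p (co x $ 1)" "regular (- int b) p (co x $ 2)"
    if p: "p \<in> proj_plane" and x: "\<And>i. regular 0 p (x $ i)" and dx: "dot ?G x = 0" for p x
  proof -
    have "\<forall>i. \<exists>y z e. homogeneous e y \<and> homogeneous e z \<and> z \<notin> p \<and> x $ i = to_fract y / to_fract z"
      using x unfolding regular_def by (metis add.right_neutral of_nat_eq_iff)
    then obtain y z e where xi: "\<And>i. homogeneous (e i) (y i)" "\<And>i. homogeneous (e i) (z i)"
      "\<And>i. z i \<notin> p" "\<And>i. x $ i = to_fract (y i) / to_fract (z i)" by metis
    \<comment> \<open>Over the common denominator B the local syzygy becomes a polynomial vector A
      of degree E, to which \<open>parallel_coprime3_descent\<close> applies.\<close>
    define B where "B = z 1 * z 2 * z 3"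
    define E where "E = e 1 + e 2 + e 3"
    define A where "A = (vector [y 1 * z 2 * z 3, z 1 * y 2 * z 3, z 1 * z 2 * y 3] :: 'a poly3 ^ 3)"
    have B: "homogeneous E B" "B \<notin> p" unfolding B_def E_def
      by (intro homogeneous_mult xi proj_plane_mult p)+
    have A: "homogeneous E (A $ i)" for i
      using exhaust_3[of i] unfolding A_def E_def by (auto simp: vector_3 intro!: homogeneous_mult xi)
    have z0: "z i \<noteq> 0" for i using notin_ideal_nonzero[OF p xi(3)] .
    have B0: "to_fract B \<noteq> 0" using z0 by (simp add: B_def)
    have xA: "x = (1 / to_fract B) *s to_fractv A"
      using z0 by (simp add: vec3_eq_iff A_def B_def vector_3 xi(4) field_simps)
    have "dot ?G (to_fractv A) = 0" using dx B0 unfolding xA by (simp add: dot_scale_right)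
    then have dA: "dot (grad F) A = 0" by (simp flip: to_fract_dot)
    have "cross (cross A r2) (grad F) = 0" "cross (cross r1 A) (grad F) = 0"
      using dA r1(2) r2(2) by (simp_all add: cross_cross_left dot_commute[of _ "grad F"])
    then obtain h1 h2 where h1: "cross A r2 = h1 *s grad F" and h2: "cross r1 A = h2 *s grad F"
      using parallel_coprime3_descent[OF _ cop] by metis
    have hom1: "homogeneous (E + b) (h1 * grad F $ j)"
    proof -
      have "homogeneous (E + b) (cross A r2 $ j)"
        using exhaust_3[of j] by (auto simp: cross_3 intro!: homogeneous_diff homogeneous_mult A r2(1))
      then show ?thesis by (simp add: h1)
    qed
    have hom2: "homogeneous (E + a) (h2 * grad F $ j)"
    proof -
      have "homogeneous (a + E) (cross r1 A $ j)"
        using exhaust_3[of j] by (auto simp: cross_3 intro!: homogeneous_diff homogeneous_mult A r1(1))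
      then show ?thesis by (simp add: h2 add.commute)
    qed
    have "cross x R2 = (1 / to_fract B) *s to_fractv (cross A r2)"
      by (simp add: xA R2_def to_fractv_cross cross_scale_left)
    then have e1: "co x $ 1 = to_fract h1 / to_fract (const3 c * B)"
      using j c by (simp add: co_def vector_2 h1 D_def)
    have "cross R1 x = (1 / to_fract B) *s to_fractv (cross r1 A)"
      by (simp add: xA R1_def to_fractv_cross cross_scale_right)
    then have e2: "co x $ 2 = to_fract h2 / to_fract (const3 c * B)"
      using j c by (simp add: co_def vector_2 h2 D_def)
    show "regular (- int a) p (co x $ 1)" unfolding e1 by (rule quot[OF p hom1 B ab refl])
    show "regular (- int b) p (co x $ 2)" unfolding e2 by (rule quot[OF p hom2 B _ refl]) (use ab in simp)
  qed
  define phi where "phi U s = (\<lambda>p. co (s p))" for U :: "'a poly3 set set" and s :: "('a, 3) fsection"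
  have "bij_betw (phi U) (derivation_sheaf F U) (split_sheaf (- int a) (- int b) U)" if U: "zariski_open U" for U
  proof (rule bij_betw_inverse[where g = "\<lambda>t p. li (t p)"])
    fix s assume s: "s \<in> derivation_sheaf F U"
    note s' = s[unfolded derivation_sheaf_iff[OF U]]
    have pp: "p \<in> proj_plane" if "p \<in> U" for p using zariski_open_subset[OF U] that by blast
    show "phi U s \<in> split_sheaf (- int a) (- int b) U"
      unfolding split_sheaf_iff[OF U] phi_def using s' co_0 reg_co[OF pp, of _ "s {0}"] by simp
    show "(\<lambda>p. li (phi U s p)) = s"
    proof
      fix p show "li (phi U s p) = s p"
        unfolding phi_def by (rule li_co) (use s' in \<open>cases "p \<in> U"; simp\<close>)
    qed
  next
    fix t assume t: "t \<in> split_sheaf (- int a) (- int b) U"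
    note t' = t[unfolded split_sheaf_iff[OF U]]
    have pp: "p \<in> proj_plane" if "p \<in> U" for p using zariski_open_subset[OF U] that by blast
    have "li 0 = 0" by (simp add: li_def)
    then show "(\<lambda>p. li (t p)) \<in> derivation_sheaf F U"
      unfolding derivation_sheaf_iff[OF U] using t' reg_li[OF pp, of _ "t {0}"] li_dot by simp
    show "phi U (\<lambda>p. li (t p)) = t" by (simp add: phi_def co_li)
  qed
  then show ?thesis
    unfolding free_curve_def sheaf_isomorphic_def
    by (intro exI[of _ phi]) (auto simp: phi_def co_add co_scale co_0 section_restrict_def)
qed

section \<open>From a splitting of the sheaf to a basis of syzygies\<close>

definition constant_section :: "'a::field poly3 set set \<Rightarrow> 'b::zero \<Rightarrow> 'a poly3 set \<Rightarrow> 'b" where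
  "constant_section U y = (\<lambda>p. if p \<in> U then y else 0)"

definition chart :: "3 \<Rightarrow> 'a::field poly3 set set" where
  "chart i = {p \<in> proj_plane. vars $ i \<notin> p}"

lemma zariski_open_chart: "zariski_open (chart i)"
  unfolding chart_def by (rule zariski_open_basic[OF zariski_open_proj_plane homogeneous_vars])

lemma generic_chart: "{0} \<in> chart i"
  using generic_point vars_nonzero by (auto simp: chart_def)

lemma regular_var_power:
  assumes "vars $ i \<notin> p" "p \<in> proj_plane"
  shows "regular (int e) p (to_fract (vars $ i) ^ e)" "regular (- int e) p (1 / to_fract (vars $ i) ^ e)"
proof -
  have h: "homogeneous e (vars $ i ^ e)" using homogeneous_power[OF homogeneous_vars, of e i] by simp
  have pw: "to_fract (q ^ e) = to_fract q ^ e" for q :: "'a poly3" by (induction e) simp_all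
  show "regular (int e) p (to_fract (vars $ i) ^ e)"
    using regular_polynomial[OF assms(2) h] by (simp add: pw)
  show "regular (- int e) p (1 / to_fract (vars $ i) ^ e)"
    using regular_inverse[OF h proj_plane_power[OF assms(2,1)]] by (simp add: pw)
qed

lemma constant_section_split:
  assumes U: "zariski_open U" and y: "\<And>p. p \<in> U \<Longrightarrow> regular a p (y $ 1) \<and> regular b p (y $ 2)"
  shows "constant_section U y \<in> split_sheaf a b U"
  unfolding split_sheaf_iff[OF U] using y zariski_open_generic[OF U] by (auto simp: constant_section_def)

lemma constant_section_twist:
  assumes U: "zariski_open U" and y: "\<And>p. p \<in> U \<Longrightarrow> regular m p y"
  shows "constant_section U y \<in> twist m U"
  unfolding twist_iff[OF U] using y zariski_open_generic[OF U] by (auto simp: constant_section_def)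

lemma derivation_sheaf_restrict:
  assumes U: "zariski_open U" and V: "zariski_open V" "V \<subseteq> U" and s: "s \<in> derivation_sheaf F U"
  shows "section_restrict V s \<in> derivation_sheaf F V"
  using s zariski_open_generic[OF V(1)] V(2)
  unfolding derivation_sheaf_iff[OF U] derivation_sheaf_iff[OF V(1)] section_restrict_def by auto

lemma derivation_sheaf_scale:
  assumes U: "zariski_open U" and q: "q \<in> twist 0 U" and s: "s \<in> derivation_sheaf F U"
  shows "(\<lambda>p. q p *s s p) \<in> derivation_sheaf F U"
proof -
  note q' = q[unfolded twist_iff[OF U]] and s' = s[unfolded derivation_sheaf_iff[OF U]]
  have "regular 0 p (q {0} * s {0} $ i)" if "p \<in> U" for p i
    using regular_mult[of p 0 "q {0}" 0 "s {0} $ i"] q' s' that zariski_open_subset[OF U] by auto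
  then show ?thesis
    unfolding derivation_sheaf_iff[OF U] using q' s' by (auto simp: dot_scale_right)
qed

lemma derivation_sheaf_add:
  assumes U: "zariski_open U" and s: "s \<in> derivation_sheaf F U" and t: "t \<in> derivation_sheaf F U"
  shows "(\<lambda>p. s p + t p) \<in> derivation_sheaf F U"
proof -
  note s' = s[unfolded derivation_sheaf_iff[OF U]] and t' = t[unfolded derivation_sheaf_iff[OF U]]
  have "regular 0 p (s {0} $ i + t {0} $ i)" if "p \<in> U" for p i
    using regular_add[of p 0 "s {0} $ i" "t {0} $ i"] s' t' that zariski_open_subset[OF U] by auto
  then show ?thesis
    unfolding derivation_sheaf_iff[OF U] using s' t' by (auto simp: dot_add_right)
qed

lemma derivation_sheaf_0: "zariski_open U \<Longrightarrow> (\<lambda>p. 0) \<in> derivation_sheaf F U"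
  using zariski_open_subset by (subst derivation_sheaf_iff) (auto intro: regular_0)

text \<open>The preimages of the frame sections x_i^(-a) e_1 on the charts, multiplied by x_i^a,
  agree on overlaps because the isomorphism is linear over regular functions. The common vector is
  regular of degree a everywhere, hence polynomial; e_2 is treated likewise with b. The two syzygies
  are independent, and since their degrees add up to that of the entries of grad F, their cross
  product is a constant multiple of it.\<close>

lemma basis_if_free:
  fixes F :: "'a::field_char_0 poly3"
  assumes hF: "homogeneous d F" and cop: "coprime3 (liftv (grad F))" and ab: "a + b = d - 1"
    and free: "free_curve F a b"
  obtains r1 r2 c where "\<And>i. homogeneous a (r1 $ i)" "dot (grad F) r1 = 0"
    "\<And>i. homogeneous b (r2 $ i)" "dot (grad F) r2 = 0"
    "cross r1 r2 = const3 c *s grad F" "c \<noteq> 0"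
proof -
  let ?M = "derivation_sheaf F" and ?N = "split_sheaf (- int a) (- int b) :: ('a, 2) sheaf"
  let ?x = "\<lambda>i. to_fract (vars $ i :: 'a poly3)"
  have gc: "{0} \<in> (chart i :: 'a poly3 set set)" for i by (rule generic_chart)
  have x0: "?x i \<noteq> 0" for i by (simp add: vars_nonzero)
  from free obtain phi :: "'a poly3 set set \<Rightarrow> ('a, 3) fsection \<Rightarrow> ('a, 2) fsection" where
    phi: "\<forall>U. zariski_open U \<longrightarrow>
          bij_betw (phi U) (?M U) (?N U) \<and>
          (\<forall>s\<in>?M U. \<forall>t\<in>?M U. phi U (\<lambda>p. s p + t p) = (\<lambda>p. phi U s p + phi U t p)) \<and>
          (\<forall>r\<in>twist 0 U. \<forall>s\<in>?M U. phi U (\<lambda>p. r p *s s p) = (\<lambda>p. r p *s phi U s p)) \<and>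
          (\<forall>V. zariski_open V \<and> V \<subseteq> U \<longrightarrow>
             (\<forall>s\<in>?M U. phi V (section_restrict V s) = section_restrict V (phi U s)))"
    unfolding free_curve_def sheaf_isomorphic_def by (elim exE)
  have bij: "bij_betw (phi U) (?M U) (?N U)" if "zariski_open U" for U
    using phi that by simp
  have add: "phi U (\<lambda>p. s p + t p) = (\<lambda>p. phi U s p + phi U t p)"
    if "zariski_open U" "s \<in> ?M U" "t \<in> ?M U" for U s t
    using phi that by simp
  have scale: "phi U (\<lambda>p. r p *s s p) = (\<lambda>p. r p *s phi U s p)"
    if "zariski_open U" "r \<in> twist 0 U" "s \<in> ?M U" for U r s
    using phi that by simp
  have restrict: "phi V (section_restrict V s) = section_restrict V (phi U s)"
    if "zariski_open U" "zariski_open V" "V \<subseteq> U" "s \<in> ?M U" for U V s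
    using phi that by simp
  have inj: "s = t" if "zariski_open U" "s \<in> ?M U" "t \<in> ?M U" "phi U s = phi U t" for U s t
    using bij[OF that(1)] that by (auto simp: bij_betw_def inj_on_def)
  have gen: "\<exists>r. (\<forall>i. homogeneous e (r $ i)) \<and> dot (grad F) r = 0 \<and>
      (\<forall>i. \<exists>s\<in>?M (chart i). phi (chart i) s = constant_section (chart i) ((1 / ?x i ^ e) *s y) \<and>
        s {0} = (1 / ?x i ^ e) *s to_fractv r)"
    if N: "\<And>i. constant_section (chart i) ((1 / ?x i ^ e) *s y) \<in> ?N (chart i)" for e y
  proof -
    have "\<exists>s\<in>?M (chart i). phi (chart i) s = constant_section (chart i) ((1 / ?x i ^ e) *s y)" for i
      using bij[OF zariski_open_chart[of i]] N[of i] unfolding bij_betw_def by (metis imageE)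
    then obtain s where s: "\<And>i. s i \<in> ?M (chart i)"
      "\<And>i. phi (chart i) (s i) = constant_section (chart i) ((1 / ?x i ^ e) *s y)" by metis
    have glue: "?x j ^ e *s s j {0} = ?x i ^ e *s s i {0}" for i j
    proof -
      define V :: "'a poly3 set set" where "V = {p \<in> chart i. vars $ j \<notin> p}"
      have V: "zariski_open V" unfolding V_def by (rule zariski_open_basic[OF zariski_open_chart homogeneous_vars])
      have Vi: "V \<subseteq> chart i" and Vj: "V \<subseteq> chart j" by (auto simp: V_def chart_def)
      have V0: "{0} \<in> V" using gc[of i] vars_nonzero by (auto simp: V_def)
      \<comment> \<open>The transition function (x_i / x_j)^e between the frame sections of two
        charts.\<close>
      define q where "q = constant_section V (?x i ^ e * (1 / ?x j ^ e))"
      have q: "q \<in> twist 0 V" unfolding q_def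
      proof (rule constant_section_twist[OF V])
        fix p assume "p \<in> V"
        then have p: "p \<in> proj_plane" "vars $ i \<notin> p" "vars $ j \<notin> p" by (auto simp: V_def chart_def)
        have "regular (int e + - int e) p (?x i ^ e * (1 / ?x j ^ e))"
          by (intro regular_mult regular_var_power p)
        then show "regular 0 p (?x i ^ e * (1 / ?x j ^ e))" by simp
      qed
      note si = derivation_sheaf_restrict[OF zariski_open_chart V Vi s(1)]
      note sj = derivation_sheaf_restrict[OF zariski_open_chart V Vj s(1)]
      have "phi V (section_restrict V (s j)) = phi V (\<lambda>p. q p *s section_restrict V (s i) p)"
        unfolding restrict[OF zariski_open_chart V Vj s(1)] scale[OF V q si] restrict[OF zariski_open_chart V Vi s(1)] s(2)
        using Vi Vj x0 by (auto simp: section_restrict_def constant_section_def q_def vec_eq_iff fun_eq_iff)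
      then have "section_restrict V (s j) = (\<lambda>p. q p *s section_restrict V (s i) p)"
        by (rule inj[OF V sj derivation_sheaf_scale[OF V q si]])
      then have "s j {0} = (?x i ^ e * (1 / ?x j ^ e)) *s s i {0}"
        using V0 by (metis (no_types, lifting) section_restrict_def q_def constant_section_def)
      then show ?thesis using x0 by (simp add: vec_eq_iff)
    qed
    define rho where "rho = ?x 1 ^ e *s s 1 {0}"
    have rho: "rho = ?x i ^ e *s s i {0}" for i unfolding rho_def by (rule glue)
    have "\<exists>R. homogeneous e R \<and> rho $ l = to_fract R" for l
    proof -
      have "regular (int e) p (rho $ l)" if p: "p \<in> proj_plane" for p
      proof -
        obtain i where i: "vars $ i \<notin> p" using proj_plane_var[OF p] by blast
        then have "p \<in> chart i" using p by (simp add: chart_def)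
        then have "regular 0 p (s i {0} $ l)"
          using s(1)[of i] unfolding derivation_sheaf_iff[OF zariski_open_chart] by blast
        from regular_mult[OF p regular_var_power(1)[OF i p, of e] this]
        show ?thesis by (simp add: rho[of i])
      qed
      from polynomial_if_regular[OF this] show ?thesis by metis
    qed
    then obtain R where R: "\<And>l. homogeneous e (R l)" "\<And>l. rho $ l = to_fract (R l)" by metis
    define r where "r = (\<chi> l. R l)"
    have rr: "rho = to_fractv r" using R by (simp add: vec_eq_iff r_def)
    have "dot (to_fractv (grad F)) (s 1 {0}) = 0"
      using s(1)[of 1] gc[of 1] unfolding derivation_sheaf_iff[OF zariski_open_chart] by blast
    then have "to_fract (dot (grad F) r) = 0"
      unfolding to_fract_dot rr[symmetric] rho_def by (simp add: dot_scale_right)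
    then have "dot (grad F) r = 0" by simp
    moreover have "s i {0} = (1 / ?x i ^ e) *s to_fractv r" for i
      unfolding rr[symmetric] rho[of i] using x0 by (simp add: vec_eq_iff)
    then have "\<exists>s'\<in>?M (chart i). phi (chart i) s' = constant_section (chart i) ((1 / ?x i ^ e) *s y) \<and>
        s' {0} = (1 / ?x i ^ e) *s to_fractv r" for i
      using s(1)[of i] s(2)[of i] by blast
    moreover have "homogeneous e (r $ i)" for i by (simp add: r_def R(1))
    ultimately show ?thesis by blast
  qed
  have N1: "constant_section (chart i) ((1 / ?x i ^ a) *s axis 1 1) \<in> ?N (chart i)" for i
    by (rule constant_section_split[OF zariski_open_chart])
       (auto simp: axis_def chart_def intro: regular_0 regular_var_power)
  have N2: "constant_section (chart i) ((1 / ?x i ^ b) *s axis 2 1) \<in> ?N (chart i)" for i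
    by (rule constant_section_split[OF zariski_open_chart])
       (auto simp: axis_def chart_def intro: regular_0 regular_var_power)
  obtain r1 where r1: "\<And>i. homogeneous a (r1 $ i)" "dot (grad F) r1 = 0"
    and s1: "\<exists>s\<in>?M (chart 1). phi (chart 1) s = constant_section (chart 1) ((1 / ?x 1 ^ a) *s axis 1 1) \<and>
        s {0} = (1 / ?x 1 ^ a) *s to_fractv r1" using gen[OF N1] by blast
  obtain r2 where r2: "\<And>i. homogeneous b (r2 $ i)" "dot (grad F) r2 = 0"
    and s2: "\<exists>s\<in>?M (chart 1). phi (chart 1) s = constant_section (chart 1) ((1 / ?x 1 ^ b) *s axis 2 1) \<and>
        s {0} = (1 / ?x 1 ^ b) *s to_fractv r2" using gen[OF N2] by blast
  obtain s1 s2 where s1: "s1 \<in> ?M (chart 1)" "phi (chart 1) s1 = constant_section (chart 1) ((1 / ?x 1 ^ a) *s axis 1 1)"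
      "s1 {0} = (1 / ?x 1 ^ a) *s to_fractv r1"
    and s2: "s2 \<in> ?M (chart 1)" "phi (chart 1) s2 = constant_section (chart 1) ((1 / ?x 1 ^ b) *s axis 2 1)"
      "s2 {0} = (1 / ?x 1 ^ b) *s to_fractv r2" using s1 s2 by blast
  let ?U = "chart 1 :: 'a poly3 set set"
  note U = zariski_open_chart[of 1, where 'a = 'a]
  have phi0: "phi ?U (\<lambda>p. 0) = (\<lambda>p. 0)"
    using add[OF U derivation_sheaf_0[OF U] derivation_sheaf_0[OF U]] by (simp add: fun_eq_iff)
  have zero: "s = (\<lambda>p. 0)" if s: "s \<in> ?M ?U" "s {0} = 0" for s
  proof
    fix p show "s p = 0" using s unfolding derivation_sheaf_iff[OF U] by (cases "p \<in> ?U") auto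
  qed
  have "cross r1 r2 \<noteq> 0"
  proof
    assume par: "cross r1 r2 = 0"
    have "r1 $ j = 0" for j
    proof -
      \<comment> \<open>The relation r1_j r2 - r2_j r1 = 0, divided by x_1^(a+b), becomes a relation
        between s1 and s2 with regular functions as coefficients. The isomorphism carries it to the
        frame e_1, e_2, where the second component says r1_j = 0.\<close>
      define al where "al = constant_section ?U (to_fract (- r2 $ j) * (1 / ?x 1 ^ b))"
      define be where "be = constant_section ?U (to_fract (r1 $ j) * (1 / ?x 1 ^ a))"
      have al: "al \<in> twist 0 ?U" unfolding al_def
      proof (rule constant_section_twist[OF U])
        fix p assume "p \<in> ?U"
        then have p: "p \<in> proj_plane" "vars $ 1 \<notin> p" by (auto simp: chart_def)
        have "regular (int b + - int b) p (to_fract (- r2 $ j) * (1 / ?x 1 ^ b))"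
          by (intro regular_mult regular_var_power p regular_polynomial homogeneous_uminus r2(1))
        then show "regular 0 p (to_fract (- r2 $ j) * (1 / ?x 1 ^ b))" by simp
      qed
      have be: "be \<in> twist 0 ?U" unfolding be_def
      proof (rule constant_section_twist[OF U])
        fix p assume "p \<in> ?U"
        then have p: "p \<in> proj_plane" "vars $ 1 \<notin> p" by (auto simp: chart_def)
        have "regular (int a + - int a) p (to_fract (r1 $ j) * (1 / ?x 1 ^ a))"
          by (intro regular_mult regular_var_power p regular_polynomial r1(1))
        then show "regular 0 p (to_fract (r1 $ j) * (1 / ?x 1 ^ a))" by simp
      qed
      note m1 = derivation_sheaf_scale[OF U al s1(1)] and m2 = derivation_sheaf_scale[OF U be s2(1)]
      note m = derivation_sheaf_add[OF U m1 m2]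
      have "al {0} *s s1 {0} + be {0} *s s2 {0} = 0"
      proof -
        have "r1 $ i * r2 $ j = r1 $ j * r2 $ i" for i
          using cross_eq_0_components[OF par, of i j] .
        then have "to_fract (r1 $ i) * to_fract (r2 $ j) = to_fract (r1 $ j) * to_fract (r2 $ i)" for i
          by (metis to_fract_mult)
        then show ?thesis
          using gc[of 1] by (simp add: s1(3) s2(3) al_def be_def constant_section_def vec_eq_iff field_simps)
      qed
      then have "(\<lambda>p. al p *s s1 p + be p *s s2 p) = (\<lambda>p. 0)" by (intro zero[OF m])
      then have "(\<lambda>p. al p *s phi ?U s1 p + be p *s phi ?U s2 p) = (\<lambda>p. 0)"
        using add[OF U m1 m2] scale[OF U al s1(1)] scale[OF U be s2(1)] phi0 by simp
      then have "(al {0} *s phi ?U s1 {0} + be {0} *s phi ?U s2 {0}) $ 2 = 0" by (metis zero_index)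
      then have "be {0} * (1 / ?x 1 ^ b) = 0"
        using gc[of 1] by (simp add: s1(2) s2(2) constant_section_def axis_def)
      then show "r1 $ j = 0" using x0 gc[of 1] by (simp add: be_def constant_section_def)
    qed
    then have "s1 {0} = 0" by (simp add: s1(3) vec_eq_iff)
    then have "s1 = (\<lambda>p. 0)" by (rule zero[OF s1(1)])
    then have "phi ?U s1 {0} $ 1 = 0" using phi0 by simp
    then show False using x0 gc[of 1] by (simp add: s1(2) constant_section_def axis_def)
  qed
  moreover have "cross (cross r1 r2) (grad F) = 0"
    using r1(2) r2(2) by (simp add: cross_cross_left dot_commute[of _ "grad F"])
  then obtain h where h: "cross r1 r2 = h *s grad F"
    using parallel_coprime3_descent[OF _ cop] by metis
  ultimately have h0: "h \<noteq> 0" by auto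
  obtain j where "liftv (grad F) $ j \<noteq> 0" using coprime3_nonzero[OF cop] by blast
  then have j: "grad F $ j \<noteq> 0" by simp
  have "homogeneous (a + b) (cross r1 r2 $ j)"
    using exhaust_3[of j] by (auto simp: cross_3 intro!: homogeneous_diff homogeneous_mult r1(1) r2(1))
  \<comment> \<open>Since a + b = d - 1, the factor h is left with degree 0.\<close>
  then have "homogeneous (d - 1 + 0) (grad F $ j * h)" by (simp add: h ab mult.commute)
  then have "homogeneous 0 h" by (rule homogeneous_cofactor[OF _ homogeneous_grad[OF hF] j])
  then obtain c where "h = const3 c" by (rule homogeneous_0_const)
  with h h0 show ?thesis using that[OF r1 r2, of c] by auto
qed

section \<open>The Jacobian ideal as a local complete intersection\<close>

lemma point_prime_iff:
  assumes "homogeneous d b"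
  shows "b \<in> point_prime (proj_class v) \<longleftrightarrow> eval3 (lift3 b) v = 0"
proof
  assume "b \<in> point_prime (proj_class v)"
  moreover have "v \<in> proj_class v" unfolding proj_class_def by (auto intro: exI[of _ 1])
  ultimately show "eval3 (lift3 b) v = 0" by (auto simp: point_prime_def)
next
  have "homogeneous d (lift3 b)" using assms by simp
  then show "eval3 (lift3 b) v = 0 \<Longrightarrow> b \<in> point_prime (proj_class v)"
    by (auto simp: point_prime_def proj_class_def eval3_homogeneous_scale)
qed

lemma jacobian_ideal_iff: "a \<in> jacobian_ideal F \<longleftrightarrow> (\<exists>w. a = dot w (grad F))"
proof
  let ?J = "{a. \<exists>w. a = dot w (grad F)}"
  have "is_ideal ?J"
    unfolding is_ideal_def
  proof (intro conjI ballI allI; clarify)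
    show "\<exists>w. 0 = dot w (grad F)" by (rule exI[of _ 0]) simp
    show "\<exists>w''. dot w (grad F) + dot w' (grad F) = dot w'' (grad F)" for w w'
      by (rule exI[of _ "w + w'"]) (simp add: dot_add_left)
    show "\<exists>w'. r * dot w (grad F) = dot w' (grad F)" for r w
      by (rule exI[of _ "r *s w"]) (simp add: dot_scale_left)
  qed
  moreover have "range (\<lambda>i. grad F $ i) \<subseteq> ?J"
  proof clarify
    fix i
    have "grad F $ i = dot (axis i 1) (grad F)" by (simp add: dot_axis)
    then show "\<exists>w. grad F $ i = dot w (grad F)" ..
  qed
  ultimately show "a \<in> jacobian_ideal F \<Longrightarrow> \<exists>w. a = dot w (grad F)"
    unfolding jacobian_ideal_def genideal_type_algebra by blast
next
  assume "\<exists>w. a = dot w (grad F)"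
  then show "a \<in> jacobian_ideal F"
    unfolding jacobian_ideal_def genideal_type_algebra dot_def
    by (auto intro!: is_ideal_sum is_idealD(3))
qed

lemma hpart_sum: "hpart d (sum h T) = (\<Sum>t\<in>T. hpart d (h t))"
  by (induction T rule: infinite_finite_induct) simp_all

text \<open>Multiplying by l of degree D gives the coefficients the degree E of a itself, which is
  also the degree of the denominator of a stalk element, so no subtraction of degrees occurs. Taking
  parts of degree E makes them homogeneous.\<close>

lemma homogeneous_jacobian_multiple:
  assumes hF: "homogeneous (Suc D) F" and a: "a = dot w (grad F)" "homogeneous E a" and l: "homogeneous D l"
  obtains W where "\<And>i. homogeneous E (W $ i)" "l * a = dot W (grad F)"
proof -
  define W where "W = (\<chi> i. hpart E (l * w $ i))"
  have e: "l * a = (\<Sum>i\<in>UNIV. grad F $ i * (l * w $ i))"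
    unfolding a(1) dot_def by (simp add: sum_distrib_left mult_ac)
  have "l * a = hpart (D + E) (l * a)"
    using hpart_homogeneous[OF homogeneous_mult[OF l a(2)], of "D + E"] by simp
  also have "\<dots> = (\<Sum>i\<in>UNIV. grad F $ i * hpart E (l * w $ i))"
    unfolding e hpart_sum
    by (rule sum.cong) (use hpart_mult_homogeneous[OF homogeneous_grad[OF hF]] in simp_all)
  also have "\<dots> = dot W (grad F)" by (simp add: W_def dot_def mult.commute)
  finally show ?thesis using that[of W] by (simp add: W_def homogeneous_hpart)
qed

lemma sum_UNIV_3_others:
  fixes i :: 3
  shows "\<exists>j k. \<forall>h :: 3 \<Rightarrow> 'c::comm_monoid_add. sum h UNIV = h i + h j + h k"
proof -
  consider "i = 1" | "i = 2" | "i = 3" using exhaust_3[of i] by blast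
  then show ?thesis
  proof cases
    case 1 then show ?thesis by (intro exI[of _ 2] exI[of _ 3]) (simp add: sum_3)
  next
    case 2 then show ?thesis by (intro exI[of _ 1] exI[of _ 3]) (simp add: sum_3 add_ac)
  next
    case 3 then show ?thesis by (intro exI[of _ 1] exI[of _ 2]) (simp add: sum_3 add_ac)
  qed
qed

text \<open>A stalk generated by two elements makes the matrix relating the three partial derivatives to
  themselves singular, so one of the resulting syzygies has a unit entry.\<close>

lemma lci_iff_syzygy:
  fixes F :: "'a::field_char_0 poly3"
  assumes hF: "homogeneous (Suc D) F" and v: "v \<noteq> 0"
  shows "jacobian_lci_at F (point_prime (proj_class v)) \<longleftrightarrow>
    (\<exists>e b. (\<forall>i. homogeneous e (b $ i)) \<and> dot b (grad F) = 0 \<and> evalv (liftv b) v \<noteq> 0)"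
proof -
  define p where "p = point_prime (proj_class v) \<inter> (UNIV :: 'a poly3 set)"
  have p: "point_prime (proj_class v) = p" by (simp add: p_def)
  have notin: "b \<notin> p \<longleftrightarrow> eval3 (lift3 b) v \<noteq> 0" if "homogeneous d b" for b d
    using point_prime_iff[OF that] by (simp add: p_def)
  have mult: "b * c \<notin> p" if "homogeneous d b" "b \<notin> p" "homogeneous e c" "c \<notin> p" for b c d e
    using that notin homogeneous_mult[OF that(1,3)] by simp
  have nz: "b \<noteq> 0" if "b \<notin> p" for b
    using that by (auto simp: p_def point_prime_def)
  have one: "1 \<notin> p" using notin[OF homogeneous_1] by simp
  obtain i0 where i0: "v $ i0 \<noteq> 0" using v by (auto simp: vec_eq_iff)
  define l where "l = (vars $ i0 :: 'a poly3) ^ D"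
  have l: "homogeneous D l" unfolding l_def using homogeneous_power[OF homogeneous_vars, of D i0] by simp
  have "lift3 (vars $ i0 :: 'a poly3) = vars $ i0"
    using exhaust_3[of i0] by (auto simp: vars_3 lift3_mon)
  then have "eval3 (lift3 l) v = v $ i0 ^ D"
    unfolding l_def by (simp add: ring_hom_fun_power[OF ring_hom_fun_lift3] eval3_power)
  then have lp: "l \<notin> p" using notin[OF l] i0 by simp
  have l0: "to_fract l \<noteq> 0" using nz[OF lp] by simp
  let ?G = "grad F"
  \<comment> \<open>The partial derivatives divided by a form of the same degree that does not
    vanish at the point, which puts them into the stalk.\<close>
  define g where "g i = to_fract (?G $ i) / to_fract l" for i
  have hG: "homogeneous D (?G $ i)" for i using homogeneous_grad[OF hF] by simp
  have local_ringI: "to_fract x / to_fract y \<in> local_ring p" if "homogeneous e x" "homogeneous e y" "y \<notin> p" for x y e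
    using that unfolding local_ring_def by blast
  have loc01: "0 \<in> local_ring p" "1 \<in> local_ring p"
    using local_ringI[of 0 0 1] local_ringI[of 0 1 1] one by simp_all
  have stalkE: "\<exists>W E y. (\<forall>i. homogeneous E (W $ i)) \<and> homogeneous E y \<and> y \<notin> p \<and>
      h = to_fract (dot W ?G) / (to_fract y * to_fract l)" if h: "h \<in> jacobian_stalk F p" for h
  proof -
    obtain a y E where a: "h = to_fract a / to_fract y" "a \<in> jacobian_ideal F" "homogeneous E a"
      "homogeneous E y" "y \<notin> p" using h unfolding jacobian_stalk_def by blast
    obtain w where "a = dot w ?G" using a(2) jacobian_ideal_iff by blast
    then obtain W where W: "\<And>i. homogeneous E (W $ i)" "l * a = dot W ?G"
      using homogeneous_jacobian_multiple[OF hF _ a(3) l] by metis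
    have "h = to_fract (l * a) / (to_fract y * to_fract l)" using a(1) l0 by simp
    then show ?thesis using W a by metis
  qed
  have g_stalk: "g i \<in> jacobian_stalk F p" for i
  proof -
    have "?G $ i \<in> jacobian_ideal F" unfolding jacobian_ideal_iff by (rule exI[of _ "axis i 1"]) (simp add: dot_axis)
    then show ?thesis unfolding g_def jacobian_stalk_def using hG l lp by blast
  qed
  show ?thesis unfolding p
  proof
    assume "jacobian_lci_at F p"
    then obtain h1 h2 where st: "jacobian_stalk F p =
        {r1 * h1 + r2 * h2 | r1 r2. r1 \<in> local_ring p \<and> r2 \<in> local_ring p}"
      unfolding jacobian_lci_at_def by blast
    have "1 * h1 + 0 * h2 \<in> jacobian_stalk F p" "0 * h1 + 1 * h2 \<in> jacobian_stalk F p"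
      unfolding st using loc01 by blast+
    then have "h1 \<in> jacobian_stalk F p" "h2 \<in> jacobian_stalk F p" by simp_all
    then obtain W1 E1 y1 W2 E2 y2 where
      W1: "\<And>i. homogeneous E1 (W1 $ i)" "homogeneous E1 y1" "y1 \<notin> p" "h1 = to_fract (dot W1 ?G) / (to_fract y1 * to_fract l)" and
      W2: "\<And>i. homogeneous E2 (W2 $ i)" "homogeneous E2 y2" "y2 \<notin> p" "h2 = to_fract (dot W2 ?G) / (to_fract y2 * to_fract l)"
      using stalkE by metis
    have ex: "\<exists>e Y A B. homogeneous (e + E1 + E2) Y \<and> homogeneous (e + E2) A \<and> homogeneous (e + E1) B \<and> Y \<notin> p \<and>
      Y * ?G $ i = A * dot W1 ?G + B * dot W2 ?G" for i
    proof -
      obtain r1 r2 where "g i = r1 * h1 + r2 * h2" "r1 \<in> local_ring p" "r2 \<in> local_ring p"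
        using g_stalk[of i] unfolding st by blast
      then obtain a1 b1 e1 a2 b2 e2 where
        r: "g i = to_fract a1 / to_fract b1 * h1 + to_fract a2 / to_fract b2 * h2"
        and h: "homogeneous e1 a1" "homogeneous e1 b1" "b1 \<notin> p" "homogeneous e2 a2" "homogeneous e2 b2" "b2 \<notin> p"
        unfolding local_ring_def by auto
      have nz': "to_fract b1 \<noteq> 0" "to_fract b2 \<noteq> 0" "to_fract y1 \<noteq> 0" "to_fract y2 \<noteq> 0"
        using nz h W1 W2 by auto
      have "to_fract (b1 * b2 * y1 * y2 * ?G $ i) = to_fract (b1 * b2 * y1 * y2 * l) * g i"
        using l0 by (simp add: g_def)
      also have "\<dots> = to_fract ((a1 * b2 * y2) * dot W1 ?G + (a2 * b1 * y1) * dot W2 ?G)"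
        unfolding r W1(4) W2(4) using nz' l0 by (simp add: field_simps)
      finally have eq: "b1 * b2 * y1 * y2 * ?G $ i = (a1 * b2 * y2) * dot W1 ?G + (a2 * b1 * y1) * dot W2 ?G"
        by (simp only: to_fract_eq_iff)
      note hb = homogeneous_mult[OF h(2,5)]
      note hby = homogeneous_mult[OF hb W1(2)]
      have "b1 * b2 * y1 * y2 \<notin> p"
        using mult[OF hby mult[OF hb mult[OF h(2,3,5,6)] W1(2,3)] W2(2,3)] .
      moreover have "homogeneous (e1 + e2 + E1 + E2) (b1 * b2 * y1 * y2)"
        by (rule homogeneous_mult[OF hby W2(2)])
      moreover have "homogeneous (e1 + e2 + E2) (a1 * b2 * y2)"
        using h W1 W2 by (intro homogeneous_mult)
      moreover have "homogeneous (e1 + e2 + E1) (a2 * b1 * y1)"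
        using homogeneous_mult[OF homogeneous_mult[OF h(4,2)] W1(2)] by (simp add: add.commute)
      ultimately show ?thesis using eq by blast
    qed
    then obtain e Y A B where Y: "\<And>i. homogeneous (e i + E1 + E2) (Y i)" "\<And>i. homogeneous (e i + E2) (A i)"
      "\<And>i. homogeneous (e i + E1) (B i)" "\<And>i. Y i \<notin> p"
      "\<And>i. Y i * ?G $ i = A i * dot W1 ?G + B i * dot W2 ?G" by metis
    \<comment> \<open>Expressing each partial derivative by the two generators, and these again by
      the partial derivatives, leaves one syzygy for each index.\<close>
    define b where "b i = Y i *s axis i 1 - A i *s W1 - B i *s W2" for i
    have bG: "dot (b i) ?G = 0" for i
      unfolding b_def using Y(5)[of i] dot_axis[of i ?G]
      by (simp add: dot_commute[of _ ?G] dot_diff_right dot_scale_right)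
    have bh: "homogeneous (e i + E1 + E2) (b i $ j)" for i j
    proof -
      have "homogeneous (e i + E1 + E2) (A i * W1 $ j)"
        using homogeneous_mult[OF Y(2)[of i] W1(1)[of j]] by (simp add: add_ac)
      moreover have "homogeneous (e i + E1 + E2) (B i * W2 $ j)"
        using homogeneous_mult[OF Y(3)[of i] W2(1)[of j]] by simp
      moreover have "homogeneous (e i + E1 + E2) (Y i * axis i 1 $ j)"
        using Y(1)[of i] by (simp add: axis_def)
      ultimately show ?thesis unfolding b_def by (simp add: homogeneous_diff)
    qed
    have "\<exists>i. evalv (liftv (b i)) v \<noteq> 0"
    proof (rule ccontr)
      assume no: "\<not> ?thesis"
      define ev where "ev x = eval3 (lift3 x) v" for x
      define w1 where "w1 = evalv (liftv W1) v"
      define w2 where "w2 = evalv (liftv W2) v"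
      have "ev (Y i) *s axis i 1 = ev (A i) *s w1 + ev (B i) *s w2" for i
      proof -
        have "ev (Y i) * axis i 1 $ j = ev (A i) * w1 $ j + ev (B i) * w2 $ j" for j
        proof -
          have "evalv (liftv (b i)) v $ j = 0" using no by simp
          then have "ev (b i $ j) = 0" by (simp add: ev_def)
          moreover have "ev (b i $ j) = ev (Y i) * axis i 1 $ j - (ev (A i) * w1 $ j + ev (B i) * w2 $ j)"
            by (simp add: b_def ev_def w1_def w2_def axis_def)
          ultimately show ?thesis by (simp only: eq_iff_diff_eq_0[symmetric] right_minus_eq)
        qed
        then show ?thesis by (simp add: vec_eq_iff)
      qed
      \<comment> \<open>If all three syzygies vanished at v, the diagonal matrix with entries Y i
        evaluated at v would have its rows in the span of w1 and w2, so its determinant would be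
        zero; but no Y i vanishes at v.\<close>
      then have "dot (cross (ev (Y 1) *s axis 1 1) (ev (Y 2) *s axis 2 1)) (ev (Y 3) *s axis 3 1)
        = dot ((ev (A 1) * ev (B 2) - ev (B 1) * ev (A 2)) *s cross w1 w2) (ev (A 3) *s w1 + ev (B 3) *s w2)"
        by (simp add: cross_combination)
      also have "\<dots> = 0" by (simp add: dot_scale_left dot_add_right dot_scale_right dot_commute[of "cross _ _"])
      finally have "ev (Y 1) * ev (Y 2) * ev (Y 3) = 0" by (simp add: vec3_simps axis_def)
      then show False using Y(4) notin[OF Y(1)] by (auto simp: ev_def)
    qed
    then show "\<exists>e b. (\<forall>i. homogeneous e (b $ i)) \<and> dot b ?G = 0 \<and> evalv (liftv b) v \<noteq> 0"
      using bG bh by blast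
  next
    assume "\<exists>e b. (\<forall>i. homogeneous e (b $ i)) \<and> dot b ?G = 0 \<and> evalv (liftv b) v \<noteq> 0"
    then obtain e b where b: "\<And>i. homogeneous e (b $ i)" "dot b ?G = 0" "evalv (liftv b) v \<noteq> 0" by blast
    obtain i where "eval3 (lift3 (b $ i)) v \<noteq> 0" using b(3) by (auto simp: vec_eq_iff)
    then have i: "b $ i \<notin> p" using notin[OF b(1)] by simp
    obtain j k where sum: "\<And>h :: 3 \<Rightarrow> 'a poly3. sum h UNIV = h i + h j + h k" using sum_UNIV_3_others[of i] by metis
    have syz: "b $ i * ?G $ i = - (b $ j * ?G $ j + b $ k * ?G $ k)"
    proof -
      have "b $ i * ?G $ i + (b $ j * ?G $ j + b $ k * ?G $ k) = 0"
        using b(2) unfolding dot_def sum by (simp only: add.assoc)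
      then show ?thesis by (simp only: eq_neg_iff_add_eq_0)
    qed
    have bi: "to_fract (b $ i) \<noteq> 0" using nz[OF i] by simp
    have "jacobian_stalk F p = {r1 * g j + r2 * g k | r1 r2. r1 \<in> local_ring p \<and> r2 \<in> local_ring p}"
    proof (intro subset_antisym subsetI)
      fix h assume "h \<in> jacobian_stalk F p"
      then obtain W E y where W: "\<And>i. homogeneous E (W $ i)" "homogeneous E y" "y \<notin> p"
        "h = to_fract (dot W ?G) / (to_fract y * to_fract l)" using stalkE by metis
      have y0: "to_fract y \<noteq> 0" using nz W by simp
      \<comment> \<open>Coordinates obtained by eliminating the i-th partial derivative with the
        syzygy, whose i-th entry does not vanish at the point.\<close>
      define q where "q j = to_fract (W $ j * b $ i - W $ i * b $ j) / to_fract (y * b $ i)" for j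
      have "q j \<in> local_ring p" for j
        unfolding q_def
        using homogeneous_mult[OF W(2) b(1), of i] mult[OF W(2,3) b(1) i]
          homogeneous_diff[OF homogeneous_mult[OF W(1) b(1)] homogeneous_mult[OF W(1) b(1)], of j i i j]
        by (intro local_ringI)
      moreover have "h = q j * g j + q k * g k"
      proof -
        have "b $ i * dot W ?G = W $ i * (b $ i * ?G $ i) + b $ i * (W $ j * ?G $ j + W $ k * ?G $ k)"
          unfolding dot_def sum by (simp add: algebra_simps)
        also have "\<dots> = (W $ j * b $ i - W $ i * b $ j) * ?G $ j + (W $ k * b $ i - W $ i * b $ k) * ?G $ k"
          unfolding syz by (simp add: algebra_simps)
        finally have "to_fract (b $ i) * to_fract (dot W ?G) =
          to_fract (W $ j * b $ i - W $ i * b $ j) * to_fract (?G $ j) + to_fract (W $ k * b $ i - W $ i * b $ k) * to_fract (?G $ k)"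
          by (simp only: to_fract_mult[symmetric] to_fract_add[symmetric])
        moreover have "h = to_fract (b $ i) * to_fract (dot W ?G) / (to_fract (y * b $ i) * to_fract l)"
          using bi by (simp add: W(4))
        ultimately show ?thesis using y0 bi l0
          by (simp only: q_def g_def times_divide_times_eq add_divide_distrib)
      qed
      ultimately show "h \<in> {r1 * g j + r2 * g k | r1 r2. r1 \<in> local_ring p \<and> r2 \<in> local_ring p}" by blast
    next
      fix h assume "h \<in> {r1 * g j + r2 * g k | r1 r2. r1 \<in> local_ring p \<and> r2 \<in> local_ring p}"
      then obtain a1 b1 e1 a2 b2 e2 where
        r: "h = to_fract a1 / to_fract b1 * g j + to_fract a2 / to_fract b2 * g k"
        and H: "homogeneous e1 a1" "homogeneous e1 b1" "b1 \<notin> p" "homogeneous e2 a2" "homogeneous e2 b2" "b2 \<notin> p"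
        unfolding local_ring_def by auto
      have nz': "to_fract b1 \<noteq> 0" "to_fract b2 \<noteq> 0" using nz H by auto
      define a where "a = (a1 * b2) * ?G $ j + (b1 * a2) * ?G $ k"
      have "h = to_fract a / to_fract (b1 * b2 * l)"
        unfolding r g_def a_def using nz' l0 by (simp add: field_simps)
      moreover have "a \<in> jacobian_ideal F"
        unfolding jacobian_ideal_iff
      proof (rule exI[of _ "(a1 * b2) *s axis j 1 + (b1 * a2) *s axis k 1"])
        show "a = dot ((a1 * b2) *s axis j 1 + (b1 * a2) *s axis k 1) ?G"
          unfolding a_def dot_add_left dot_scale_left dot_axis ..
      qed
      moreover have "homogeneous (e1 + e2 + D) a" unfolding a_def
        using H by (intro homogeneous_add homogeneous_mult hG)
      moreover have "homogeneous (e1 + e2 + D) (b1 * b2 * l)"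
        using H l by (intro homogeneous_mult)
      moreover have "b1 * b2 * l \<notin> p"
        using mult[OF homogeneous_mult[OF H(2,5)] mult[OF H(2,3,5,6)] l lp] .
      ultimately show "h \<in> jacobian_stalk F p" unfolding jacobian_stalk_def by blast
    qed
    then show "jacobian_lci_at F p" unfolding jacobian_lci_at_def by blast
  qed
qed

section \<open>Free unions of members of a pencil\<close>

lemma proj_class_self: "v \<in> proj_class v"
  unfolding proj_class_def by (auto intro: exI[of _ 1])

lemma proj_class_scale: "c \<noteq> 0 \<Longrightarrow> proj_class (c *s v) = proj_class v"
  unfolding proj_class_def
proof (intro subset_antisym subsetI; clarify)
  fix d :: 'a assume "c \<noteq> 0" "d \<noteq> 0"
  then show "\<exists>e. d *s (c *s v) = e *s v \<and> e \<noteq> 0"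
    by (intro exI[of _ "d * c"]) (simp add: vector_smult_assoc)
next
  fix d :: 'a assume "c \<noteq> 0" "d \<noteq> 0"
  then show "\<exists>e. d *s v = e *s (c *s v) \<and> e \<noteq> 0"
    by (intro exI[of _ "d / c"]) (simp add: vector_smult_assoc)
qed

lemma proj_class_eqD:
  assumes "proj_class v = proj_class w"
  obtains c where "c \<noteq> 0" "w = c *s v"
  using proj_class_self[of w] assms unfolding proj_class_def by auto

lemma proj_spaceE:
  assumes "P \<in> proj_space"
  obtains v where "v \<noteq> 0" "P = proj_class v"
  using assms by (auto simp: proj_space_def)

lemma proj_class_in_space: "v \<noteq> 0 \<Longrightarrow> proj_class v \<in> proj_space"
  by (simp add: proj_space_def)

lemma curve_points_iff:
  assumes "homogeneous d F" "v \<noteq> 0"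
  shows "proj_class v \<in> curve_points F \<longleftrightarrow> eval3 F v = 0"
  using assms proj_class_self[of v] proj_class_in_space[of v]
  by (auto simp: curve_points_def proj_class_def eval3_homogeneous_scale[OF assms(1)])

lemma singular_points_iff:
  assumes "homogeneous d F" "v \<noteq> 0"
  shows "proj_class v \<in> singular_points F \<longleftrightarrow> eval3 F v = 0 \<and> evalv (grad F) v = 0"
proof -
  have "(\<forall>w\<in>proj_class v. \<forall>i. eval3 (grad F $ i) w = 0) \<longleftrightarrow> evalv (grad F) v = 0"
  proof
    assume "\<forall>w\<in>proj_class v. \<forall>i. eval3 (grad F $ i) w = 0"
    then have "eval3 (grad F $ i) v = 0" for i using proj_class_self[of v] by blast
    then show "evalv (grad F) v = 0" by (simp add: vec_eq_iff)
  next
    assume z: "evalv (grad F) v = 0"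
    have "eval3 (grad F $ i) (c *s v) = 0" for i c
    proof -
      have "eval3 (grad F $ i) v = 0" using z by (metis evalv_nth zero_index)
      then show ?thesis by (simp add: eval3_homogeneous_scale[OF homogeneous_grad[OF assms(1)]])
    qed
    then show "\<forall>w\<in>proj_class v. \<forall>i. eval3 (grad F $ i) w = 0" unfolding proj_class_def by blast
  qed
  then show ?thesis
    unfolding singular_points_def mem_Collect_eq curve_points_iff[OF assms] by blast
qed

lemma singular_pointsE:
  assumes "P \<in> singular_points F" "homogeneous d F"
  obtains v where "v \<noteq> 0" "P = proj_class v" "eval3 F v = 0" "evalv (grad F) v = 0"
proof -
  have "P \<in> proj_space" using assms by (simp add: singular_points_def curve_points_def)
  then obtain v where v: "v \<noteq> 0" "P = proj_class v" by (rule proj_spaceE)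
  with assms singular_points_iff[OF assms(2) v(1)] that show ?thesis by blast
qed

lemma pencil_member_eq: "pencil_member f g v = pencil_at (lift3 f) (lift3 g) v"
  by (simp add: pencil_member_def pencil_at_def)

lemma pencil_if_reduced:
  fixes f g :: "'a::field_char_0 poly3"
  assumes n: "n \<ge> 1" and hf: "homogeneous n f" and hg: "homogeneous n g"
    and general: "general_member_smooth f g"
    and reduced: "\<forall>v. v \<noteq> 0 \<longrightarrow> reduced_curve n (pencil_member f g v)"
    and card: "card (base_locus f g) = n\<^sup>2"
  shows "pencil (lift3 f) (lift3 g) n"
proof
  let ?f = "lift3 f" and ?g = "lift3 g"
  have hf': "homogeneous n ?f" and hg': "homogeneous n ?g" using hf hg by simp_all
  then show "homogeneous n ?f" "homogeneous n ?g" .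
  show "n \<ge> 1" by (rule n)
  show "pencil_at ?f ?g v \<noteq> 0" "squarefree (pencil_at ?f ?g v)" if "v \<noteq> 0" for v
    using reduced that by (auto simp: reduced_curve_def pencil_member_eq)
  have hm: "homogeneous n (pencil_at ?f ?g v)" for v
    unfolding pencil_at_def by (intro homogeneous_add homogeneous_const3_mult hf' hg')
  have base: "proj_class p \<in> base_locus f g \<longleftrightarrow> eval3 ?f p = 0 \<and> eval3 ?g p = 0" if "p \<noteq> 0" for p
    unfolding base_locus_def using curve_points_iff[OF hf' that] curve_points_iff[OF hg' that] by blast
  \<comment> \<open>An infinite set would have cardinality 0, while n^2 is positive.\<close>
  have fin: "finite (base_locus f g)" using card n by (intro card_ge_0_finite) simp
  show "\<exists>i j. i \<noteq> j \<and> cross (p i) (p j) = 0"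
    if p: "\<And>i::nat. p i \<noteq> 0 \<and> eval3 ?f (p i) = 0 \<and> eval3 ?g (p i) = 0" for p
  proof -
    have "range (\<lambda>i. proj_class (p i)) \<subseteq> base_locus f g" using p base by blast
    then have "\<not> inj (\<lambda>i. proj_class (p i))"
      using fin finite_subset finite_imageD infinite_UNIV_nat by blast
    then obtain i j where ij: "i \<noteq> j" "proj_class (p i) = proj_class (p j)" by (auto simp: inj_def)
    then obtain c where "p j = c *s p i" using proj_class_eqD by metis
    then show ?thesis using ij by (intro exI[of _ i] exI[of _ j]) (simp add: cross_scale_right)
  qed
  show "\<exists>p. (\<forall>i<n * n. p i \<noteq> 0 \<and> eval3 ?f (p i) = 0 \<and> eval3 ?g (p i) = 0) \<and>
      (\<forall>i<n * n. \<forall>j<n * n. i \<noteq> j \<longrightarrow> cross (p i) (p j) \<noteq> 0) \<and>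
      (\<forall>q. q \<noteq> 0 \<longrightarrow> eval3 ?f q = 0 \<longrightarrow> eval3 ?g q = 0 \<longrightarrow> (\<exists>i<n * n. cross (p i) q = 0))"
  proof -
    obtain h where h: "bij_betw h {0..<n * n} (base_locus f g)"
      using ex_bij_betw_nat_finite[OF fin] card by (auto simp: power2_eq_square)
    have "\<exists>v. v \<noteq> 0 \<and> h i = proj_class v" if "i < n * n" for i
    proof -
      have "h i \<in> base_locus f g" using bij_betw_apply[OF h] that by simp
      then have "h i \<in> proj_space" by (simp add: base_locus_def curve_points_def)
      then show ?thesis using proj_spaceE by metis
    qed
    then obtain p where p: "\<And>i. i < n * n \<Longrightarrow> p i \<noteq> 0 \<and> h i = proj_class (p i)" by metis
    have 1: "p i \<noteq> 0 \<and> eval3 ?f (p i) = 0 \<and> eval3 ?g (p i) = 0" if "i < n * n" for i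
      using p[OF that] base[of "p i"] bij_betw_apply[OF h, of i] that by simp
    have 2: "cross (p i) (p j) \<noteq> 0" if ij: "i < n * n" "j < n * n" "i \<noteq> j" for i j
    proof
      assume "cross (p i) (p j) = 0"
      then obtain c where c: "p j = c *s p i" using parallel_field p[OF ij(1)] by metis
      then have "c \<noteq> 0" using p[OF ij(2)] by auto
      then have "proj_class (p j) = proj_class (p i)" unfolding c by (rule proj_class_scale)
      then have "h i = h j" using p[OF ij(1)] p[OF ij(2)] by simp
      from inj_onD[OF bij_betw_imp_inj_on[OF h] this] show False using ij by simp
    qed
    have 3: "\<exists>i<n * n. cross (p i) q = 0" if q: "q \<noteq> 0" "eval3 ?f q = 0" "eval3 ?g q = 0" for q
    proof -
      have "proj_class q \<in> h ` {0..<n * n}" using base[OF q(1)] q h by (simp add: bij_betw_def)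
      then obtain i where i: "i < n * n" "proj_class q = proj_class (p i)" using p by auto
      then obtain c where "p i = c *s q" using proj_class_eqD by metis
      then show ?thesis using i by (auto simp: cross_scale_left)
    qed
    show ?thesis using 1 2 3 by blast
  qed
  \<comment> \<open>The parameters of the singular members are finitely many points of the
    projective line; \<open>rep\<close> picks a coordinate vector of each.\<close>
  define T where "T = {Q \<in> proj_space. \<exists>v\<in>Q. singular_points (pencil_member f g v) \<noteq> {}}"
  have finT: "finite T" using general by (simp add: general_member_smooth_def T_def)
  have "\<exists>v. v \<noteq> 0 \<and> Q = proj_class v" if "Q \<in> T" for Q
    using that proj_spaceE unfolding T_def by blast
  then obtain rep where rep: "\<And>Q. Q \<in> T \<Longrightarrow> rep Q \<noteq> 0 \<and> Q = proj_class (rep Q)" by metis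
  show "\<exists>S. finite S \<and> 0 \<notin> S \<and> (\<forall>v p. v \<noteq> 0 \<longrightarrow> p \<noteq> 0 \<longrightarrow>
      evalv (grad (pencil_at ?f ?g v)) p = 0 \<longrightarrow> (\<exists>w\<in>S. eval3 (pencil_at ?f ?g w) p = 0))"
  proof (intro exI[of _ "rep ` T"] conjI allI impI)
    show "finite (rep ` T)" using finT by simp
    show "0 \<notin> rep ` T" using rep by force
    fix v p assume v: "v \<noteq> 0" and p: "p \<noteq> 0" and s: "evalv (grad (pencil_at ?f ?g v)) p = 0"
    have z: "eval3 (pencil_at ?f ?g v) p = 0" by (rule eval3_zero_if_grad_zero[OF hm n s])
    then have "proj_class p \<in> singular_points (pencil_member f g v)"
      unfolding pencil_member_eq singular_points_iff[OF hm p] using s by blast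
    then have "proj_class v \<in> T"
      unfolding T_def using proj_class_in_space[OF v] proj_class_self[of v] by blast
    then have "proj_class v = proj_class (rep (proj_class v))" "rep (proj_class v) \<in> rep ` T" using rep by blast+
    then obtain c where "rep (proj_class v) = c *s v" using proj_class_eqD by metis
    then have "eval3 (pencil_at ?f ?g (rep (proj_class v))) p = c * eval3 (pencil_at ?f ?g v) p"
      by (simp add: pencil_at_def algebra_simps)
    then show "\<exists>w\<in>rep ` T. eval3 (pencil_at ?f ?g w) p = 0"
      using z \<open>rep (proj_class v) \<in> rep ` T\<close> by auto
  qed
qed

text \<open>The retraction is linear over S, so it moves V down to S while fixing G. Taking parts of
  degree b then preserves the equation because u and G are homogeneous.\<close>

lemma ex_homogeneous_partner:
  fixes u G :: "'a::field poly3 ^ 3"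
  assumes u: "\<And>i. homogeneous a (u $ i)" and G: "\<And>i. homogeneous (a + b) (G $ i)"
    and V: "liftv G = cross (liftv u) V"
  obtains v where "\<And>i. homogeneous b (v $ i)" "G = cross u v"
proof -
  obtain R :: "'a alg_closure poly3 \<Rightarrow> 'a poly3" where
    R: "\<And>A B. R (A + B) = R A + R B" "\<And>A B. R (lift3 A * B) = A * R B" "\<And>A. R (lift3 A) = A"
    using ex_retraction3 by metis
  have Rd: "R (A - B) = R A - R B" for A B using R(1)[of "A - B" B] by simp
  define v where "v = (\<chi> i. hpart b (R (V $ i)))"
  have e: "G $ i = cross u (\<chi> i. R (V $ i)) $ i" for i
  proof -
    have "G $ i = R (liftv G $ i)" by (simp add: R)
    also have "\<dots> = cross u (\<chi> i. R (V $ i)) $ i"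
      unfolding V using exhaust_3[of i] by (auto simp: cross_3 Rd R(2))
    finally show ?thesis .
  qed
  have "G $ i = cross u v $ i" for i
  proof -
    have "G $ i = hpart (a + b) (G $ i)" using hpart_homogeneous[OF G, of "a + b"] by simp
    also have "\<dots> = cross u v $ i"
      unfolding e using exhaust_3[of i]
      by (auto simp: cross_3 v_def hpart_mult_homogeneous[OF u])
    finally show ?thesis .
  qed
  then have "G = cross u v" by (simp add: vec_eq_iff)
  moreover have "homogeneous b (v $ i)" for i by (simp add: v_def homogeneous_hpart)
  ultimately show ?thesis using that by blast
qed

text \<open>For degree reasons the cross product of u and r2 is a constant times G. If the constant
  is nonzero, r2 rescaled is the partner of u. Otherwise u is a constant multiple of r2, so a = b
  and r1 rescaled takes over.\<close>

lemma basis_contains: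
  fixes G u r1 r2 :: "'a::field_char_0 poly3 ^ 3"
  assumes cG: "coprime3 (liftv G)" and hG: "\<And>i. homogeneous (a + b) (G $ i)"
    and cu: "coprime3 (liftv u)" and hu: "\<And>i. homogeneous a (u $ i)" and uG: "dot u G = 0"
    and r1: "\<And>i. homogeneous a (r1 $ i)" "dot G r1 = 0"
    and r2: "\<And>i. homogeneous b (r2 $ i)" "dot G r2 = 0"
    and c: "cross r1 r2 = const3 c *s G" "c \<noteq> 0"
  obtains v where "\<And>i. homogeneous b (v $ i)" "G = cross u v"
proof -
  obtain j where "liftv G $ j \<noteq> 0" using coprime3_nonzero[OF cG] by blast
  then have j: "G $ j \<noteq> 0" by simp
  have "cross (cross u r2) G = 0"
    using uG r2(2) by (simp add: cross_cross_left dot_commute[of _ G])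
  then obtain al where al: "cross u r2 = al *s G" using parallel_coprime3_descent[OF _ cG] by metis
  have "homogeneous (a + b) (cross u r2 $ j)"
    using exhaust_3[of j] by (auto simp: cross_3 intro!: homogeneous_diff homogeneous_mult hu r2(1))
  then have "homogeneous (a + b + 0) (G $ j * al)" by (simp add: al mult.commute)
  then have "homogeneous 0 al" by (rule homogeneous_cofactor[OF _ hG j])
  then obtain a0 where a0: "al = const3 a0" by (rule homogeneous_0_const)
  show ?thesis
  proof (cases "a0 = 0")
    case False
    have "cross u (const3 (1 / a0) *s r2) = G"
      by (simp add: cross_scale_right al a0 vector_smult_assoc const3_inverse[OF False])
    moreover have "homogeneous b ((const3 (1 / a0) *s r2) $ i)" for i
      unfolding vector_smult_component by (rule homogeneous_const3_mult[OF r2(1)])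
    ultimately show ?thesis using that by metis
  next
    case True
    then have par: "cross u r2 = 0" using al a0 by simp
    \<comment> \<open>A common factor of r2 divides the cross product with r1, hence G.\<close>
    have "coprime3 (liftv r2)"
      unfolding coprime3_def
    proof (intro allI impI)
      fix h assume h: "\<forall>i. h dvd liftv r2 $ i"
      have "h dvd liftv G $ i" for i
      proof -
        have "h dvd cross (liftv r1) (liftv r2) $ i"
          using h exhaust_3[of i] by (auto simp: cross_3 simp del: liftv_nth)
        also have "cross (liftv r1) (liftv r2) $ i = const3 (to_ac c) * liftv G $ i"
          unfolding liftv_cross[symmetric] c(1) by (simp add: lift3_const3)
        finally have d: "h dvd const3 (to_ac c) * liftv G $ i" .
        have "const3 (1 / to_ac c) * const3 (to_ac c) = (1 :: 'a alg_closure poly3)"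
          by (rule const3_inverse) (use c(2) in simp)
        moreover have "h dvd const3 (1 / to_ac c) * const3 (to_ac c) * liftv G $ i"
          unfolding mult.assoc by (rule dvd_mult[OF d])
        ultimately show ?thesis by (simp only: mult_1)
      qed
      then show "h dvd 1" using cG unfolding coprime3_def by blast
    qed
    then obtain ga where ga: "u = ga *s r2" using parallel_coprime3_descent[OF par] by metis
    have "lift3 ga dvd liftv u $ i" for i unfolding ga by simp
    then have "lift3 ga dvd 1" using cu unfolding coprime3_def by blast
    then have "ga dvd 1" using lift3_dvd_iff[of ga 1] by simp
    then obtain g0 where g0: "g0 \<noteq> 0" "ga = const3 g0" using is_unit_poly3_iff by blast
    obtain i where "liftv u $ i \<noteq> 0" using coprime3_nonzero[OF cu] by blast
    then have i: "u $ i \<noteq> 0" by simp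
    then have ri: "r2 $ i \<noteq> 0" using ga by auto
    have "homogeneous b (u $ i)" using homogeneous_const3_mult[OF r2(1)[of i], of g0] by (simp add: ga g0)
    then have ab: "a = b" using homogeneous_degree_unique[OF hu _ i] by blast
    have "cross r2 r1 = - (const3 c *s G)" using c(1) cross_skew[of r2 r1] by simp
    then have "cross u r1 = const3 (- (g0 * c)) *s G"
      by (simp add: ga g0 cross_scale_left vector_smult_assoc vec_eq_iff)
    moreover have "- (g0 * c) \<noteq> 0" using g0 c by simp
    ultimately have "cross u (const3 (1 / - (g0 * c)) *s r1) = G"
      using const3_inverse[of "- (g0 * c)"] by (simp add: cross_scale_right vector_smult_assoc del: const3_simps)
    moreover have "homogeneous b ((const3 (1 / - (g0 * c)) *s r1) $ i)" for i
      unfolding vector_smult_component by (rule homogeneous_const3_mult[OF r1(1)[unfolded ab]])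
    ultimately show ?thesis using that by metis
  qed
qed

theorem theorem2p7:
  fixes f g F :: "'a::field_char_0 poly3" and n k :: nat
  assumes "n \<ge> 1"
    and "reduced_curve n f" and "reduced_curve n g"
    and "no_common_component f g"
    and "general_member_smooth f g"
    and "\<forall>v. v \<noteq> 0 \<longrightarrow> reduced_curve n (pencil_member f g v)"
    and "card (base_locus f g) = n\<^sup>2"
    and "k > 1"
    and "union_of_members k f g F"
  shows "free_curve F (2 * n - 2) (n * (k - 2) + 1) \<longleftrightarrow>
    singular_members_union f g \<subseteq> curve_points (lift3 F) \<and>
    (\<forall>P \<in> pencil_sing f g. jacobian_lci_at F (point_prime P))"
proof -
  have hf: "homogeneous n f" and hg: "homogeneous n g" using assms(2,3) by (auto simp: reduced_curve_def)
  interpret L: pencil "lift3 f" "lift3 g" n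
    using pencil_if_reduced[OF assms(1) hf hg assms(5-7)] .
  obtain w where w: "\<forall>i<k. w i \<noteq> 0" "inj_on (\<lambda>i. proj_class (w i)) {..<k}"
    "lift3 F = (\<Prod>i<k. pencil_member f g (w i))"
    using assms(9) unfolding union_of_members_def by blast
  interpret L: pencil_union "lift3 f" "lift3 g" n k w
  proof
    show "k > 1" by (rule assms(8))
    show "w i \<noteq> 0" if "i < k" for i using w(1) that by blast
    show "det2 (w i) (w j) \<noteq> 0" if ij: "i < k" "j < k" "i \<noteq> j" for i j
    proof
      assume "det2 (w i) (w j) = 0"
      then obtain c where c: "w j = c *s w i" using L.m_parallel w(1) ij(1) by metis
      then have "c \<noteq> 0" using w(1) ij(2) by auto
      then have "proj_class (w i) = proj_class (w j)" using c proj_class_scale by metis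
      then show False using w(2) ij by (auto simp: inj_on_def)
    qed
  qed
  have LF: "L.F = lift3 F" unfolding L.F_def w(3) pencil_member_eq ..
  define u where "u = cross (grad f) (grad g)"
  have Lu: "L.u = liftv u" unfolding L.u_def u_def liftv_cross liftv_grad ..
  let ?a = "2 * n - 2" and ?b = "n * (k - 2) + 1"
  \<comment> \<open>The degree condition in Saito's criterion; n >= 1 and k >= 2 make the
    subtractions of natural numbers exact.\<close>
  have ab: "?a + ?b = n * k - 1"
  proof -
    obtain m where m: "n = Suc m" using assms(1) by (cases n) auto
    obtain l where l: "k = Suc (Suc l)" using assms(8) by (metis One_nat_def Suc_lessE less_SucE not_less_eq Suc_lessD)
    show ?thesis by (simp add: m l)
  qed
  have hF: "homogeneous (n * k) F" using L.hom_F by (simp add: LF)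
  have "Suc (n * k - 1) = n * k" using L.nk by (intro Suc_diff_1) linarith
  then have hF': "homogeneous (Suc (n * k - 1)) F" using hF by metis
  have cF: "coprime3 (liftv (grad F))" using L.coprime3_grad_F by (simp add: LF liftv_grad)
  have hu: "homogeneous ?a (u $ i)" for i using L.hom_u[of i] by (simp add: Lu)
  have cu: "coprime3 (liftv u)" using L.coprime3_u by (simp add: Lu)
  have "lift3 (dot u (grad F)) = 0" using L.dot_u_grad_F by (simp add: lift3_dot Lu LF liftv_grad)
  then have uF: "dot u (grad F) = 0" by simp
  have hG: "homogeneous (?a + ?b) (grad F $ i)" for i unfolding ab by (rule homogeneous_grad[OF hF])
  \<comment> \<open>Freeness is traded for an equation over S that is linear in v and can therefore
    be tested over the closure.\<close>
  have "free_curve F ?a ?b \<longleftrightarrow> (\<exists>v. (\<forall>i. homogeneous ?b (v $ i)) \<and> grad F = cross u v)"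
  proof
    assume "free_curve F ?a ?b"
    from basis_if_free[OF hF cF ab this] obtain r1 r2 c where
      "\<And>i. homogeneous ?a (r1 $ i)" "dot (grad F) r1 = 0" "\<And>i. homogeneous ?b (r2 $ i)" "dot (grad F) r2 = 0"
      "cross r1 r2 = const3 c *s grad F" "c \<noteq> 0" by metis
    from basis_contains[OF cF hG cu hu uF this]
    show "\<exists>v. (\<forall>i. homogeneous ?b (v $ i)) \<and> grad F = cross u v" by metis
  next
    assume "\<exists>v. (\<forall>i. homogeneous ?b (v $ i)) \<and> grad F = cross u v"
    then obtain v where v: "\<And>i. homogeneous ?b (v $ i)" "grad F = cross u v" by blast
    show "free_curve F ?a ?b"
    proof (rule free_curve_if_basis[OF hF cF ab hu _ v(1)])
      show "dot (grad F) u = 0" using uF by (simp add: dot_commute)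
      show "dot (grad F) v = 0" by (simp add: v(2) dot_commute)
      show "cross u v = const3 1 *s grad F" using v(2) by simp
    qed simp
  qed
  also have "\<dots> \<longleftrightarrow> singular_members_union f g \<subseteq> curve_points (lift3 F) \<and>
    (\<forall>P \<in> pencil_sing f g. jacobian_lci_at F (point_prime P))"
  proof
    assume "\<exists>v. (\<forall>i. homogeneous ?b (v $ i)) \<and> grad F = cross u v"
    then obtain v where v: "\<And>i. homogeneous ?b (v $ i)" "grad F = cross u v" by blast
    have Lv: "grad L.F = cross L.u (liftv v)"
      unfolding LF Lu liftv_cross[symmetric] v(2)[symmetric] liftv_grad ..
    have partner: "evalv (liftv v) p \<noteq> 0" "eval3 L.F p = 0"
      if "p \<noteq> 0" "x \<noteq> 0" "evalv (grad (L.m x)) p = 0" for p x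
      using L.nonvanishing_partner[OF Lv that(1) L.zero_of_singular_member(1)[OF that(2,3)]] by blast+
    show "singular_members_union f g \<subseteq> curve_points (lift3 F) \<and>
      (\<forall>P \<in> pencil_sing f g. jacobian_lci_at F (point_prime P))"
    proof (intro conjI subsetI ballI)
      fix P assume "P \<in> singular_members_union f g"
      then obtain x where x: "x \<noteq> 0" "P \<in> curve_points (L.m x)" "singular_points (L.m x) \<noteq> {}"
        unfolding singular_members_union_def pencil_member_eq by blast
      then obtain p where p: "p \<noteq> 0" "evalv (grad (L.m x)) p = 0"
        using singular_pointsE[OF _ L.hom_m] by blast
      have "L.m x dvd lift3 F"
        using L.member_dvd_F_if_singular[OF x(1) p(1,2) partner(2)[OF p(1) x(1) p(2)]] by (simp add: LF)
      then show "P \<in> curve_points (lift3 F)" using x(2) eval3_dvd unfolding curve_points_def by blast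
    next
      fix P assume "P \<in> pencil_sing f g"
      then obtain x where x: "x \<noteq> 0" "P \<in> singular_points (L.m x)"
        unfolding pencil_sing_def pencil_member_eq by blast
      then obtain p where p: "p \<noteq> 0" "P = proj_class p" "evalv (grad (L.m x)) p = 0"
        using singular_pointsE[OF _ L.hom_m] by metis
      have "dot v (grad F) = 0" by (simp add: v(2))
      then show "jacobian_lci_at F (point_prime P)"
        unfolding p(2) lci_iff_syzygy[OF hF' p(1)]
        using v(1) partner(1)[OF p(1) x(1) p(3)] by blast
    qed
  next
    assume R: "singular_members_union f g \<subseteq> curve_points (lift3 F) \<and>
      (\<forall>P \<in> pencil_sing f g. jacobian_lci_at F (point_prime P))"
    \<comment> \<open>The solution is found over the closure, with no control of degree or field of
      definition; \<open>ex_homogeneous_partner\<close> supplies both.\<close>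
    have "\<exists>V. grad L.F = cross L.u V"
    proof (rule L.ex_partner)
      fix p assume p: "p \<noteq> 0" "evalv L.u p = 0"
      obtain x where x: "x \<noteq> 0" "evalv (grad (L.m x)) p = 0" using L.singular_member_of_zero[OF p(2)] .
      have z: "eval3 (L.m x) p = 0" using L.zero_of_singular_member(2)[OF x] .
      have s: "proj_class p \<in> singular_points (L.m x)"
        unfolding singular_points_iff[OF L.hom_m p(1)] using x z by blast
      then have "proj_class p \<in> singular_members_union f g"
        unfolding singular_members_union_def pencil_member_eq using x(1) by (auto simp: singular_points_def)
      then have "proj_class p \<in> curve_points (lift3 F)" using R by blast
      then have "eval3 (lift3 F) p = 0" using curve_points_iff[OF _ p(1)] hF by (metis homogeneous_lift3)
      moreover have "proj_class p \<in> pencil_sing f g"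
        unfolding pencil_sing_def pencil_member_eq using s x(1) by blast
      then have lci: "jacobian_lci_at F (point_prime (proj_class p))" using R by blast
      obtain e b where "\<And>i. homogeneous e (b $ i)" "dot b (grad F) = 0" "evalv (liftv b) p \<noteq> 0"
        using lci unfolding lci_iff_syzygy[OF hF' p(1)] by blast
      then have "(\<forall>i. homogeneous e (liftv b $ i)) \<and> dot (liftv b) (grad L.F) = 0 \<and> evalv (liftv b) p \<noteq> 0"
        unfolding LF liftv_grad[symmetric] lift3_dot[symmetric] by simp
      ultimately show "eval3 L.F p = 0 \<and> (\<exists>d b. (\<forall>i. homogeneous d (b $ i)) \<and> dot b (grad L.F) = 0 \<and> evalv b p \<noteq> 0)"
        unfolding LF by blast
    qed blast
    then obtain V where V: "liftv (grad F) = cross (liftv u) V" by (auto simp: LF Lu liftv_grad)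
    from ex_homogeneous_partner[OF hu hG V] show "\<exists>v. (\<forall>i. homogeneous ?b (v $ i)) \<and> grad F = cross u v" by metis
  qed
  finally show ?thesis .
qed

end
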